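(* Suppose that for each subsolution $w$ the functions $T_c^-w$ and $-T_c^+w$ are locally semiconcave on $M$. Given a subsolution $u$, there exists a subsolution $v$ such that: (i) $v=u$ on $\mathcal{A}_u$; (ii) $v$ is smooth and free on the complement of $\mathcal{A}_u$; (iii) $v$ is locally $C^{1,1}$; (iv) $v$ is strict at each pair $(x,y)\in M\times M$ at which $u$ is strict.
   Context: $M$ is a smooth connected Riemannian manifold, and $c:M\times M\to\mathbb{R}$ is a given function (the cost). A function $u:M\to\mathbb{R}$ (not assumed continuous) is called a subsolution if $u(y)-u(x)\leq c(x,y)$ for all $(x,y)\in M\times M$. The discrete Lax--Oleinik operators are $T_c^-u(x)=\inf_{y\in M}\big(u(y)+c(y,x)\big)$ and $T_c^+u(x)=\sup_{y\in M}\big(u(y)-c(x,y)\big)$. A function is locally semiconcave (with linear modulus) if each point has a chart neighbourhood in which the function is the sum of a concave function and a smooth function. A function is locally $C^{1,1}$ if it is $C^1$ with locally Lipschitz differential. A subsolution $u$ is free at $x$ if $T_c^+u(x)<u(x)<T_c^-u(x)$, and free on a set if it is free at each point of it. It is strict at $(x,y)$ if $u(y)-u(x)<c(x,y)$. For a subsolution $u$, $\mathcal{A}_u=\{x\in M : T_c^+u(x)=u(x)=T_c^-u(x)\}$. *)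

theory Defs
  imports "HOL-Analysis.Analysis"
begin

section \<open>Smooth maps between Euclidean spaces\<close>

text \<open>The predicates below are meant for open \<open>S\<close>; the values of \<open>f\<close> outside \<open>S\<close> are
  then irrelevant.\<close>

fun Ck_on :: "nat \<Rightarrow> 'a::euclidean_space set \<Rightarrow> ('a \<Rightarrow> 'b::real_normed_vector) \<Rightarrow> bool" where
  "Ck_on 0 S f \<longleftrightarrow> continuous_on S f"
| "Ck_on (Suc k) S f \<longleftrightarrow>
     (\<forall>x\<in>S. f differentiable (at x)) \<and>
     (\<forall>v. Ck_on k S (\<lambda>x. frechet_derivative f (at x) v))"

definition smooth_on :: "'a::euclidean_space set \<Rightarrow> ('a \<Rightarrow> 'b::real_normed_vector) \<Rightarrow> bool" where
  "smooth_on S f \<longleftrightarrow> (\<forall>k. Ck_on k S f)"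


section \<open>Smooth Riemannian manifolds\<close>

text \<open>The manifold is the whole type \<open>'m\<close> with its topology. A chart is a pair of its domain
  and a coordinate map, of which only the values on the domain matter.\<close>

type_synonym ('m, 'e) chart = "'m set \<times> ('m \<Rightarrow> 'e)"

definition chart :: "('m::topological_space, 'e::euclidean_space) chart \<Rightarrow> bool" where
  "chart = (\<lambda>(U, \<phi>). open U \<and> open (\<phi> ` U) \<and> homeomorphism U (\<phi> ` U) \<phi> (inv_into U \<phi>))"

definition in_chart :: "('m, 'e) chart \<Rightarrow> ('m \<Rightarrow> 'b) \<Rightarrow> 'e \<Rightarrow> 'b" where
  "in_chart = (\<lambda>(U, \<phi>) f z. f (inv_into U \<phi> z))"

definition compatible :: "('m, 'e::euclidean_space) chart \<Rightarrow> ('m, 'e) chart \<Rightarrow> bool" where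
  "compatible = (\<lambda>(U, \<phi>) (V, \<psi>).
     smooth_on (\<phi> ` (U \<inter> V)) (in_chart (U, \<phi>) \<psi>) \<and>
     smooth_on (\<psi> ` (U \<inter> V)) (in_chart (V, \<psi>) \<phi>))"

text \<open>A smooth structure is a maximal smooth atlas, so charts may be restricted freely to
  smaller open sets.\<close>

definition smooth_structure :: "('m::topological_space, 'e::euclidean_space) chart set \<Rightarrow> bool" where
  "smooth_structure A \<longleftrightarrow>
     (\<forall>k\<in>A. chart k) \<and>
     (\<Union>(U, \<phi>)\<in>A. U) = UNIV \<and>
     (\<forall>k\<in>A. \<forall>l\<in>A. compatible k l) \<and>
     (\<forall>k. chart k \<and> (\<forall>l\<in>A. compatible k l) \<longrightarrow> k \<in> A)"

text \<open>A Riemannian metric in coordinates: \<open>g k p\<close> is the inner product on the tangent space at \<open>p\<close>,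
  identified with \<open>'e\<close> by the differential of the chart \<open>k\<close>. The last condition is the
  transformation law under change of charts.\<close>

definition riemannian_metric ::
  "('m::topological_space, 'e::euclidean_space) chart set \<Rightarrow>
   (('m, 'e) chart \<Rightarrow> 'm \<Rightarrow> 'e \<Rightarrow> 'e \<Rightarrow> real) \<Rightarrow> bool" where
  "riemannian_metric A g \<longleftrightarrow>
     (\<forall>(U, \<phi>)\<in>A.
        (\<forall>p\<in>U. bilinear (g (U, \<phi>) p) \<and>
               (\<forall>v w. g (U, \<phi>) p v w = g (U, \<phi>) p w v) \<and>
               (\<forall>v. v \<noteq> 0 \<longrightarrow> 0 < g (U, \<phi>) p v v)) \<and>
        (\<forall>v w. smooth_on (\<phi> ` U) (in_chart (U, \<phi>) (\<lambda>p. g (U, \<phi>) p v w))) \<and>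
        (\<forall>(V, \<psi>)\<in>A. \<forall>p\<in>U \<inter> V. \<forall>v w.
           g (U, \<phi>) p v w =
             g (V, \<psi>) p (frechet_derivative (in_chart (U, \<phi>) \<psi>) (at (\<phi> p)) v)
                        (frechet_derivative (in_chart (U, \<phi>) \<psi>) (at (\<phi> p)) w)))"


section \<open>Regularity of functions on a manifold\<close>

definition smooth_fun_on ::
  "('m, 'e::euclidean_space) chart set \<Rightarrow> 'm set \<Rightarrow> ('m \<Rightarrow> real) \<Rightarrow> bool" where
  "smooth_fun_on A W f \<longleftrightarrow>
     (\<forall>x\<in>W. \<exists>(U, \<phi>)\<in>A. x \<in> U \<and> smooth_on (\<phi> ` U) (in_chart (U, \<phi>) f))"

text \<open>Note that \<^const>\<open>concave_on\<close> includes convexity of the set \<open>\<phi> ` U\<close>.\<close>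

definition locally_semiconcave ::
  "('m, 'e::euclidean_space) chart set \<Rightarrow> ('m \<Rightarrow> real) \<Rightarrow> bool" where
  "locally_semiconcave A f \<longleftrightarrow>
     (\<forall>x. \<exists>(U, \<phi>)\<in>A. x \<in> U \<and>
        (\<exists>h s. concave_on (\<phi> ` U) h \<and> smooth_on (\<phi> ` U) s \<and>
               (\<forall>p\<in>U. f p = h (\<phi> p) + s (\<phi> p))))"

text \<open>Lipschitz continuity of \<open>D\<close> on \<open>\<phi> ` U\<close> makes the local representative \<open>C\<^sup>1\<close> there.\<close>

definition locally_C11 ::
  "('m, 'e::euclidean_space) chart set \<Rightarrow> ('m \<Rightarrow> real) \<Rightarrow> bool" where
  "locally_C11 A f \<longleftrightarrow>
     (\<forall>x. \<exists>(U, \<phi>)\<in>A. x \<in> U \<and>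
        (\<exists>(D :: 'e \<Rightarrow> 'e \<Rightarrow>\<^sub>L real) L.
           (\<forall>z\<in>\<phi> ` U. (in_chart (U, \<phi>) f has_derivative blinfun_apply (D z)) (at z)) \<and>
           L-lipschitz_on (\<phi> ` U) D))"


section \<open>Subsolutions and the discrete Lax-Oleinik operators\<close>

definition subsolution :: "('m \<Rightarrow> 'm \<Rightarrow> real) \<Rightarrow> ('m \<Rightarrow> real) \<Rightarrow> bool" where
  "subsolution c u \<longleftrightarrow> (\<forall>x y. u y - u x \<le> c x y)"

text \<open>The infimum and supremum are taken in the reals. For a subsolution \<open>u\<close> they are finite:
  \<open>u x\<close> is a lower bound of the values \<open>u y + c y x\<close> and an upper bound of the values
  \<open>u y - c x y\<close>.\<close>

definition Tminus :: "('m \<Rightarrow> 'm \<Rightarrow> real) \<Rightarrow> ('m \<Rightarrow> real) \<Rightarrow> 'm \<Rightarrow> real" where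
  "Tminus c u x = (INF y. u y + c y x)"

definition Tplus :: "('m \<Rightarrow> 'm \<Rightarrow> real) \<Rightarrow> ('m \<Rightarrow> real) \<Rightarrow> 'm \<Rightarrow> real" where
  "Tplus c u x = (SUP y. u y - c x y)"

definition free_at :: "('m \<Rightarrow> 'm \<Rightarrow> real) \<Rightarrow> ('m \<Rightarrow> real) \<Rightarrow> 'm \<Rightarrow> bool" where
  "free_at c u x \<longleftrightarrow> Tplus c u x < u x \<and> u x < Tminus c u x"

definition strict_at :: "('m \<Rightarrow> 'm \<Rightarrow> real) \<Rightarrow> ('m \<Rightarrow> real) \<Rightarrow> 'm \<Rightarrow> 'm \<Rightarrow> bool" where
  "strict_at c u x y \<longleftrightarrow> u y - u x < c x y"

definition aubry :: "('m \<Rightarrow> 'm \<Rightarrow> real) \<Rightarrow> ('m \<Rightarrow> real) \<Rightarrow> 'm set" where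
  "aubry c u = {x. Tplus c u x = u x \<and> u x = Tminus c u x}"

end

theory Submission
  imports Defs
begin

text \<open>Write \<open>T\<^sup>-\<close> and \<open>T\<^sup>+\<close> for the two Lax-Oleinik operators. The
  subsolution \<open>w = (u + T\<^sup>- u) / 2\<close> satisfies \<open>T\<^sup>+ w \<le> (T\<^sup>+ u +
  u) / 2 \<le> w\<close>, so \<open>T\<^sup>+ w\<close> is strictly below \<open>w\<close> exactly off the
  set \<open>\<A>\<close> where \<open>T\<^sup>+ u = u = T\<^sup>- u\<close>. Put \<open>a = T\<^sup>+
  w\<close> and \<open>b = T\<^sup>- a\<close>. Then \<open>a \<le> w \<le> b\<close>, with \<open>a = b =
  u\<close> on \<open>\<A>\<close> and \<open>a < b\<close> off \<open>\<A>\<close>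
  (\<open>free_subsolution\<close>), and \<open>- a\<close> and \<open>b\<close> are locally semiconcave
  by hypothesis. Every function \<open>v\<close> with \<open>a \<le> v \<le> b\<close> is a subsolution
  with \<open>T\<^sup>+ v \<le> a\<close> and \<open>b \<le> T\<^sup>- v\<close>, because \<open>b =
  T\<^sup>- a\<close>. Hence \<open>v\<close> is free wherever \<open>a < v < b\<close>. Freeness also
  gives the strictness claim: if \<open>v y - v x = c x y\<close>, then \<open>v\<close> is free neither
  at \<open>x\<close> nor at \<open>y\<close>, both points lie in \<open>\<A>\<close>, where \<open>v =
  u\<close>, and \<open>u\<close> is not strict at \<open>(x, y)\<close>.

  It remains to insert, between a locally semiconvex \<open>a\<close> and a locally semiconcave
  \<open>b\<close>, a locally \<open>C\<^sup>1\<^sup>,\<^sup>1\<close> function that is smooth and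
  strictly between them wherever \<open>a < b\<close> (\<open>manifold_insertion\<close>, a version of
  Ilmanen's lemma). Lying between \<open>a\<close> and \<open>b\<close> is preserved by convex
  combinations, so a partition of unity reduces this to one chart, and multiplying \<open>a\<close> and
  \<open>b\<close> by the same bump function reduces it to bounded functions on a Euclidean space
  (\<open>smooth_strict_insertion\<close>).

  There all regularity is expressed by the second difference \<open>f (x + z) + f (x - z) - 2 f x\<close>:
  an upper bound by \<open>C \<bar>z\<bar>\<^sup>2\<close> is semiconcavity, and a two-sided one gives
  \<open>C\<^sup>1\<^sup>,\<^sup>1\<close> regularity (\<open>bounded_second_diff_derivative\<close>). If
  \<open>q\<close> is the quadratic form that makes \<open>a + q\<close> convex, the inserted function is
  \<open>H - q\<close>, where \<open>H\<close> is the largest convex function below \<open>b + q\<close>;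
  that \<open>H\<close> inherits the semiconcavity of \<open>b + q\<close> is immediate from its
  maximality (\<open>semiconcave_insertion\<close>). To obtain strict inequalities on \<open>\<Omega> = {a
  < b}\<close>, the same is done with \<open>a + \<delta>\<close> and \<open>b - \<delta>\<close> for a
  small \<open>\<delta>\<close> that is positive exactly on \<open>\<Omega>\<close>. To obtain smoothness
  on \<open>\<Omega>\<close>, the result is replaced by \<open>\<Sum> g\<^sub>i F\<^sub>i\<close>, where
  the \<open>g\<^sub>i\<close> form a partition of unity of \<open>\<Omega>\<close> and the
  \<open>F\<^sub>i\<close> are mollifications at scales that decrease so fast that second differences
  remain bounded up to the boundary of \<open>\<Omega>\<close> and beyond.\<close>

section \<open>Calculus of smooth maps\<close>

lemma frechet_derivative_cong:
  assumes "open S" "x \<in> S" "\<And>y. y \<in> S \<Longrightarrow> f y = g y"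
  shows "frechet_derivative f (at x) = frechet_derivative g (at x)"
proof -
  have "(f has_derivative D) (at x) \<longleftrightarrow> (g has_derivative D) (at x)" for D
    using has_derivative_transform_within_open[OF _ assms(1,2)] assms(3) by (metis (full_types))
  then show ?thesis by (simp add: frechet_derivative_def)
qed

lemma Ck_on_cong:
  assumes "open S" "\<And>x. x \<in> S \<Longrightarrow> f x = g x"
  shows "Ck_on k S f \<longleftrightarrow> Ck_on k S g"
  using assms(2)
proof (induction k arbitrary: f g)
  case 0
  then show ?case by (simp cong: continuous_on_cong)
next
  case (Suc k)
  have "frechet_derivative f (at x) = frechet_derivative g (at x)" if "x \<in> S" for x
    using frechet_derivative_cong[OF \<open>open S\<close> that] Suc.prems by blast
  then have "Ck_on k S (\<lambda>x. frechet_derivative f (at x) v) = Ck_on k S (\<lambda>x. frechet_derivative g (at x) v)" for v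
    by (intro Suc.IH) simp
  moreover have "f differentiable (at x) \<longleftrightarrow> g differentiable (at x)" if "x \<in> S" for x
    unfolding differentiable_def
    using has_derivative_transform_within_open[OF _ \<open>open S\<close> that] Suc.prems by (metis (full_types))
  ultimately show ?case by simp
qed

lemma Ck_on_subset: "Ck_on k S f \<Longrightarrow> T \<subseteq> S \<Longrightarrow> Ck_on k T f"
  by (induction k arbitrary: f) (auto intro: continuous_on_subset)

lemma Ck_on_continuous: "Ck_on k S f \<Longrightarrow> continuous_on S f"
  by (cases k) (auto intro!: continuous_at_imp_continuous_on differentiable_imp_continuous_within)

lemma Ck_on_SucD: "Ck_on (Suc k) S f \<Longrightarrow> Ck_on k S f"
proof (induction k arbitrary: f)
  case 0
  then show ?case using Ck_on_continuous by fastforce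
next
  case (Suc k)
  have "Ck_on k S (\<lambda>x. frechet_derivative f (at x) v)" for v
    using Suc.IH Suc.prems unfolding Ck_on.simps(2)[of "Suc k"] by blast
  then show ?case using Suc.prems by simp
qed

lemma Ck_on_SucI:
  assumes "open S" and "\<And>x. x \<in> S \<Longrightarrow> (f has_derivative D x) (at x)"
    and "\<And>v. Ck_on k S (\<lambda>x. D x v)"
  shows "Ck_on (Suc k) S f"
proof -
  have "frechet_derivative f (at x) = D x" if "x \<in> S" for x
    using frechet_derivative_at[OF assms(2)[OF that]] by simp
  then have "Ck_on k S (\<lambda>x. frechet_derivative f (at x) v)" for v
    using Ck_on_cong[OF \<open>open S\<close>, of "\<lambda>x. frechet_derivative f (at x) v" "\<lambda>x. D x v"] assms(3) by simp
  then show ?thesis using assms(2) by (auto simp: differentiable_def)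
qed

lemma Ck_on_has_derivative:
  "Ck_on (Suc k) S f \<Longrightarrow> x \<in> S \<Longrightarrow> (f has_derivative frechet_derivative f (at x)) (at x)"
  by (simp add: frechet_derivative_works)

lemma Ck_on_local:
  assumes "\<And>x. x \<in> S \<Longrightarrow> \<exists>T. open T \<and> x \<in> T \<and> Ck_on k T f"
  shows "Ck_on k S f"
  using assms
proof (induction k arbitrary: f)
  case 0
  then show ?case
    by (auto intro!: continuous_at_imp_continuous_on) (metis continuous_on_eq_continuous_at)
next
  case (Suc k)
  have "Ck_on k S (\<lambda>x. frechet_derivative f (at x) v)" for v
    by (rule Suc.IH) (metis Ck_on.simps(2) Suc.prems)
  moreover have "f differentiable (at x)" if "x \<in> S" for x
    using Suc.prems[OF that] by auto
  ultimately show ?case by simp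
qed

lemma Ck_on_const: "Ck_on k S (\<lambda>x. c)"
  by (induction k arbitrary: c) simp_all

lemma Ck_on_add:
  assumes "open S" shows "Ck_on k S f \<Longrightarrow> Ck_on k S g \<Longrightarrow> Ck_on k S (\<lambda>x. f x + g x)"
proof (induction k arbitrary: f g)
  case 0
  then show ?case by (simp add: continuous_on_add)
next
  case (Suc k)
  show ?case
    by (rule Ck_on_SucI[OF assms has_derivative_add[OF Ck_on_has_derivative Ck_on_has_derivative]])
      (use Suc in auto)
qed

lemma Ck_on_bounded_linear:
  assumes "open S" "bounded_linear l" shows "Ck_on k S f \<Longrightarrow> Ck_on k S (\<lambda>x. l (f x))"
proof (induction k arbitrary: f)
  case 0
  then show ?case by (simp add: assms bounded_linear.continuous_on)
next
  case (Suc k)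
  show ?case
    by (rule Ck_on_SucI[OF assms(1) bounded_linear.has_derivative[OF assms(2) Ck_on_has_derivative]])
      (use Suc in auto)
qed

lemma Ck_on_bilinear:
  assumes "open S" "bounded_bilinear p"
  shows "Ck_on k S f \<Longrightarrow> Ck_on k S g \<Longrightarrow> Ck_on k S (\<lambda>x. p (f x) (g x))"
proof (induction k arbitrary: f g)
  case 0
  then show ?case by (simp add: assms bounded_bilinear.continuous_on)
next
  case (Suc k)
  have "Ck_on k S f" "Ck_on k S g" using Suc.prems by (auto dest: Ck_on_SucD simp del: Ck_on.simps)
  then show ?case
    by (intro Ck_on_SucI[OF assms(1) bounded_bilinear.FDERIV[OF assms(2) Ck_on_has_derivative Ck_on_has_derivative]])
      (use Suc in \<open>auto intro!: Ck_on_add assms(1)\<close>)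
qed

lemma Ck_on_id: "Ck_on k S (\<lambda>x. x)"
proof (cases k)
  case (Suc m)
  have "Ck_on (Suc m) UNIV (\<lambda>x::'a. x)"
    by (rule Ck_on_SucI[OF open_UNIV has_derivative_ident]) (rule Ck_on_const)
  then show ?thesis using Ck_on_subset[OF _ subset_UNIV] Suc by blast
qed (simp add: continuous_on_id)

lemma Ck_on_sum:
  assumes "open S" "\<And>i. i \<in> I \<Longrightarrow> Ck_on k S (f i)"
  shows "Ck_on k S (\<lambda>x. \<Sum>i\<in>I. f i x)"
  using assms(2)
  by (induction I rule: infinite_finite_induct) (auto intro!: Ck_on_const Ck_on_add[OF assms(1)])

text \<open>Linearity turns the chain rule into a finite sum of products of functions \<open>D\<^sub>v g \<bullet>
  i\<close> with functions \<open>(D\<^sub>i f) \<circ> g\<close>. The closure properties of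
  \<^const>\<open>Ck_on\<close> apply to such sums, and the induction in \<open>Ck_on_compose\<close>
  rests on this.\<close>

lemma frechet_derivative_basis:
  fixes f :: "'a::euclidean_space \<Rightarrow> 'b::real_normed_vector"
  assumes "f differentiable (at x)"
  shows "frechet_derivative f (at x) v = (\<Sum>i\<in>Basis. (v \<bullet> i) *\<^sub>R frechet_derivative f (at x) i)"
proof -
  interpret bounded_linear "frechet_derivative f (at x)"
    using assms frechet_derivative_works has_derivative_bounded_linear by blast
  show ?thesis
    by (subst euclidean_representation[of v, symmetric]) (simp add: sum scaleR del: euclidean_representation_sum)
qed

lemma Ck_on_compose:
  fixes f :: "'b::euclidean_space \<Rightarrow> 'c::real_normed_vector" and g :: "'a::euclidean_space \<Rightarrow> 'b"
  assumes "open S" "open T" "g ` S \<subseteq> T"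
  shows "Ck_on k T f \<Longrightarrow> Ck_on k S g \<Longrightarrow> Ck_on k S (\<lambda>x. f (g x))"
proof (induction k arbitrary: f)
  case 0
  then show ?case using assms(3) by (auto intro: continuous_on_compose2)
next
  case (Suc k)
  have g: "Ck_on k S g" using Suc.prems(2) Ck_on_SucD by blast
  show ?case
  proof (rule Ck_on_SucI[OF assms(1)])
    fix x assume x: "x \<in> S"
    then have "g x \<in> T" using assms(3) by auto
    then have f: "f differentiable (at (g x))" using Suc.prems(1) by simp
    have "((\<lambda>x. f (g x)) has_derivative (\<lambda>v. frechet_derivative f (at (g x)) (frechet_derivative g (at x) v))) (at x)"
      using has_derivative_compose[OF Ck_on_has_derivative[OF Suc.prems(2) x]
          Ck_on_has_derivative[OF Suc.prems(1) \<open>g x \<in> T\<close>]] by simp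
    then show "((\<lambda>x. f (g x)) has_derivative (\<lambda>v. \<Sum>i\<in>Basis. (frechet_derivative g (at x) v \<bullet> i) *\<^sub>R
        frechet_derivative f (at (g x)) i)) (at x)"
      by (simp only: frechet_derivative_basis[OF f, symmetric])
  next
    fix v
    have "Ck_on k S (\<lambda>x. frechet_derivative g (at x) v)" using Suc.prems(2) by simp
    moreover have "Ck_on k S (\<lambda>x. frechet_derivative f (at (g x)) i)" for i
      using Suc.IH[of "\<lambda>y. frechet_derivative f (at y) i"] Suc.prems(1) g by simp
    ultimately show "Ck_on k S (\<lambda>x. \<Sum>i\<in>Basis. (frechet_derivative g (at x) v \<bullet> i) *\<^sub>R
        frechet_derivative f (at (g x)) i)"
      by (intro Ck_on_sum assms(1) Ck_on_bilinear[OF assms(1) bounded_bilinear_scaleR]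
          Ck_on_bounded_linear[OF assms(1) bounded_linear_inner_left])
  qed
qed

lemma smooth_on_cong: "open S \<Longrightarrow> (\<And>x. x \<in> S \<Longrightarrow> f x = g x) \<Longrightarrow> smooth_on S f \<longleftrightarrow> smooth_on S g"
  unfolding smooth_on_def using Ck_on_cong by blast

lemma smooth_on_subset: "smooth_on S f \<Longrightarrow> T \<subseteq> S \<Longrightarrow> smooth_on T f"
  unfolding smooth_on_def using Ck_on_subset by blast

lemma smooth_on_local:
  "(\<And>x. x \<in> S \<Longrightarrow> \<exists>T. open T \<and> x \<in> T \<and> smooth_on T f) \<Longrightarrow> smooth_on S f"
  unfolding smooth_on_def using Ck_on_local by meson

lemma smooth_on_continuous: "smooth_on S f \<Longrightarrow> continuous_on S f"
  unfolding smooth_on_def using Ck_on_continuous by blast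

lemma smooth_on_const: "smooth_on S (\<lambda>x. c)"
  by (simp add: smooth_on_def Ck_on_const)

lemma smooth_on_id: "smooth_on S (\<lambda>x. x)"
  by (simp add: smooth_on_def Ck_on_id)

lemma smooth_on_add: "open S \<Longrightarrow> smooth_on S f \<Longrightarrow> smooth_on S g \<Longrightarrow> smooth_on S (\<lambda>x. f x + g x)"
  by (simp add: smooth_on_def Ck_on_add)

lemma smooth_on_bilinear:
  "open S \<Longrightarrow> bounded_bilinear p \<Longrightarrow> smooth_on S f \<Longrightarrow> smooth_on S g \<Longrightarrow> smooth_on S (\<lambda>x. p (f x) (g x))"
  by (simp add: smooth_on_def Ck_on_bilinear)

lemmas smooth_on_mult = smooth_on_bilinear[OF _ bounded_bilinear_mult]

lemma smooth_on_diff: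
  "open S \<Longrightarrow> smooth_on S f \<Longrightarrow> smooth_on S g \<Longrightarrow> smooth_on S (\<lambda>x. f x - g x)"
  using smooth_on_add[of S f "\<lambda>x. - g x"] Ck_on_bounded_linear[OF _ bounded_linear_minus[OF bounded_linear_ident], of S _ g]
  by (simp add: smooth_on_def)

lemma smooth_on_sum:
  "open S \<Longrightarrow> (\<And>i. i \<in> I \<Longrightarrow> smooth_on S (f i)) \<Longrightarrow> smooth_on S (\<lambda>x. \<Sum>i\<in>I. f i x)"
  by (simp add: smooth_on_def Ck_on_sum)

lemma smooth_on_prod:
  fixes f :: "'i \<Rightarrow> 'a::euclidean_space \<Rightarrow> real"
  assumes "open S" "\<And>i. i \<in> I \<Longrightarrow> smooth_on S (f i)"
  shows "smooth_on S (\<lambda>x. \<Prod>i\<in>I. f i x)"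
  using assms(2)
  by (induction I rule: infinite_finite_induct) (auto intro!: smooth_on_const smooth_on_mult[OF assms(1)])

lemma smooth_on_compose:
  fixes f :: "'b::euclidean_space \<Rightarrow> 'c::real_normed_vector" and g :: "'a::euclidean_space \<Rightarrow> 'b"
  shows "open S \<Longrightarrow> open T \<Longrightarrow> g ` S \<subseteq> T \<Longrightarrow> smooth_on T f \<Longrightarrow> smooth_on S g \<Longrightarrow> smooth_on S (\<lambda>x. f (g x))"
  unfolding smooth_on_def using Ck_on_compose by blast

section \<open>Bump functions\<close>

lemma smooth_on_inverse:
  fixes f :: "'a::euclidean_space \<Rightarrow> real"
  assumes "open S" "smooth_on S f" "\<And>x. x \<in> S \<Longrightarrow> f x \<noteq> 0"
  shows "smooth_on S (\<lambda>x. inverse (f x))"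
proof (rule smooth_on_compose[OF assms(1) _ _ _ assms(2)])
  show op: "open (- {0::real})" by auto
  show "f ` S \<subseteq> - {0}" using assms(3) by auto
  have "Ck_on k (- {0}) (inverse :: real \<Rightarrow> real)" for k
  proof (induction k)
    case 0
    then show ?case by (auto intro!: continuous_intros)
  next
    case (Suc k)
    show ?case
    proof (rule Ck_on_SucI[OF op has_derivative_inverse'])
      show "Ck_on k (- {0}) (\<lambda>x::real. - (inverse x * v * inverse x))" for v
        by (intro Ck_on_bounded_linear[OF op bounded_linear_minus[OF bounded_linear_ident]]
            Ck_on_bilinear[OF op bounded_bilinear_mult] Suc Ck_on_const)
    qed simp
  qed
  then show "smooth_on (- {0}) (inverse :: real \<Rightarrow> real)" by (simp add: smooth_on_def)
qed

text \<open>The derivatives of \<open>exp (- 1 / t)\<close>, extended by zero, all have this form, so one induction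
  over all polynomials at once shows that the function is smooth.\<close>

definition flat_exp :: "real poly \<Rightarrow> real \<Rightarrow> real" where
  "flat_exp p t = (if t > 0 then poly p (1 / t) * exp (- (1 / t)) else 0)"

lemma flat_exp_tendsto_0: "(flat_exp p \<longlongrightarrow> 0) (at 0)"
proof -
  have "((\<lambda>s. poly p s * exp (- s)) \<longlongrightarrow> 0) at_top"
  proof (induction p)
    case 0
    then show ?case by simp
  next
    case (pCons a p)
    have "((\<lambda>s. poly q s / exp s) \<longlongrightarrow> 0) at_top" for q :: "real poly"
    proof -
      have "((\<lambda>s. \<Sum>i\<le>degree q. coeff q i * (s ^ i / exp s)) \<longlongrightarrow> (\<Sum>i\<le>degree q. coeff q i * 0)) at_top"
        by (intro tendsto_intros tendsto_power_div_exp_0)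
      then show ?thesis by (simp add: poly_altdef sum_divide_distrib)
    qed
    from this[of "pCons a p"] show ?case by (simp add: exp_minus field_simps)
  qed
  from filterlim_compose[OF this filterlim_inverse_at_top_right]
  have "((\<lambda>t. poly p (inverse t) * exp (- inverse t)) \<longlongrightarrow> 0) (at_right 0)" .
  then have "(flat_exp p \<longlongrightarrow> 0) (at_right 0)"
    by (rule Lim_transform_eventually)
      (auto simp: flat_exp_def eventually_at_filter field_simps)
  moreover have "(flat_exp p \<longlongrightarrow> 0) (at_left 0)"
    by (rule tendsto_eventually) (auto simp: flat_exp_def eventually_at_filter)
  ultimately show ?thesis by (simp add: filterlim_split_at)
qed

lemma flat_exp_derivative:
  "(flat_exp p has_field_derivative flat_exp ([:0, 0, 1:] * (p - pderiv p)) t) (at t)"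
proof (cases t "0::real" rule: linorder_cases)
  case less
  have "((\<lambda>_. 0) has_field_derivative 0) (at t)" by simp
  then have "(flat_exp p has_field_derivative 0) (at t)"
    by (rule has_field_derivative_transform_within_open[where S="{..<0}"]) (use less in \<open>auto simp: flat_exp_def\<close>)
  then show ?thesis using less by (simp add: flat_exp_def)
next
  case greater
  have "((\<lambda>t. poly p (1 / t) * exp (- (1 / t))) has_field_derivative
      flat_exp ([:0, 0, 1:] * (p - pderiv p)) t) (at t)"
    using greater
    by (auto intro!: derivative_eq_intros simp: flat_exp_def field_simps power2_eq_square)
  then show ?thesis
    by (rule has_field_derivative_transform_within_open[where S="{0<..}"]) (use greater in \<open>auto simp: flat_exp_def\<close>)
next
  case equal
  have "((\<lambda>h. flat_exp p h / h) \<longlongrightarrow> 0) (at 0)"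
    by (rule Lim_transform_eventually[OF flat_exp_tendsto_0[of "[:0,1:] * p"]])
      (auto simp: flat_exp_def field_simps eventually_at_filter)
  then show ?thesis using equal by (simp add: DERIV_def flat_exp_def)
qed

lemma smooth_on_flat_exp: "smooth_on UNIV (flat_exp p)"
proof -
  have "Ck_on k UNIV (flat_exp p)" for k
  proof (induction k arbitrary: p)
    case 0
    then show ?case
      using flat_exp_derivative by (auto intro!: continuous_at_imp_continuous_on DERIV_isCont)
  next
    case (Suc k)
    show ?case
      by (rule Ck_on_SucI[OF open_UNIV flat_exp_derivative[unfolded has_field_derivative_def]])
        (intro Ck_on_bilinear[OF open_UNIV bounded_bilinear_mult] Suc Ck_on_const)
  qed
  then show ?thesis by (simp add: smooth_on_def)
qed

lemma smooth_step_exists: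
  "\<exists>s::real \<Rightarrow> real. smooth_on UNIV s \<and> (\<forall>t. 0 \<le> s t \<and> s t \<le> 1) \<and> (\<forall>t\<le>0. s t = 0) \<and> (\<forall>t\<ge>1. s t = 1)"
proof -
  \<comment> \<open>the step is \<open>\<theta> t / (\<theta> t + \<theta> (1 - t))\<close> with \<open>\<theta> t = exp (- 1 / t)\<close> for positive \<open>t\<close>\<close>
  define \<theta> where "\<theta> = flat_exp 1"
  have \<theta>: "\<theta> t \<ge> 0" "t > 0 \<Longrightarrow> \<theta> t > 0" "t \<le> 0 \<Longrightarrow> \<theta> t = 0" for t
    by (auto simp: \<theta>_def flat_exp_def)
  have pos: "\<theta> t + \<theta> (1 - t) > 0" for t
    using \<theta>(1)[of t] \<theta>(2)[of t] \<theta>(1)[of "1 - t"] \<theta>(2)[of "1 - t"] by (cases "t > 0") auto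
  have s\<theta>: "smooth_on UNIV \<theta>" using smooth_on_flat_exp by (simp add: \<theta>_def)
  have "smooth_on UNIV (\<lambda>t. \<theta> (1 - t))"
    by (rule smooth_on_compose[OF _ _ _ s\<theta>]) (auto intro!: smooth_on_diff smooth_on_const smooth_on_id)
  then have "smooth_on UNIV (\<lambda>t. \<theta> t * inverse (\<theta> t + \<theta> (1 - t)))"
    by (intro smooth_on_mult smooth_on_inverse smooth_on_add s\<theta>) (use pos in \<open>auto simp: less_imp_neq\<close>, metis pos less_irrefl)
  moreover have "0 \<le> \<theta> t * inverse (\<theta> t + \<theta> (1 - t))" "\<theta> t * inverse (\<theta> t + \<theta> (1 - t)) \<le> 1" for t
    using \<theta>(1)[of t] \<theta>(1)[of "1-t"] pos[of t] by (auto simp: field_simps)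
  moreover have "\<theta> t * inverse (\<theta> t + \<theta> (1 - t)) = 1" if "t \<ge> 1" for t
    using \<theta>(2)[of t] \<theta>(3)[of "1-t"] that by auto
  ultimately show ?thesis using \<theta>(3) by (intro exI[of _ "\<lambda>t. \<theta> t * inverse (\<theta> t + \<theta> (1 - t))"]) auto
qed

lemma smooth_bump_exists:
  fixes p :: "'a::euclidean_space"
  assumes "0 < r" "r < R"
  shows "\<exists>\<rho>::'a \<Rightarrow> real. smooth_on UNIV \<rho> \<and> (\<forall>x. 0 \<le> \<rho> x \<and> \<rho> x \<le> 1) \<and>
    (\<forall>x\<in>cball p r. \<rho> x = 1) \<and> (\<forall>x. x \<notin> ball p R \<longrightarrow> \<rho> x = 0)"
proof -
  obtain s :: "real \<Rightarrow> real" where s: "smooth_on UNIV s" "\<And>t. 0 \<le> s t \<and> s t \<le> 1"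
    "\<And>t. t \<le> 0 \<Longrightarrow> s t = 0" "\<And>t. t \<ge> 1 \<Longrightarrow> s t = 1"
    using smooth_step_exists by blast
  \<comment> \<open>a quadratic polynomial, smooth also at \<open>p\<close>, that is 1 at distance \<open>r\<close> and 0 at distance \<open>R\<close>\<close>
  define N where "N x = (R\<^sup>2 - (x - p) \<bullet> (x - p)) * inverse (R\<^sup>2 - r\<^sup>2)" for x
  have Rr: "r\<^sup>2 < R\<^sup>2" using assms by (simp add: power_strict_mono)
  have "smooth_on UNIV N"
    unfolding N_def
    by (intro smooth_on_mult smooth_on_diff smooth_on_const smooth_on_bilinear[OF _ bounded_bilinear_inner] smooth_on_id open_UNIV)
  then have 1: "smooth_on UNIV (\<lambda>x. s (N x))" by (intro smooth_on_compose[OF _ _ _ s(1)]) auto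
  have Nd: "N x = (R\<^sup>2 - (dist x p)\<^sup>2) / (R\<^sup>2 - r\<^sup>2)" for x
    by (simp add: N_def dist_norm power2_norm_eq_inner field_simps)
  have 2: "s (N x) = 1" if "x \<in> cball p r" for x
  proof -
    have "(dist x p)\<^sup>2 \<le> r\<^sup>2" using that by (intro power_mono) (auto simp: dist_commute)
    then show ?thesis using Rr by (intro s) (simp add: Nd)
  qed
  have 3: "s (N x) = 0" if "x \<notin> ball p R" for x
  proof -
    have "R\<^sup>2 \<le> (dist x p)\<^sup>2" using that assms by (intro power_mono) (auto simp: dist_commute)
    then show ?thesis using Rr by (intro s) (simp add: Nd field_simps)
  qed
  show ?thesis using 1 2 3 s(2) by (intro exI[of _ "\<lambda>x. s (N x)"]) auto
qed

section \<open>Second differences\<close>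

definition second_diff :: "('a::real_vector \<Rightarrow> 'b::real_vector) \<Rightarrow> 'a \<Rightarrow> 'a \<Rightarrow> 'b" where
  "second_diff f x z = f (x + z) + f (x - z) - 2 *\<^sub>R f x"

definition semiconcave_with :: "real \<Rightarrow> ('a::real_normed_vector \<Rightarrow> real) \<Rightarrow> bool" where
  "semiconcave_with C f \<longleftrightarrow> (\<forall>x z. second_diff f x z \<le> C * (norm z)\<^sup>2)"

definition bounded_second_diff :: "real \<Rightarrow> ('a::real_normed_vector \<Rightarrow> real) \<Rightarrow> bool" where
  "bounded_second_diff C f \<longleftrightarrow> (\<forall>x z. \<bar>second_diff f x z\<bar> \<le> C * (norm z)\<^sup>2)"

lemma second_diff_add: "second_diff (\<lambda>x. f x + g x) x z = second_diff f x z + second_diff g x z"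
  by (simp add: second_diff_def scaleR_add_right)

lemma second_diff_uminus: "second_diff (\<lambda>x. - f x) x z = - second_diff f x z"
  by (simp add: second_diff_def)

lemma second_diff_diff: "second_diff (\<lambda>x. f x - g x) x z = second_diff f x z - second_diff g x z"
  by (simp add: second_diff_def scaleR_diff_right)

lemma second_diff_cmult: "second_diff (\<lambda>x. c * f x) x z = c * (second_diff f x z :: real)"
  by (simp add: second_diff_def algebra_simps)

lemma bounded_second_diff_iff:
  "bounded_second_diff C f \<longleftrightarrow> semiconcave_with C f \<and> semiconcave_with C (\<lambda>x. - f x)"
  unfolding bounded_second_diff_def semiconcave_with_def second_diff_uminus
  by (smt (verit, best))

text \<open>This produces the derivative \<open>lim 2\<^sup>k (f (x + 2\<^sup>-\<^sup>k z) - f x)\<close> together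
  with the error of the first-order Taylor expansion.\<close>

lemma geometric_increments_converge:
  fixes s :: "nat \<Rightarrow> real"
  assumes "\<And>k. \<bar>s (Suc k) - s k\<bar> \<le> c * (1/2) ^ k"
  obtains l where "s \<longlonglongrightarrow> l" "\<bar>s 0 - l\<bar> \<le> 2 * c"
proof -
  have g: "(\<lambda>k. c * (1/2::real) ^ k) sums (c * 2)"
    using sums_mult[OF geometric_sums[of "1/2::real"], of c] by simp
  have sm: "summable (\<lambda>k. s (Suc k) - s k)"
    by (rule summable_comparison_test'[OF sums_summable[OF g]]) (use assms in auto)
  define t where "t = (\<Sum>k. s (Suc k) - s k)"
  have "(\<lambda>n. s 0 + (\<Sum>k<n. s (Suc k) - s k)) \<longlonglongrightarrow> s 0 + t"
    unfolding t_def by (intro tendsto_intros summable_LIMSEQ sm)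
  then have "s \<longlonglongrightarrow> s 0 + t" by (simp add: sum_lessThan_telescope)
  moreover have "norm t \<le> (\<Sum>k. c * (1/2::real) ^ k)"
    unfolding t_def by (rule norm_suminf_le) (use assms sums_summable[OF g] in auto)
  ultimately show thesis using that[of "s 0 + t"] sums_unique[OF g] by (simp add: mult.commute)
qed

text \<open>The function \<open>t \<mapsto> l (t z) - t l z\<close> is additive and vanishes at the integers, so it
  is 1-periodic and hence bounded; a bounded additive function is zero.\<close>

lemma additive_bounded_imp_homogeneous:
  fixes l :: "'a::real_normed_vector \<Rightarrow> real"
  assumes add: "\<And>z w. l (z + w) = l z + l w" and bd: "\<And>z. \<bar>l z\<bar> \<le> A + B * (norm z)\<^sup>2" "B \<ge> 0"
  shows "l (r *\<^sub>R z) = r * l z"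
proof -
  have l0: "l 0 = 0" using add[of 0 0] by simp
  have nat: "l (real n *\<^sub>R z) = n * l z" for n z
    by (induction n) (auto simp: l0 algebra_simps add)
  have neg: "l (- z) = - l z" for z using add[of z "-z"] l0 by simp
  have int: "l (real_of_int m *\<^sub>R z) = m * l z" for m z
    using nat[of "nat m" z] nat[of "nat (- m)" z] neg[of "real (nat (- m)) *\<^sub>R z"]
    by (cases "m \<ge> 0") auto
  define E where "E = A + B * (norm z)\<^sup>2 + \<bar>l z\<bar>"
  have "n * \<bar>l (r *\<^sub>R z) - r * l z\<bar> \<le> E" for n :: nat
  proof -
    define t where "t = frac (n * r)"
    have t: "0 \<le> t" "t < 1" "n * r = of_int \<lfloor>n * r\<rfloor> + t"
      unfolding t_def by (simp_all add: frac_lt_1) (simp add: frac_def)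
    have "n * l (r *\<^sub>R z) = l ((n * r) *\<^sub>R z)" using nat[of n "r *\<^sub>R z"] by simp
    also have "\<dots> = \<lfloor>n * r\<rfloor> * l z + l (t *\<^sub>R z)" by (subst t(3)) (simp only: scaleR_add_left add int)
    finally have "n * (l (r *\<^sub>R z) - r * l z) = l (t *\<^sub>R z) - t * l z"
      using t(3) by (simp add: algebra_simps) (metis distrib_left mult.commute mult.left_commute)
    moreover have "\<bar>l (t *\<^sub>R z)\<bar> \<le> A + B * (norm z)\<^sup>2"
    proof -
      have "norm (t *\<^sub>R z) \<le> norm z" using t by (simp add: mult_left_le_one_le)
      then have "B * (norm (t *\<^sub>R z))\<^sup>2 \<le> B * (norm z)\<^sup>2"
        by (intro mult_left_mono power_mono bd) auto
      then show ?thesis using bd(1)[of "t *\<^sub>R z"] by simp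
    qed
    moreover have "\<bar>t * l z\<bar> \<le> \<bar>l z\<bar>" using t by (simp add: abs_mult mult_left_le_one_le)
    ultimately have "\<bar>n * (l (r *\<^sub>R z) - r * l z)\<bar> \<le> E" unfolding E_def by linarith
    then show ?thesis by (simp add: abs_mult)
  qed
  then have "\<bar>l (r *\<^sub>R z) - r * l z\<bar> \<le> 0"
    by (metis (no_types, opaque_lifting) ex_less_of_nat_mult linorder_not_less)
  then show ?thesis by simp
qed

lemma bounded_second_diff_nonneg:
  fixes f :: "'a::euclidean_space \<Rightarrow> real"
  assumes "bounded_second_diff C f" shows "C \<ge> 0"
proof -
  obtain b :: 'a where "b \<in> Basis" using nonempty_Basis by blast
  then show ?thesis
    using assms abs_ge_zero[of "second_diff f 0 b"] unfolding bounded_second_diff_def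
    by (metis mult.right_neutral norm_Basis one_power2 order_trans)
qed

text \<open>The dyadic difference quotients at \<open>x\<close> in direction \<open>z\<close> differ by second
  differences, so they converge geometrically, to \<open>l x z\<close>. Comparing \<open>f y + f w\<close>
  with twice the value at the midpoint of \<open>y\<close> and \<open>w\<close> gives everything else:
  additivity of \<open>l x\<close>, when \<open>y\<close> and \<open>w\<close> approach \<open>x\<close>
  along two directions, and the Lipschitz estimate, when the midpoint is the centre of a parallelogram,
  whose two diagonals are compared.\<close>

lemma bounded_second_diff_derivative:
  fixes f :: "'a::euclidean_space \<Rightarrow> real"
  assumes sd: "bounded_second_diff C f" and B: "\<And>x. \<bar>f x\<bar> \<le> B"
  obtains D :: "'a \<Rightarrow> 'a \<Rightarrow>\<^sub>L real" where
    "\<And>x. (f has_derivative blinfun_apply (D x)) (at x)"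
    "(3 * C)-lipschitz_on UNIV D"
    "\<And>x z. \<bar>f (x + z) - f x - D x z\<bar> \<le> C * (norm z)\<^sup>2"
proof -
  note C0 = bounded_second_diff_nonneg[OF sd]
  have sd': "\<bar>f y + f w - 2 * f ((1/2) *\<^sub>R (y + w))\<bar> \<le> C * (norm (y - w))\<^sup>2 / 4" for y w
  proof -
    have e: "(1/2) *\<^sub>R (y + w) + (1/2) *\<^sub>R (y - w) = y" "(1/2) *\<^sub>R (y + w) - (1/2) *\<^sub>R (y - w) = w"
      unfolding scaleR_add_right scaleR_diff_right by (simp_all flip: scaleR_add_left)
    show ?thesis
      using sd[unfolded bounded_second_diff_def second_diff_def, rule_format, of "(1/2) *\<^sub>R (y + w)" "(1/2) *\<^sub>R (y - w)"]
      unfolding e by (simp add: power_mult_distrib power2_eq_square)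
  qed
  define d where "d x z k = 2 ^ k * (f (x + (1/2) ^ k *\<^sub>R z) - f x)" for x z and k :: nat
  have dadd: "\<bar>d x z k + d x w k - d x (z + w) (Suc k)\<bar> \<le> C * (norm (z - w))\<^sup>2 / 4 * (1/2) ^ k" for x z w k
  proof -
    have "x + (1/2) ^ k *\<^sub>R z + (x + (1/2) ^ k *\<^sub>R w) = 2 *\<^sub>R x + (1/2) ^ k *\<^sub>R (z + w)"
      by (simp add: scaleR_add_right scaleR_2)
    then have e: "(1/2) *\<^sub>R (x + (1/2) ^ k *\<^sub>R z + (x + (1/2) ^ k *\<^sub>R w)) = x + (1/2) ^ Suc k *\<^sub>R (z + w)"
      by (simp only:) (simp add: scaleR_add_right)
    have e2: "norm (x + (1/2) ^ k *\<^sub>R z - (x + (1/2) ^ k *\<^sub>R w)) = (1/2) ^ k * norm (z - w)"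
      by (simp flip: scaleR_diff_right)
    have "d x z k + d x w k - d x (z + w) (Suc k) = 2 ^ k *
       (f (x + (1/2) ^ k *\<^sub>R z) + f (x + (1/2) ^ k *\<^sub>R w) - 2 * f (x + (1/2) ^ Suc k *\<^sub>R (z + w)))"
      by (simp add: d_def algebra_simps)
    also have "\<bar>\<dots>\<bar> \<le> 2 ^ k * (C * ((1/2) ^ k * norm (z - w))\<^sup>2 / 4)"
      using sd'[of "x + (1/2) ^ k *\<^sub>R z" "x + (1/2) ^ k *\<^sub>R w"] unfolding e e2 by (simp add: abs_mult)
    also have "\<dots> = C * (norm (z - w))\<^sup>2 / 4 * (1/2) ^ k"
      by (simp add: power_mult_distrib power2_eq_square power_one_over)
    finally show ?thesis .
  qed
  have "\<exists>l. d x z \<longlonglongrightarrow> l \<and> \<bar>d x z 0 - l\<bar> \<le> 2 * (C * (norm z)\<^sup>2 / 4)" for x z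
  proof -
    have "\<bar>d x z (Suc k) - d x z k\<bar> \<le> C * (norm z)\<^sup>2 / 4 * (1/2) ^ k" for k
      using dadd[of x z k 0] by (simp add: d_def abs_minus_commute)
    from geometric_increments_converge[OF this] show ?thesis by blast
  qed
  then obtain l where l: "\<And>x z. d x z \<longlonglongrightarrow> l x z" "\<And>x z. \<bar>d x z 0 - l x z\<bar> \<le> 2 * (C * (norm z)\<^sup>2 / 4)"
    by metis
  have taylor2: "\<bar>f (x + z) - f x - l x z\<bar> \<le> C * (norm z)\<^sup>2 / 2" for x z
    using l(2)[of x z] by (simp add: d_def)
  have l_add: "l x (z + w) = l x z + l x w" for x z w
  proof -
    have "(\<lambda>k. d x z k + d x w k - d x (z + w) (Suc k)) \<longlonglongrightarrow> l x z + l x w - l x (z + w)"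
      by (intro tendsto_intros l LIMSEQ_Suc)
    moreover have "(\<lambda>k. d x z k + d x w k - d x (z + w) (Suc k)) \<longlonglongrightarrow> 0"
    proof (rule Lim_null_comparison)
      show "(\<lambda>k. C * (norm (z - w))\<^sup>2 / 4 * (1/2::real) ^ k) \<longlonglongrightarrow> 0"
        by (rule tendsto_mult_right_zero[OF LIMSEQ_power_zero]) simp
    qed (use dadd in auto)
    ultimately show ?thesis using LIMSEQ_unique by force
  qed
  have bd: "\<bar>l x z\<bar> \<le> 2 * B + C * (norm z)\<^sup>2" for x z
  proof -
    have "C * (norm z)\<^sup>2 \<ge> 0" using C0 by simp
    then show ?thesis using taylor2[of x z] B[of x] B[of "x + z"] by linarith
  qed
  have l_scale: "l x (r *\<^sub>R z) = r * l x z" for x r z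
    by (rule additive_bounded_imp_homogeneous[OF l_add bd C0])
  have bl: "bounded_linear (l x)" for x
  proof (rule bounded_linear_intro)
    show "norm (l x z) \<le> norm z * (2 * B + C)" for z
    proof (cases "z = 0")
      case True
      then show ?thesis using l_add[of x 0 0] by simp
    next
      case False
      have "l x z = norm z * l x (z /\<^sub>R norm z)" using False by (simp add: l_scale field_simps)
      moreover have "\<bar>l x (z /\<^sub>R norm z)\<bar> \<le> 2 * B + C" using bd[of x "z /\<^sub>R norm z"] False by simp
      ultimately show ?thesis by (simp add: abs_mult mult_left_mono)
    qed
  qed (simp_all add: l_add l_scale)
  define D where "D x = Blinfun (l x)" for x
  have D: "blinfun_apply (D x) = l x" for x
    unfolding D_def by (rule bounded_linear_Blinfun_apply[OF bl])
  have taylor: "\<bar>f (x + z) - f x - D x z\<bar> \<le> C * (norm z)\<^sup>2" for x z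
  proof -
    have "C * (norm z)\<^sup>2 \<ge> 0" using C0 by simp
    then show ?thesis using taylor2[of x z] by (simp add: D)
  qed
  show thesis
  proof (rule that[OF _ _ taylor])
    fix x
    show "(f has_derivative blinfun_apply (D x)) (at x)"
    proof (rule has_derivativeI_sandwich[where e=1 and H="\<lambda>y. C * norm (y - x)"])
      show "norm (f y - f x - D x (y - x)) / norm (y - x) \<le> C * norm (y - x)" if "y \<noteq> x" for y
        using taylor[of x "y - x"] that by (simp add: field_simps power2_eq_square)
      show "((\<lambda>y. C * norm (y - x)) \<longlongrightarrow> 0) (at x)" by (auto intro!: tendsto_eq_intros)
    qed (auto intro: blinfun.bounded_linear_right)
  next
    have *: "\<bar>(D (x + w) - D x) z\<bar> \<le> 3 * C * (norm w)\<^sup>2" if "norm z = norm w" for x w z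
    proof -
      have e: "x + w + z + x = (x + w) + (x + z)" by simp
      have "C * (norm (x + w + z - x))\<^sup>2 \<le> C * (2 * norm w)\<^sup>2" "C * (norm (x + w - (x + z)))\<^sup>2 \<le> C * (2 * norm w)\<^sup>2"
        using norm_triangle_ineq[of w z] norm_triangle_ineq4[of w z] that
        by (intro mult_left_mono[OF _ C0] power_mono; simp add: algebra_simps)+
      moreover have "C * (2 * norm w)\<^sup>2 = 4 * (C * (norm w)\<^sup>2)" by (simp add: power_mult_distrib)
      ultimately have "\<bar>f (x + w + z) - f (x + w) - f (x + z) + f x\<bar> \<le> 2 * (C * (norm w)\<^sup>2)"
        using sd'[of "x + w + z" x] sd'[of "x + w" "x + z"] unfolding e by linarith
      moreover have "\<bar>f (x + z) - f x - l x z\<bar> \<le> C * (norm w)\<^sup>2 / 2"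
        "\<bar>f (x + w + z) - f (x + w) - l (x + w) z\<bar> \<le> C * (norm w)\<^sup>2 / 2"
        using taylor2[of x z] taylor2[of "x + w" z] that by simp_all
      ultimately have "\<bar>l (x + w) z - l x z\<bar> \<le> 3 * (C * (norm w)\<^sup>2)" by linarith
      then show ?thesis by (simp add: blinfun.diff_left D)
    qed
    show "(3 * C)-lipschitz_on UNIV D"
    proof (rule lipschitz_onI)
      fix x y :: 'a
      define w where "w = y - x"
      have "norm (D (x + w) - D x) \<le> 3 * C * norm w"
      proof (rule norm_blinfun_bound)
        fix z
        show "norm ((D (x + w) - D x) z) \<le> 3 * C * norm w * norm z"
        proof (cases "z = 0 \<or> w = 0")
          case True
          then show ?thesis by (auto simp: blinfun.zero_right)
        next
          case False
          then have "norm ((norm w / norm z) *\<^sub>R z) = norm w" by simp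
          from *[OF this, of x] False show ?thesis
            by (simp add: blinfun.scaleR_right abs_mult field_simps power2_eq_square)
        qed
      qed (use C0 in auto)
      then show "dist (D x) (D y) \<le> 3 * C * dist x y"
        by (simp add: w_def dist_norm norm_minus_commute)
    qed (use C0 in auto)
  qed
qed

text \<open>Interpolation between \<open>C\<^sup>0\<close> and \<open>C\<^sup>1\<^sup>,\<^sup>1\<close>: uniform
  smallness forces the first derivative to be small. Thus a mollification need only be controlled in the
  uniform norm.\<close>

lemma lipschitz_on_interpolation:
  fixes f :: "'a::euclidean_space \<Rightarrow> real"
  assumes sd: "bounded_second_diff C f" and f: "\<And>x. \<bar>f x\<bar> \<le> s\<^sup>2" and s: "s > 0"
  shows "((2 + C) * s)-lipschitz_on UNIV f"
proof -
  note C0 = bounded_second_diff_nonneg[OF sd]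
  obtain D :: "'a \<Rightarrow> 'a \<Rightarrow>\<^sub>L real" where D:
    "\<And>x. (f has_derivative blinfun_apply (D x)) (at x)"
    "\<And>x z. \<bar>f (x + z) - f x - D x z\<bar> \<le> C * (norm z)\<^sup>2"
    using bounded_second_diff_derivative[OF sd f] by metis
  have *: "norm (D x) \<le> (2 + C) * s" for x
  proof (rule norm_blinfun_bound)
    fix z
    show "norm (D x z) \<le> (2 + C) * s * norm z"
    proof (cases "z = 0")
      case False
      \<comment> \<open>length \<open>s\<close> balances the size \<open>s\<^sup>2\<close> of \<open>f\<close> against the Taylor error \<open>C s\<^sup>2\<close>\<close>
      define z' where "z' = (s / norm z) *\<^sub>R z"
      have "norm z' = s" using s False by (simp add: z'_def)
      then have "\<bar>D x z'\<bar> \<le> (2 + C) * s\<^sup>2"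
        using D(2)[of x z'] f[of x] f[of "x + z'"] by (simp add: algebra_simps)
      then have "s / norm z * \<bar>D x z\<bar> \<le> s / norm z * ((2 + C) * s * norm z)" using s False
        by (simp add: z'_def blinfun.scaleR_right abs_mult power2_eq_square mult_ac)
      then show ?thesis using s False
        by (subst (asm) mult_le_cancel_left_pos) auto
    qed (simp add: blinfun.zero_right)
  qed (use C0 s in auto)
  show ?thesis
  proof (rule lipschitz_onI)
    fix x y :: 'a
    have "norm (f x - f y) \<le> (2 + C) * s * norm (x - y)"
      by (rule differentiable_bound[where S=UNIV and f'="\<lambda>x. blinfun_apply (D x)"])
        (use D(1) * in \<open>auto simp: norm_blinfun.rep_eq[symmetric]\<close>)
    then show "dist (f x) (f y) \<le> (2 + C) * s * dist x y" by (simp add: dist_norm)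
  qed (use C0 s in auto)
qed

lemma bounded_second_diff_lipschitz:
  fixes f :: "'a::euclidean_space \<Rightarrow> real"
  assumes "bounded_second_diff C f" "\<And>x. \<bar>f x\<bar> \<le> B"
  obtains L where "L-lipschitz_on UNIV f"
proof -
  have "B \<ge> 0" using assms(2)[of 0] by simp
  then have "\<bar>f x\<bar> \<le> (sqrt (B + 1))\<^sup>2" for x using assms(2)[of x] by simp
  from lipschitz_on_interpolation[OF assms(1) this] \<open>B \<ge> 0\<close> that show thesis by simp
qed

section \<open>Insertion of functions with bounded second differences\<close>

text \<open>The largest (midpoint-)convex function \<open>H\<close> below \<open>h = b + q\<close> lies above
  \<open>a + q\<close>, which is one of the competitors. For fixed \<open>z\<close>, the function \<open>x
  \<mapsto> (H (x + z) + H (x - z) - 2 C \<bar>z\<bar>\<^sup>2) / 2\<close> is again convex, and it is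
  below \<open>h\<close> by the semiconcavity of \<open>h\<close>. So it is below \<open>H\<close>, and
  this is the semiconcavity of \<open>H\<close>. The argument needs all translates, hence functions on the
  whole space.\<close>

lemma semiconcave_insertion:
  fixes a b :: "'a::real_inner \<Rightarrow> real"
  assumes ab: "\<And>x. a x \<le> b x" and b: "semiconcave_with C b" and a: "semiconcave_with C (\<lambda>x. - a x)"
  obtains f where "\<And>x. a x \<le> f x" "\<And>x. f x \<le> b x" "bounded_second_diff C f"
proof -
  define q where "q x = C / 2 * (x \<bullet> x)" for x :: 'a
  have q: "second_diff q x z = C * (norm z)\<^sup>2" for x z
    by (simp add: second_diff_def q_def power2_norm_eq_inner algebra_simps inner_commute)
  define h where "h x = b x + q x" for x
  have h: "second_diff h x z \<le> 2 * C * (norm z)\<^sup>2" for x z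
  proof -
    have "second_diff h x z = second_diff b x z + second_diff q x z"
      by (simp add: h_def second_diff_def)
    then show ?thesis using b q[of x z] by (simp add: semiconcave_with_def)
  qed
  define \<G> where "\<G> = {G. (\<forall>x z. second_diff G x z \<ge> 0) \<and> (\<forall>x. G x \<le> h x)}"
  define H where "H x = (SUP G\<in>\<G>. G x)" for x
  have aq: "(\<lambda>x. a x + q x) \<in> \<G>"
    using a q ab by (auto simp: \<G>_def h_def second_diff_add semiconcave_with_def second_diff_uminus)
      (smt (verit))
  have bdd: "bdd_above ((\<lambda>G. G x) ` \<G>)" for x
    by (rule bdd_aboveI[of _ "h x"]) (auto simp: \<G>_def)
  have upper: "G x \<le> H x" if "G \<in> \<G>" for G x
    unfolding H_def using that bdd by (intro cSUP_upper)
  have least: "H x \<le> y" if "\<And>G. G \<in> \<G> \<Longrightarrow> G x \<le> y" for x y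
    unfolding H_def using that aq by (intro cSUP_least) auto
  have Hh: "H x \<le> h x" for x by (rule least) (auto simp: \<G>_def)
  have H0: "second_diff H x z \<ge> 0" for x z
  proof -
    have "H x \<le> (H (x + z) + H (x - z)) / 2"
    proof (rule least)
      fix G assume G: "G \<in> \<G>"
      then have "second_diff G x z \<ge> 0" by (simp add: \<G>_def)
      then show "G x \<le> (H (x + z) + H (x - z)) / 2"
        using upper[OF G, of "x + z"] upper[OF G, of "x - z"] by (simp add: second_diff_def)
    qed
    then show ?thesis by (simp add: second_diff_def)
  qed
  have H1: "second_diff H x z \<le> 2 * C * (norm z)\<^sup>2" for x z
  proof -
    define G where "G x = (H (x + z) + H (x - z) - 2 * C * (norm z)\<^sup>2) / 2" for x
    have "G y \<le> h y" for y
      using h[of y z] Hh[of "y + z"] Hh[of "y - z"] by (simp add: G_def second_diff_def)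
    moreover have "second_diff G y w = (second_diff H (y + z) w + second_diff H (y - z) w) / 2" for y w
    proof -
      have "y + w + z = y + z + w" "y - w + z = y + z - w" "y + w - z = y - z + w" "y - w - z = y - z - w"
        by (simp_all add: algebra_simps)
      then show ?thesis unfolding second_diff_def G_def by (simp add: field_simps)
    qed
    moreover have "second_diff G y w \<ge> 0" if "second_diff G y w = (second_diff H (y + z) w + second_diff H (y - z) w) / 2" for y w
      using H0[of "y + z" w] H0[of "y - z" w] that by simp
    ultimately have "G \<in> \<G>" by (simp add: \<G>_def)
    from upper[OF this, of x] show ?thesis by (simp add: G_def second_diff_def)
  qed
  show thesis
  proof (rule that[of "\<lambda>x. H x - q x"])
    show "a x \<le> H x - q x" for x using upper[OF aq, of x] by simp
    show "H x - q x \<le> b x" for x using Hh[of x] by (simp add: h_def)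
    show "bounded_second_diff C (\<lambda>x. H x - q x)"
      unfolding bounded_second_diff_def second_diff_diff q
      using H0 H1 by (auto simp: abs_le_iff mult.assoc)
  qed
qed

section \<open>Local semiconcavity\<close>

text \<open>The Lipschitz bound is part of the notion because stability under changes of coordinates and under
  multiplication by smooth functions depends on it. The same constant serves for both bounds.\<close>

definition semiconcave_on :: "'a::real_normed_vector set \<Rightarrow> real \<Rightarrow> ('a \<Rightarrow> real) \<Rightarrow> bool" where
  "semiconcave_on S L f \<longleftrightarrow> L-lipschitz_on S f \<and>
     (\<forall>x z. x + z \<in> S \<longrightarrow> x - z \<in> S \<longrightarrow> second_diff f x z \<le> L * (norm z)\<^sup>2)"

text \<open>The two-sided version, for vector-valued maps, so that it applies to coordinate changes.\<close>

definition c11_on :: "'a::real_normed_vector set \<Rightarrow> real \<Rightarrow> ('a \<Rightarrow> 'b::real_normed_vector) \<Rightarrow> bool" where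
  "c11_on S L f \<longleftrightarrow> L-lipschitz_on S f \<and>
     (\<forall>x z. x + z \<in> S \<longrightarrow> x - z \<in> S \<longrightarrow> norm (second_diff f x z) \<le> L * (norm z)\<^sup>2)"

definition semiconcave_near :: "('a::real_normed_vector \<Rightarrow> real) \<Rightarrow> 'a \<Rightarrow> bool" where
  "semiconcave_near f p \<longleftrightarrow> (\<exists>r>0. \<exists>L. semiconcave_on (ball p r) L f)"

definition c11_near :: "('a::real_normed_vector \<Rightarrow> 'b::real_normed_vector) \<Rightarrow> 'a \<Rightarrow> bool" where
  "c11_near f p \<longleftrightarrow> (\<exists>r>0. \<exists>L. c11_on (ball p r) L f)"

lemma midpoint_in_convex: "convex S \<Longrightarrow> x + z \<in> S \<Longrightarrow> x - z \<in> S \<Longrightarrow> x \<in> S"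
  for x :: "'a::real_vector"
proof -
  assume "convex S" "x + z \<in> S" "x - z \<in> S"
  then have "(1/2) *\<^sub>R (x + z) + (1/2) *\<^sub>R (x - z) \<in> S" by (intro convexD) auto
  moreover have "(1/2) *\<^sub>R (x + z) + (1/2) *\<^sub>R (x - z) = x"
    unfolding scaleR_add_right scaleR_diff_right by (simp flip: scaleR_add_left)
  ultimately show "x \<in> S" by simp
qed

lemma semiconcave_on_mono:
  "semiconcave_on S L f \<Longrightarrow> T \<subseteq> S \<Longrightarrow> L \<le> M \<Longrightarrow> semiconcave_on T M f"
  unfolding semiconcave_on_def
  by (meson lipschitz_on_mono mult_right_mono order_trans subsetD zero_le_power2)

lemma c11_on_mono: "c11_on S L f \<Longrightarrow> T \<subseteq> S \<Longrightarrow> L \<le> M \<Longrightarrow> c11_on T M f"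
  unfolding c11_on_def
  by (meson lipschitz_on_mono mult_right_mono order_trans subsetD zero_le_power2)

lemma semiconcave_on_cong:
  assumes "convex S" "\<And>x. x \<in> S \<Longrightarrow> f x = g x" "semiconcave_on S L f"
  shows "semiconcave_on S L g"
  unfolding semiconcave_on_def
proof (intro conjI allI impI)
  show "L-lipschitz_on S g"
    using assms(2,3) lipschitz_on_transform unfolding semiconcave_on_def by metis
  fix x z assume S: "x + z \<in> S" "x - z \<in> S"
  then have "second_diff g x z = second_diff f x z"
    using assms(2) midpoint_in_convex[OF assms(1) S] by (simp add: second_diff_def)
  then show "second_diff g x z \<le> L * (norm z)\<^sup>2"
    using S assms(3) by (simp add: semiconcave_on_def)
qed

lemma semiconcave_near_cong:
  assumes "open S" "p \<in> S" "\<And>x. x \<in> S \<Longrightarrow> f x = g x" "semiconcave_near f p"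
  shows "semiconcave_near g p"
proof -
  obtain r L where r: "r > 0" "semiconcave_on (ball p r) L f"
    using assms(4) by (auto simp: semiconcave_near_def)
  obtain e where e: "e > 0" "ball p e \<subseteq> S" using assms(1,2) openE by blast
  have "semiconcave_on (ball p (min r e)) L f"
    by (rule semiconcave_on_mono[OF r(2)]) auto
  then have "semiconcave_on (ball p (min r e)) L g"
    by (rule semiconcave_on_cong[rotated 2]) (use e assms(3) in auto)
  then show ?thesis using r(1) e(1) unfolding semiconcave_near_def
    by (intro exI[of _ "min r e"]) auto
qed

lemma semiconcave_near_add:
  assumes "semiconcave_near f p" "semiconcave_near g p"
  shows "semiconcave_near (\<lambda>x. f x + g x) p"
proof -
  obtain r L where r: "r > 0" "semiconcave_on (ball p r) L f"
    using assms(1) by (auto simp: semiconcave_near_def)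
  obtain e M where e: "e > 0" "semiconcave_on (ball p e) M g"
    using assms(2) by (auto simp: semiconcave_near_def)
  let ?B = "ball p (min r e)"
  have "semiconcave_on ?B L f" "semiconcave_on ?B M g"
    by (auto intro: semiconcave_on_mono[OF r(2)] semiconcave_on_mono[OF e(2)])
  then have "semiconcave_on ?B (L + M) (\<lambda>x. f x + g x)"
    unfolding semiconcave_on_def second_diff_add
    by (auto intro!: lipschitz_on_add) (smt (verit) distrib_right)
  then show ?thesis using r(1) e(1) unfolding semiconcave_near_def
    by (intro exI[of _ "min r e"]) auto
qed

text \<open>The points \<open>\<tau> (x \<plusminus> z)\<close> are symmetric about their midpoint \<open>m\<close>,
  where semiconcavity of \<open>f\<close> applies. The midpoint differs from \<open>\<tau> x\<close> by
  half a second difference of \<open>\<tau>\<close>, which the Lipschitz bound of \<open>f\<close>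
  absorbs.\<close>

lemma semiconcave_on_compose:
  fixes \<tau> :: "'a::real_normed_vector \<Rightarrow> 'b::real_normed_vector"
  assumes S: "convex S" and T: "convex T" and ST: "\<tau> ` S \<subseteq> T"
    and f: "semiconcave_on T L f" and \<tau>: "c11_on S K \<tau>"
  shows "semiconcave_on S (L * K + L * K\<^sup>2) (\<lambda>x. f (\<tau> x))"
  unfolding semiconcave_on_def
proof (intro conjI allI impI)
  have fl: "L-lipschitz_on T f" and \<tau>l: "K-lipschitz_on S \<tau>"
    using f \<tau> by (auto simp: semiconcave_on_def c11_on_def)
  have L: "L \<ge> 0" and K: "K \<ge> 0" using fl \<tau>l lipschitz_on_nonneg by auto
  have "(L * K)-lipschitz_on S (\<lambda>x. f (\<tau> x))"
    using lipschitz_on_compose2[OF \<tau>l] lipschitz_on_mono[OF fl ST] by fast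
  then show "(L * K + L * K\<^sup>2)-lipschitz_on S (\<lambda>x. f (\<tau> x))"
    by (rule lipschitz_on_le) (use L in simp)
  fix x z assume xz: "x + z \<in> S" "x - z \<in> S"
  then have x: "x \<in> S" by (rule midpoint_in_convex[OF S])
  define m where "m = (1/2) *\<^sub>R (\<tau> (x + z) + \<tau> (x - z))"
  define \<zeta> where "\<zeta> = (1/2) *\<^sub>R (\<tau> (x + z) - \<tau> (x - z))"
  have m: "m + \<zeta> = \<tau> (x + z)" "m - \<zeta> = \<tau> (x - z)"
    unfolding m_def \<zeta>_def scaleR_add_right scaleR_diff_right by (simp_all flip: scaleR_add_left)
  have mT: "m \<in> T" by (rule midpoint_in_convex[OF T]) (use m xz ST in auto)
  have "dist (\<tau> (x + z)) (\<tau> (x - z)) \<le> K * dist (x + z) (x - z)"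
    using lipschitz_onD[OF \<tau>l] xz by blast
  moreover have "dist (x + z) (x - z) = 2 * norm z" by (simp add: dist_norm flip: scaleR_2)
  ultimately have "norm \<zeta> \<le> K * norm z" by (simp add: \<zeta>_def dist_norm)
  then have "(norm \<zeta>)\<^sup>2 \<le> K\<^sup>2 * (norm z)\<^sup>2"
    by (metis norm_ge_zero power_mono power_mult_distrib)
  then have 1: "second_diff f m \<zeta> \<le> L * (K\<^sup>2 * (norm z)\<^sup>2)"
    using f m xz ST L unfolding semiconcave_on_def
    by (smt (verit) image_subset_iff mult_left_mono)
  have "dist (f m) (f (\<tau> x)) \<le> L * dist m (\<tau> x)"
    using lipschitz_onD[OF fl mT] x ST by auto
  also have "m - \<tau> x = (1/2) *\<^sub>R second_diff \<tau> x z"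
    by (simp add: m_def second_diff_def scaleR_diff_right)
  then have "dist m (\<tau> x) = norm (second_diff \<tau> x z) / 2" by (simp add: dist_norm)
  also have "\<dots> \<le> K * (norm z)\<^sup>2 / 2" using \<tau> xz by (simp add: c11_on_def)
  finally have 2: "2 * (f m - f (\<tau> x)) \<le> L * (K * (norm z)\<^sup>2)"
    using L mult_left_mono[of _ _ L] by (fastforce simp: dist_real_def abs_if split: if_splits)
  have "second_diff (\<lambda>x. f (\<tau> x)) x z = second_diff f m \<zeta> + 2 * (f m - f (\<tau> x))"
    by (simp add: second_diff_def m)
  then show "second_diff (\<lambda>x. f (\<tau> x)) x z \<le> (L * K + L * K\<^sup>2) * (norm z)\<^sup>2"
    using 1 2 by (simp add: algebra_simps)
qed

lemma semiconcave_near_compose: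
  assumes f: "semiconcave_near f (\<tau> p)" and \<tau>: "c11_near \<tau> p"
  shows "semiconcave_near (\<lambda>x. f (\<tau> x)) p"
proof -
  obtain r L where r: "r > 0" "semiconcave_on (ball (\<tau> p) r) L f"
    using f by (auto simp: semiconcave_near_def)
  obtain e K where e: "e > 0" "c11_on (ball p e) K \<tau>"
    using \<tau> by (auto simp: c11_near_def)
  then have K: "K-lipschitz_on (ball p e) \<tau>" by (simp add: c11_on_def)
  have K0: "K \<ge> 0" using K lipschitz_on_nonneg by auto
  define d where "d = min e (r / (K + 1))"
  have d: "d > 0" "d \<le> e" using e r K0 by (auto simp: d_def)
  have "\<tau> ` ball p d \<subseteq> ball (\<tau> p) r"
  proof (intro subsetI, elim imageE)
    fix y x assume x: "y = \<tau> x" "x \<in> ball p d"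
    have "dist (\<tau> p) (\<tau> x) \<le> K * dist p x"
      using lipschitz_onD[OF K, of p x] x d e by auto
    also have "\<dots> \<le> (K + 1) * dist p x" by (simp add: mult_right_mono)
    also have "\<dots> < (K + 1) * d" using x K0 by (intro mult_strict_left_mono) auto
    also have "\<dots> \<le> (K + 1) * (r / (K + 1))" using K0 by (intro mult_left_mono) (auto simp: d_def)
    also have "\<dots> = r" using K0 by simp
    finally show "y \<in> ball (\<tau> p) r" using x by simp
  qed
  from semiconcave_on_compose[OF convex_ball convex_ball this r(2) c11_on_mono[OF e(2) subset_ball[OF d(2)] order_refl]]
  show ?thesis using d(1) unfolding semiconcave_near_def by blast
qed

text \<open>The Leibniz rule for second differences; the last two terms are products of first differences.\<close>

lemma second_diff_mult:
  fixes f g :: "'a::real_vector \<Rightarrow> real"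
  shows "second_diff (\<lambda>x. f x * g x) x z = f x * second_diff g x z + g x * second_diff f x z +
    (f (x + z) - f x) * (g (x + z) - g x) + (f (x - z) - f x) * (g (x - z) - g x)"
  by (simp add: second_diff_def algebra_simps)

lemma semiconcave_on_mult:
  fixes f \<rho> :: "'a::real_normed_vector \<Rightarrow> real"
  assumes S: "convex S" and \<rho>: "c11_on S K \<rho>" and f: "semiconcave_on S L f"
    and \<rho>b: "\<And>x. x \<in> S \<Longrightarrow> 0 \<le> \<rho> x \<and> \<rho> x \<le> N" and fb: "\<And>x. x \<in> S \<Longrightarrow> \<bar>f x\<bar> \<le> M"
    and nn: "N \<ge> 0" "M \<ge> 0"
  shows "semiconcave_on S (N * L + M * K + 2 * K * L) (\<lambda>x. \<rho> x * f x)"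
  unfolding semiconcave_on_def
proof (intro conjI allI impI)
  have fl: "L-lipschitz_on S f" and \<rho>l: "K-lipschitz_on S \<rho>"
    using f \<rho> by (auto simp: semiconcave_on_def c11_on_def)
  have L: "L \<ge> 0" and K: "K \<ge> 0" using fl \<rho>l lipschitz_on_nonneg by auto
  show "(N * L + M * K + 2 * K * L)-lipschitz_on S (\<lambda>x. \<rho> x * f x)"
  proof (rule lipschitz_onI)
    fix x y assume xy: "x \<in> S" "y \<in> S"
    have "\<rho> x * f x - \<rho> y * f y = \<rho> x * (f x - f y) + f y * (\<rho> x - \<rho> y)" by (simp add: algebra_simps)
    also have "\<bar>\<dots>\<bar> \<le> \<bar>\<rho> x\<bar> * \<bar>f x - f y\<bar> + \<bar>f y\<bar> * \<bar>\<rho> x - \<rho> y\<bar>"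
      by (metis abs_mult abs_triangle_ineq)
    also have "\<dots> \<le> N * (L * dist x y) + M * (K * dist x y)"
      using xy \<rho>b fb lipschitz_onD[OF fl xy] lipschitz_onD[OF \<rho>l xy] nn
      by (intro add_mono mult_mono) (auto simp: dist_real_def)
    finally show "dist (\<rho> x * f x) (\<rho> y * f y) \<le> (N * L + M * K + 2 * K * L) * dist x y"
      using K L by (simp add: dist_real_def algebra_simps) (smt (verit) mult_nonneg_nonneg zero_le_dist)
  qed (use nn K L in auto)
  fix x z assume xz: "x + z \<in> S" "x - z \<in> S"
  then have x: "x \<in> S" by (rule midpoint_in_convex[OF S])
  have 1: "\<rho> x * second_diff f x z \<le> N * (L * (norm z)\<^sup>2)"
  proof -
    have "second_diff f x z \<le> L * (norm z)\<^sup>2" using f xz by (simp add: semiconcave_on_def)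
    then have "\<rho> x * second_diff f x z \<le> \<rho> x * (L * (norm z)\<^sup>2)"
      using \<rho>b[OF x] by (intro mult_left_mono) auto
    also have "\<dots> \<le> N * (L * (norm z)\<^sup>2)" using \<rho>b[OF x] L by (intro mult_right_mono) auto
    finally show ?thesis .
  qed
  have "\<bar>f x * second_diff \<rho> x z\<bar> \<le> M * (K * (norm z)\<^sup>2)"
    unfolding abs_mult using fb[OF x] \<rho> xz nn K by (intro mult_mono) (auto simp: c11_on_def)
  moreover have "\<bar>(\<rho> (x + z) - \<rho> x) * (f (x + z) - f x)\<bar> \<le> (K * norm z) * (L * norm z)"
    unfolding abs_mult using lipschitz_onD[OF fl xz(1) x] lipschitz_onD[OF \<rho>l xz(1) x] K
    by (intro mult_mono) (auto simp: dist_norm)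
  moreover have "\<bar>(\<rho> (x - z) - \<rho> x) * (f (x - z) - f x)\<bar> \<le> (K * norm z) * (L * norm z)"
    unfolding abs_mult using lipschitz_onD[OF fl xz(2) x] lipschitz_onD[OF \<rho>l xz(2) x] K
    by (intro mult_mono) (auto simp: dist_norm)
  ultimately show "second_diff (\<lambda>x. \<rho> x * f x) x z \<le> (N * L + M * K + 2 * K * L) * (norm z)\<^sup>2"
    using 1 unfolding second_diff_mult by (simp add: algebra_simps power2_eq_square)
qed

lemma lipschitz_on_ball_bounded:
  fixes f :: "'a::metric_space \<Rightarrow> real"
  assumes "L-lipschitz_on (ball p r) f" "x \<in> ball p r"
  shows "\<bar>f x\<bar> \<le> \<bar>f p\<bar> + L * r"
proof -
  have "p \<in> ball p r" using assms(2) by (metis ball_eq_empty centre_in_ball empty_iff linorder_not_less)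
  then have "dist (f x) (f p) \<le> L * dist x p" using lipschitz_onD assms by blast
  also have "\<dots> \<le> L * r" using assms lipschitz_on_nonneg[OF assms(1)]
    by (intro mult_left_mono) (auto simp: dist_commute)
  finally show ?thesis by (simp add: dist_real_def)
qed

lemma semiconcave_near_mult:
  assumes f: "semiconcave_near f p" and \<rho>: "c11_near \<rho> p" and nn: "\<And>x. \<rho> x \<ge> 0"
  shows "semiconcave_near (\<lambda>x. \<rho> x * f x) p"
proof -
  obtain r L where r: "r > 0" "semiconcave_on (ball p r) L f"
    using f by (auto simp: semiconcave_near_def)
  obtain e K where e: "e > 0" "c11_on (ball p e) K \<rho>"
    using \<rho> by (auto simp: c11_near_def)
  define d where "d = min r e"
  have 1: "semiconcave_on (ball p d) L f" and 2: "c11_on (ball p d) K \<rho>"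
    by (auto intro!: semiconcave_on_mono[OF r(2)] c11_on_mono[OF e(2)] simp: d_def)
  then have l: "L-lipschitz_on (ball p d) f" "K-lipschitz_on (ball p d) \<rho>"
    by (auto simp: semiconcave_on_def c11_on_def)
  have d: "d > 0" using r e by (simp add: d_def)
  have "semiconcave_on (ball p d) ((\<bar>\<rho> p\<bar> + K * d) * L + (\<bar>f p\<bar> + L * d) * K + 2 * K * L) (\<lambda>x. \<rho> x * f x)"
    using lipschitz_on_ball_bounded[OF l(1)] lipschitz_on_ball_bounded[OF l(2)] nn lipschitz_on_nonneg[OF l(1)] lipschitz_on_nonneg[OF l(2)] d
    by (intro semiconcave_on_mult[OF convex_ball 2 1]) force+
  then show ?thesis using d unfolding semiconcave_near_def by blast
qed

lemma c11_near_imp_semiconcave_near: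
  fixes f :: "'a::real_normed_vector \<Rightarrow> real"
  assumes "c11_near f p"
  shows "semiconcave_near f p" "semiconcave_near (\<lambda>x. - f x) p"
proof -
  obtain e K where e: "e > 0" "c11_on (ball p e) K f"
    using assms by (auto simp: c11_near_def)
  then have "semiconcave_on (ball p e) K f" "semiconcave_on (ball p e) K (\<lambda>x. - f x)"
    by (auto simp: c11_on_def semiconcave_on_def second_diff_uminus abs_le_iff lipschitz_on_def dist_minus)
  then show "semiconcave_near f p" "semiconcave_near (\<lambda>x. - f x) p"
    using e(1) by (auto simp: semiconcave_near_def)
qed

text \<open>Second differences of a concave function are nonpositive. The Lipschitz bound is the usual one: prolong
  the segment from \<open>x\<close> to \<open>y\<close> by a fixed length and use concavity on the longer
  segment, together with boundedness on a compact ball.\<close>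

lemma concave_on_imp_semiconcave_near:
  fixes h :: "'a::euclidean_space \<Rightarrow> real"
  assumes h: "concave_on S h" and S: "open S" "p \<in> S"
  shows "semiconcave_near h p"
proof -
  obtain e where e: "e > 0" "cball p e \<subseteq> S" using S open_contains_cball by blast
  define r where "r = e / 2"
  have r: "r > 0" "cball p (2 * r) \<subseteq> S" using e by (auto simp: r_def)
  have "continuous_on S h"
    using convex_on_continuous[OF S(1), of "\<lambda>x. - h x"] h continuous_on_minus[of S "\<lambda>x. - h x"]
    by (simp add: concave_on_def)
  then have "bounded (h ` cball p (2 * r))"
    using r continuous_on_subset compact_continuous_image compact_imp_bounded compact_cball by metis
  then obtain M where M: "M > 0" "\<And>x. x \<in> cball p (2 * r) \<Longrightarrow> \<bar>h x\<bar> \<le> M"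
    by (auto simp: bounded_pos)
  have one_sided: "h x - h y \<le> 2 * M / r * dist x y" if xy: "x \<in> ball p r" "y \<in> ball p r" "x \<noteq> y" for x y
  proof -
    define n where "n = dist x y"
    have n: "n > 0" using xy by (simp add: n_def)
    define w where "w = y + (r / n) *\<^sub>R (y - x)"
    have "dist y w = r" using n r by (simp add: w_def dist_norm n_def norm_minus_commute)
    then have "dist p w \<le> 2 * r" using xy dist_triangle[of p w y] by simp
    then have w: "w \<in> cball p (2 * r)" "x \<in> cball p (2 * r)" using xy r by auto
    define t where "t = n / (n + r)"
    have t: "0 \<le> t" "t \<le> 1" "t \<le> n / r" using n r by (auto simp: t_def field_simps)
    have y: "y = (1 - t) *\<^sub>R x + t *\<^sub>R w"
    proof -
      have "t * (r / n) = 1 - t" using n r by (simp add: t_def field_simps)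
      then have "t *\<^sub>R w = t *\<^sub>R y + (1 - t) *\<^sub>R (y - x)" by (simp add: w_def scaleR_add_right)
      then show ?thesis by (simp add: algebra_simps)
    qed
    have "h y \<ge> (1 - t) * h x + t * h w"
      unfolding y using h t w r by (intro concave_onD[OF h]) auto
    then have "h x - h y \<le> t * (h x - h w)" by (simp add: algebra_simps)
    also have "\<dots> \<le> t * (2 * M)" using M(2)[OF w(1)] M(2)[OF w(2)] t by (intro mult_left_mono) auto
    also have "\<dots> \<le> n / r * (2 * M)" using t M by (intro mult_right_mono) auto
    finally show ?thesis by (simp add: n_def mult_ac)
  qed
  have "semiconcave_on (ball p r) (2 * M / r) h"
    unfolding semiconcave_on_def
  proof (intro conjI allI impI)
    show "(2 * M / r)-lipschitz_on (ball p r) h"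
    proof (rule lipschitz_onI)
      fix x y assume "x \<in> ball p r" "y \<in> ball p r"
      then show "dist (h x) (h y) \<le> 2 * M / r * dist x y"
        using one_sided[of x y] one_sided[of y x] by (cases "x = y") (auto simp: dist_real_def dist_commute)
    qed (use M r in auto)
    fix x z assume xz: "x + z \<in> ball p r" "x - z \<in> ball p r"
    have "(1/2) * h (x + z) + (1 - 1/2) * h (x - z) \<le> h ((1/2) *\<^sub>R (x + z) + (1 - 1/2) *\<^sub>R (x - z))"
    proof -
      have "ball p r \<subseteq> S" using r by (meson ball_subset_cball cball_subset_cball_iff dual_order.trans subset_ball mult_le_cancel_right1 less_imp_le one_le_numeral)
      then have "x + z \<in> S" "x - z \<in> S" using xz by blast+
      then show ?thesis using concave_onD[OF h, of "1/2" "x - z" "x + z"] by (simp add: add.commute)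
    qed
    moreover have "(1/2) *\<^sub>R (x + z) + (1 - 1/2) *\<^sub>R (x - z) = x"
      by (simp add: scaleR_add_right scaleR_diff_right flip: scaleR_add_left)
    ultimately have "second_diff h x z \<le> 0" by (simp add: second_diff_def)
    also have "\<dots> \<le> 2 * M / r * (norm z)\<^sup>2" using M r by simp
    finally show "second_diff h x z \<le> 2 * M / r * (norm z)\<^sup>2" .
  qed
  then show ?thesis using r(1) unfolding semiconcave_near_def by blast
qed

section \<open>Second differences of smooth functions\<close>

lemma norm_frechet_derivative_le:
  fixes f :: "'a::euclidean_space \<Rightarrow> 'b::real_normed_vector"
  assumes "f differentiable (at x)" "\<And>i. i \<in> Basis \<Longrightarrow> norm (frechet_derivative f (at x) i) \<le> (K::real)"
  shows "norm (frechet_derivative f (at x) v) \<le> real DIM('a) * K * norm v"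
proof -
  have "norm (frechet_derivative f (at x) v) \<le> (\<Sum>i\<in>Basis. norm ((v \<bullet> i) *\<^sub>R frechet_derivative f (at x) i))"
    by (subst frechet_derivative_basis[OF assms(1)]) (rule norm_sum)
  also have "\<dots> \<le> (\<Sum>i\<in>(Basis::'a set). norm v * K)"
    using assms(2) by (intro sum_mono) (auto intro!: mult_mono Basis_le_norm)
  finally show ?thesis by (simp add: mult_ac)
qed

lemma lipschitz_on_of_partials:
  fixes f :: "'a::euclidean_space \<Rightarrow> 'b::real_normed_vector"
  assumes S: "convex S" and f: "\<And>x. x \<in> S \<Longrightarrow> f differentiable (at x)"
    and K: "\<And>x i. x \<in> S \<Longrightarrow> i \<in> Basis \<Longrightarrow> norm (frechet_derivative f (at x) i) \<le> (K::real)" "K \<ge> 0"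
  shows "(real DIM('a) * K)-lipschitz_on S f"
proof (rule lipschitz_onI)
  fix x y assume "x \<in> S" "y \<in> S"
  then have "norm (f x - f y) \<le> real DIM('a) * K * norm (x - y)"
  proof (rule differentiable_bound[OF S, rotated 2])
    fix x assume x: "x \<in> S"
    show "(f has_derivative frechet_derivative f (at x)) (at x within S)"
      using f[OF x] by (simp add: has_derivative_at_withinI frechet_derivative_works)
    show "onorm (frechet_derivative f (at x)) \<le> real DIM('a) * K"
      by (rule onorm_le) (rule norm_frechet_derivative_le[OF f[OF x] K(1)[OF x]])
  qed
  then show "dist (f x) (f y) \<le> real DIM('a) * K * dist x y" by (simp add: dist_norm)
qed (use K in auto)

text \<open>A second difference is the increment of \<open>y \<mapsto> f (y + z) - f y\<close> from \<open>x -
  z\<close> to \<open>x\<close>. The derivative of that function is a difference of values of the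
  derivative of \<open>f\<close>, controlled by the second partial derivatives.\<close>

lemma c11_on_of_partials:
  fixes f :: "'a::euclidean_space \<Rightarrow> 'b::real_normed_vector"
  assumes S: "convex S" and f: "Ck_on (Suc (Suc 0)) S f" and K0: "K \<ge> 0"
    and K1: "\<And>x i. x \<in> S \<Longrightarrow> i \<in> Basis \<Longrightarrow> norm (frechet_derivative f (at x) i) \<le> K"
    and K2: "\<And>x i j. x \<in> S \<Longrightarrow> i \<in> Basis \<Longrightarrow> j \<in> Basis \<Longrightarrow>
      norm (frechet_derivative (\<lambda>y. frechet_derivative f (at y) i) (at x) j) \<le> K"
  shows "\<exists>L. c11_on S L f"
proof -
  define n where "n = real (DIM('a))"
  have n: "n \<ge> 0" by (simp add: n_def)
  have fd: "(f has_derivative frechet_derivative f (at x)) (at x)" if "x \<in> S" for x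
    using Ck_on_has_derivative[OF f that] .
  have D_lip: "norm (frechet_derivative f (at x) v - frechet_derivative f (at y) v) \<le> n * n * K * norm (x - y) * norm v"
    if xy: "x \<in> S" "y \<in> S" for x y v
  proof -
    have i: "(n * K)-lipschitz_on S (\<lambda>y. frechet_derivative f (at y) i)" if "i \<in> Basis" for i
      unfolding n_def using f K2 K0 that by (intro lipschitz_on_of_partials[OF S]) auto
    have "frechet_derivative f (at x) v - frechet_derivative f (at y) v =
      (\<Sum>i\<in>Basis. (v \<bullet> i) *\<^sub>R (frechet_derivative f (at x) i - frechet_derivative f (at y) i))"
      using frechet_derivative_basis[of f x v] frechet_derivative_basis[of f y v] xy f
      by (simp add: scaleR_diff_right sum_subtractf)
    also have "norm \<dots> \<le> (\<Sum>i\<in>Basis. norm ((v \<bullet> i) *\<^sub>R (frechet_derivative f (at x) i - frechet_derivative f (at y) i)))"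
      by (rule norm_sum)
    also have "\<dots> \<le> (\<Sum>i\<in>(Basis::'a set). norm v * (n * K * norm (x - y)))"
      using lipschitz_onD[OF i xy] by (intro sum_mono) (auto intro!: mult_mono Basis_le_norm simp: dist_norm)
    finally show ?thesis by (simp add: n_def mult_ac)
  qed
  have "c11_on S (n * K + n * n * K) f"
    unfolding c11_on_def
  proof (intro conjI allI impI)
    have "(n * K)-lipschitz_on S f"
      unfolding n_def using f K1 K0 by (intro lipschitz_on_of_partials[OF S]) auto
    then show "(n * K + n * n * K)-lipschitz_on S f"
      by (rule lipschitz_on_le) (use n K0 in auto)
    fix x z assume xz: "x + z \<in> S" "x - z \<in> S"
    then have x: "x \<in> S" by (rule midpoint_in_convex[OF S])
    define T where "T = closed_segment (x - z) x"
    have T: "y \<in> S" "y + z \<in> S" if "y \<in> T" for y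
    proof -
      show "y \<in> S" using that closed_segment_subset[OF xz(2) x S] by (auto simp: T_def)
      have "y + z \<in> closed_segment (x - z + z) (x + z)"
        using that unfolding T_def by (metis add.commute closed_segment_translation_eq)
      then show "y + z \<in> S" using closed_segment_subset[OF x xz(1) S] by auto
    qed
    have "norm ((f (x + z) - f x) - (f (x - z + z) - f (x - z))) \<le> (n * n * K * norm z) * norm (x - (x - z))"
    proof (rule differentiable_bound[where S=T and f="\<lambda>y. f (y + z) - f y"
          and f'="\<lambda>y v. frechet_derivative f (at (y + z)) v - frechet_derivative f (at y) v"])
      fix y assume y: "y \<in> T"
      have "((\<lambda>y. f (y + z)) has_derivative (\<lambda>v. frechet_derivative f (at (y + z)) v)) (at y)"
        using has_derivative_compose[OF has_derivative_add[OF has_derivative_ident has_derivative_const] fd[OF T(2)[OF y]]]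
        by simp
      from has_derivative_at_withinI[OF has_derivative_diff[OF this fd[OF T(1)[OF y]]]]
      show "((\<lambda>y. f (y + z) - f y) has_derivative (\<lambda>v. frechet_derivative f (at (y + z)) v - frechet_derivative f (at y) v)) (at y within T)" .
      show "onorm (\<lambda>v. frechet_derivative f (at (y + z)) v - frechet_derivative f (at y) v) \<le> n * n * K * norm z"
        using D_lip[OF T(2)[OF y] T(1)[OF y]] by (intro onorm_le) simp
    qed (auto simp: T_def)
    then have "norm (second_diff f x z) \<le> n * n * K * (norm z)\<^sup>2"
      by (simp add: second_diff_def scaleR_2 power2_eq_square algebra_simps)
    also have "\<dots> \<le> (n * K + n * n * K) * (norm z)\<^sup>2"
      using n K0 by (intro mult_right_mono) auto
    finally show "norm (second_diff f x z) \<le> (n * K + n * n * K) * (norm z)\<^sup>2" .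
  qed
  then show ?thesis by blast
qed

text \<open>Bounds all first and second partial derivatives at once, by a single continuous function.\<close>

definition jet_size :: "('a::euclidean_space \<Rightarrow> 'b::real_normed_vector) \<Rightarrow> 'a \<Rightarrow> real" where
  "jet_size f x = (\<Sum>i\<in>Basis. norm (frechet_derivative f (at x) i) +
     (\<Sum>j\<in>Basis. norm (frechet_derivative (\<lambda>y. frechet_derivative f (at y) i) (at x) j)))"

lemma c11_on_of_jet_size:
  assumes "convex S" "Ck_on (Suc (Suc 0)) S f" "\<And>x. x \<in> S \<Longrightarrow> jet_size f x \<le> K" "K \<ge> 0"
  shows "\<exists>L. c11_on S L f"
proof (rule c11_on_of_partials[OF assms(1,2,4)])
  fix x :: 'a and i :: 'a assume x: "x \<in> S" and i: "i \<in> Basis"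
  let ?g = "\<lambda>i. norm (frechet_derivative f (at x) i) +
     (\<Sum>j\<in>Basis. norm (frechet_derivative (\<lambda>y. frechet_derivative f (at y) i) (at x) j))"
  have "?g i \<le> jet_size f x" unfolding jet_size_def
    by (rule member_le_sum[of i Basis ?g]) (use i in \<open>auto intro!: add_nonneg_nonneg sum_nonneg\<close>)
  then have g: "?g i \<le> K" using assms(3)[OF x] by simp
  moreover have "0 \<le> (\<Sum>j\<in>Basis. norm (frechet_derivative (\<lambda>y. frechet_derivative f (at y) i) (at x) j))"
    by (intro sum_nonneg) auto
  ultimately show "norm (frechet_derivative f (at x) i) \<le> K" by linarith
  fix j :: 'a assume "j \<in> Basis"
  then have "norm (frechet_derivative (\<lambda>y. frechet_derivative f (at y) i) (at x) j) \<le>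
    (\<Sum>j\<in>Basis. norm (frechet_derivative (\<lambda>y. frechet_derivative f (at y) i) (at x) j))"
    by (intro member_le_sum) auto
  then show "norm (frechet_derivative (\<lambda>y. frechet_derivative f (at y) i) (at x) j) \<le> K"
    using g norm_ge_zero[of "frechet_derivative f (at x) i"] by linarith
qed

lemma jet_size_bounded_on_compact:
  assumes "Ck_on (Suc (Suc 0)) S f" "compact C" "C \<subseteq> S"
  obtains K where "K \<ge> 0" "\<And>x. x \<in> C \<Longrightarrow> jet_size f x \<le> K"
proof -
  have "Ck_on (Suc 0) S (\<lambda>x. frechet_derivative f (at x) i)" for i
    using assms(1) by (simp only: Ck_on.simps(2)[of "Suc 0"])
  then have "continuous_on S (\<lambda>x. frechet_derivative f (at x) i)"
    "continuous_on S (\<lambda>x. frechet_derivative (\<lambda>y. frechet_derivative f (at y) i) (at x) j)" for i j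
    using Ck_on_continuous by (blast, simp)
  then have "continuous_on S (jet_size f)"
    unfolding jet_size_def by (intro continuous_intros)
  then have "bounded (jet_size f ` C)"
    using assms(2,3) continuous_on_subset compact_continuous_image compact_imp_bounded by metis
  then obtain K where "K > 0" "\<And>x. x \<in> C \<Longrightarrow> \<bar>jet_size f x\<bar> \<le> K"
    by (auto simp: bounded_pos)
  then show thesis by (intro that[of K]) force+
qed

lemma smooth_on_imp_c11_near:
  assumes "smooth_on S f" "open S" "p \<in> S"
  shows "c11_near f p"
proof -
  obtain r where r: "r > 0" "cball p r \<subseteq> S" using assms(2,3) open_contains_cball by blast
  have f: "Ck_on (Suc (Suc 0)) S f" using assms(1) by (simp only: smooth_on_def)
  obtain K where "K \<ge> 0" "\<And>x. x \<in> cball p r \<Longrightarrow> jet_size f x \<le> K"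
    using jet_size_bounded_on_compact[OF f compact_cball r(2)] by blast
  then have "\<exists>L. c11_on (ball p r) L f"
    by (intro c11_on_of_jet_size[OF convex_ball Ck_on_subset[OF f]]) (use r in auto)
  then show ?thesis using r by (auto simp: c11_near_def)
qed

lemma smooth_compact_support_c11:
  fixes f :: "'a::euclidean_space \<Rightarrow> 'b::real_normed_vector"
  assumes "smooth_on UNIV f" "\<And>x. x \<notin> ball p R \<Longrightarrow> f x = 0"
  obtains L where "c11_on UNIV L f"
proof -
  have f: "Ck_on (Suc (Suc 0)) UNIV f" using assms(1) by (simp only: smooth_on_def)
  obtain K where K: "K \<ge> 0" "\<And>x. x \<in> cball p R \<Longrightarrow> jet_size f x \<le> K"
    using jet_size_bounded_on_compact[OF f compact_cball] by blast
  have "jet_size f x \<le> K" if x: "x \<notin> cball p R" for x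
  proof -
    have op: "open (- cball p R)" by (simp add: open_Compl)
    have 1: "frechet_derivative f (at y) i = 0" if "y \<in> - cball p R" for y i
      using frechet_derivative_cong[OF op, of y f "\<lambda>_. 0"] that assms(2) by auto
    have "frechet_derivative (\<lambda>y. frechet_derivative f (at y) i) (at x) j = 0" for i j
      using frechet_derivative_cong[OF op, of x "\<lambda>y. frechet_derivative f (at y) i" "\<lambda>_. 0"] x 1 by auto
    then show ?thesis using 1 x K(1) by (simp add: jet_size_def)
  qed
  then have "\<exists>L. c11_on UNIV L f"
    by (intro c11_on_of_jet_size[OF convex_UNIV f _ K(1)]) (use K in blast)
  then show thesis using that by blast
qed

section \<open>Cutting off\<close>

lemma semiconcave_with_mono:
  "semiconcave_with C f \<Longrightarrow> C \<le> D \<Longrightarrow> semiconcave_with D f"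
  unfolding semiconcave_with_def by (meson mult_right_mono order_trans zero_le_power2)

text \<open>Turns a local bound on second differences into a global one. When \<open>x + z\<close> or \<open>x -
  z\<close> leaves the ball, either \<open>z\<close> is short and \<open>\<rho>\<close> vanishes at all
  three points, or \<open>z\<close> is long and boundedness suffices.\<close>

lemma cutoff_semiconcave_with:
  fixes f :: "'a::euclidean_space \<Rightarrow> real"
  assumes f: "semiconcave_on (ball p R) L f" and R: "R > 0"
    and \<rho>: "smooth_on UNIV \<rho>" "\<And>x. 0 \<le> \<rho> x \<and> \<rho> x \<le> 1" "\<And>x. x \<notin> ball p (R / 2) \<Longrightarrow> \<rho> x = 0"
  obtains C B where "semiconcave_with C (\<lambda>x. \<rho> x * f x)" "continuous_on UNIV (\<lambda>x. \<rho> x * f x)"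
    "\<And>x. \<bar>\<rho> x * f x\<bar> \<le> B"
proof -
  have fl: "L-lipschitz_on (ball p R) f" using f by (simp add: semiconcave_on_def)
  obtain K where K: "c11_on UNIV K \<rho>" using smooth_compact_support_c11[OF \<rho>(1) \<rho>(3)] by blast
  define M where "M = \<bar>f p\<bar> + L * R"
  have M: "M \<ge> 0" using lipschitz_on_nonneg[OF fl] R by (simp add: M_def)
  have fb: "\<bar>f x\<bar> \<le> M" if "x \<in> ball p R" for x
    using lipschitz_on_ball_bounded[OF fl that] by (simp add: M_def)
  define L' where "L' = 1 * L + M * K + 2 * K * L"
  have sc: "semiconcave_on (ball p R) L' (\<lambda>x. \<rho> x * f x)"
    unfolding L'_def using fb M \<rho>(2)
    by (intro semiconcave_on_mult[OF convex_ball c11_on_mono[OF K subset_UNIV order_refl] f]) auto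
  then have l': "L'-lipschitz_on (ball p R) (\<lambda>x. \<rho> x * f x)" by (simp add: semiconcave_on_def)
  have bd: "\<bar>\<rho> x * f x\<bar> \<le> M" for x
  proof (cases "x \<in> ball p R")
    case True
    then show ?thesis using fb[OF True] \<rho>(2)[of x] M by (simp add: abs_mult) (smt (verit) mult_left_le_one_le)
  next
    case False
    then have "\<rho> x = 0" using R by (intro \<rho>) auto
    then show ?thesis using M by simp
  qed
  define C where "C = L' + 64 * M / R\<^sup>2"
  have L'0: "L' \<ge> 0" using lipschitz_on_nonneg[OF l'] .
  have "second_diff (\<lambda>x. \<rho> x * f x) x z \<le> C * (norm z)\<^sup>2" for x z
  proof -
    \<comment> \<open>if \<open>\<bar>z\<bar> < R / 4\<close> and one of the points \<open>x \<plusminus> z\<close> is at distance at least \<open>R\<close> from \<open>p\<close>, then all three points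
      are outside \<open>ball p (R / 2)\<close>\<close>
    consider "x + z \<in> ball p R" "x - z \<in> ball p R" | "norm z \<ge> R / 4"
      | "norm z < R / 4" "x + z \<notin> ball p R \<or> x - z \<notin> ball p R" by fastforce
    then show ?thesis
    proof cases
      case 1
      then have "second_diff (\<lambda>x. \<rho> x * f x) x z \<le> L' * (norm z)\<^sup>2" using sc by (simp add: semiconcave_on_def)
      also have "\<dots> \<le> C * (norm z)\<^sup>2" using M by (intro mult_right_mono) (auto simp: C_def)
      finally show ?thesis .
    next
      case 2
      have "second_diff (\<lambda>x. \<rho> x * f x) x z \<le> 4 * M"
        using bd[of x] bd[of "x + z"] bd[of "x - z"] by (simp add: second_diff_def)
      also have "\<dots> = 64 * M / R\<^sup>2 * (R / 4)\<^sup>2" using R by (simp add: power2_eq_square)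
      also have "\<dots> \<le> 64 * M / R\<^sup>2 * (norm z)\<^sup>2" using 2 M R by (intro mult_left_mono power_mono) auto
      also have "\<dots> \<le> C * (norm z)\<^sup>2" using L'0 by (intro mult_right_mono) (auto simp: C_def)
      finally show ?thesis .
    next
      case 3
      have "dist (x + z) x = norm z" "dist (x - z) x = norm z" by (auto simp: dist_norm)
      moreover have "R \<le> dist p (x + z) \<or> R \<le> dist p (x - z)" using 3 by auto
      ultimately have "R / 2 \<le> dist p x" "R / 2 \<le> dist p (x + z)" "R / 2 \<le> dist p (x - z)"
        using 3(1) dist_triangle[of p "x + z" x] dist_triangle[of p "x - z" x]
          dist_triangle2[of p x "x + z"] dist_triangle2[of p x "x - z"]
          dist_commute[of x "x + z"] dist_commute[of x "x - z"] by linarith+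
      then have "second_diff (\<lambda>x. \<rho> x * f x) x z = 0" using \<rho>(3) by (simp add: second_diff_def)
      moreover have "0 \<le> C * (norm z)\<^sup>2" using L'0 M by (simp add: C_def)
      ultimately show ?thesis by simp
    qed
  qed
  moreover have "continuous_on (ball p R \<union> - cball p (R / 2)) (\<lambda>x. \<rho> x * f x)"
  proof (rule continuous_on_open_Un)
    show "continuous_on (ball p R) (\<lambda>x. \<rho> x * f x)"
      by (rule lipschitz_on_continuous_on[OF l'])
    have "continuous_on (- cball p (R / 2)) (\<lambda>x. 0::real)" by simp
    then show "continuous_on (- cball p (R / 2)) (\<lambda>x. \<rho> x * f x)"
      by (rule continuous_on_eq) (use \<rho>(3) in auto)
  qed auto
  moreover have "ball p R \<union> - cball p (R / 2) = UNIV" using R by auto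
  ultimately show thesis using bd by (intro that[of C M]) (auto simp: semiconcave_with_def)
qed

text \<open>One bump function serves both functions, so that an inequality between them survives.\<close>

lemma simultaneous_cutoff:
  fixes f g :: "'a::euclidean_space \<Rightarrow> real"
  assumes "semiconcave_near f p" "semiconcave_near g p"
  obtains \<rho> r C B where "r > 0" "\<And>x. 0 \<le> \<rho> x" "\<And>x. x \<in> cball p r \<Longrightarrow> \<rho> x = 1"
    "semiconcave_with C (\<lambda>x. \<rho> x * f x)" "continuous_on UNIV (\<lambda>x. \<rho> x * f x)" "\<And>x. \<bar>\<rho> x * f x\<bar> \<le> B"
    "semiconcave_with C (\<lambda>x. \<rho> x * g x)" "continuous_on UNIV (\<lambda>x. \<rho> x * g x)" "\<And>x. \<bar>\<rho> x * g x\<bar> \<le> B"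
proof -
  obtain s L where s: "s > 0" "semiconcave_on (ball p s) L f"
    using assms(1) by (auto simp: semiconcave_near_def)
  obtain e M where e: "e > 0" "semiconcave_on (ball p e) M g"
    using assms(2) by (auto simp: semiconcave_near_def)
  define R where "R = min s e"
  have R: "R > 0" "semiconcave_on (ball p R) L f" "semiconcave_on (ball p R) M g"
    using s e by (auto simp: R_def intro: semiconcave_on_mono[OF s(2)] semiconcave_on_mono[OF e(2)])
  obtain \<rho> :: "'a \<Rightarrow> real" where \<rho>: "smooth_on UNIV \<rho>" "\<And>x. 0 \<le> \<rho> x \<and> \<rho> x \<le> 1"
    "\<And>x. x \<in> cball p (R / 4) \<Longrightarrow> \<rho> x = 1" "\<And>x. x \<notin> ball p (R / 2) \<Longrightarrow> \<rho> x = 0"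
    using smooth_bump_exists[of "R / 4" "R / 2" p] R(1) by auto
  obtain C1 B1 where 1: "semiconcave_with C1 (\<lambda>x. \<rho> x * f x)" "continuous_on UNIV (\<lambda>x. \<rho> x * f x)"
    "\<And>x. \<bar>\<rho> x * f x\<bar> \<le> B1"
    using cutoff_semiconcave_with[OF R(2,1) \<rho>(1,2,4)] by blast
  obtain C2 B2 where 2: "semiconcave_with C2 (\<lambda>x. \<rho> x * g x)" "continuous_on UNIV (\<lambda>x. \<rho> x * g x)"
    "\<And>x. \<bar>\<rho> x * g x\<bar> \<le> B2"
    using cutoff_semiconcave_with[OF R(3,1) \<rho>(1,2,4)] by blast
  show thesis
  proof (rule that[of "R / 4" \<rho> "max C1 C2" "max B1 B2"])
    show "\<bar>\<rho> x * f x\<bar> \<le> max B1 B2" "\<bar>\<rho> x * g x\<bar> \<le> max B1 B2" for x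
      using 1(3)[of x] 2(3)[of x] by auto
    show "semiconcave_with (max C1 C2) (\<lambda>x. \<rho> x * f x)" "semiconcave_with (max C1 C2) (\<lambda>x. \<rho> x * g x)"
      using semiconcave_with_mono[OF 1(1)] semiconcave_with_mono[OF 2(1)] by auto
  qed (use \<rho> R 1 2 in auto)
qed

section \<open>Mollification\<close>

lemma lborel_integral_reflect:
  fixes g :: "'a::euclidean_space \<Rightarrow> real"
  assumes "continuous_on UNIV g"
  shows "(LINT y|lborel. g (x - y)) = (LINT y|lborel. g y)"
proof -
  have m: "g \<in> borel_measurable borel" using assms by (rule borel_measurable_continuous_onI)
  have "(LINT y|lborel. g y) = (LINT y|distr lborel borel (\<lambda>y. x + (-1) *\<^sub>R y). g y)"
    by (subst lborel_affine[of "-1" x]) (simp_all add: density_1)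
  also have "\<dots> = (LINT y|lborel. g (x - y))"
    by (subst integral_distr) (use m in auto)
  finally show ?thesis by simp
qed

lemma integrable_continuous_compact_support:
  fixes g :: "'a::euclidean_space \<Rightarrow> real"
  assumes "continuous_on UNIV g" "\<And>y. y \<notin> cball p R \<Longrightarrow> g y = 0"
  shows "integrable lborel g"
proof -
  have "integrable lborel (\<lambda>y. indicator (cball p R) y *\<^sub>R g y)"
    using assms(1) continuous_on_subset by (intro borel_integrable_compact) auto
  moreover have "(\<lambda>y. indicator (cball p R) y *\<^sub>R g y) = g"
    using assms(2) by (auto simp: fun_eq_iff indicator_def)
  ultimately show ?thesis by simp
qed

definition convolution :: "('a::euclidean_space \<Rightarrow> real) \<Rightarrow> ('a \<Rightarrow> real) \<Rightarrow> 'a \<Rightarrow> real" where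
  "convolution \<rho> f x = (LINT y|lborel. \<rho> (x - y) * f y)"

text \<open>The difference quotients fall on the kernel, whose second-order Taylor remainder is at most \<open>L
  \<bar>v\<bar>\<^sup>2\<close> and, for \<open>\<bar>v\<bar> < 1\<close>, vanishes outside a fixed ball.
  The other two claims let the statement be iterated.\<close>

lemma convolution_has_derivative:
  fixes \<rho> f :: "'a::euclidean_space \<Rightarrow> real"
  assumes f: "continuous_on UNIV f" "\<And>x. \<bar>f x\<bar> \<le> B"
    and \<rho>: "smooth_on UNIV \<rho>" "\<And>x. x \<notin> cball 0 R \<Longrightarrow> \<rho> x = 0"
  shows "(convolution \<rho> f has_derivative (\<lambda>v. convolution (\<lambda>y. frechet_derivative \<rho> (at y) v) f x)) (at x)"
    "smooth_on UNIV (\<lambda>y. frechet_derivative \<rho> (at y) v)"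
    "y \<notin> cball 0 R \<Longrightarrow> frechet_derivative \<rho> (at y) v = 0"
proof -
  define D where "D v x = frechet_derivative \<rho> (at x) v" for v x
  have smD: "smooth_on UNIV (D v)" for v
    using \<rho>(1) unfolding smooth_on_def D_def by (metis Ck_on.simps(2))
  have op: "open (- cball 0 R :: 'a set)" by (simp add: open_Compl)
  have D0: "D v x = 0" if "x \<notin> cball 0 R" for v x
    using frechet_derivative_cong[OF op, of x \<rho> "\<lambda>_. 0"] that \<rho>(2) by (auto simp: D_def)
  have hd: "(\<rho> has_derivative frechet_derivative \<rho> (at x)) (at x)" for x
    using \<rho>(1) Ck_on_has_derivative[of 0 UNIV \<rho>] unfolding smooth_on_def by blast
  then have linD: "bounded_linear (\<lambda>v. D v x)" for x
    unfolding D_def using has_derivative_bounded_linear by blast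
  have cont: "continuous_on UNIV (\<lambda>y. h (x - y) * f y)" if "smooth_on UNIV h" for h :: "'a \<Rightarrow> real" and x
  proof -
    have "continuous_on UNIV (\<lambda>y. x - y)" by (intro continuous_intros)
    then have "continuous_on UNIV (\<lambda>y. h (x - y))"
      using continuous_on_compose2[OF smooth_on_continuous[OF that]] by blast
    then show ?thesis using f(1) by (rule continuous_on_mult)
  qed
  have int: "integrable lborel (\<lambda>y. h (x - y) * f y)"
    if "smooth_on UNIV h" "\<And>x. x \<notin> cball 0 R \<Longrightarrow> h x = 0" for h :: "'a \<Rightarrow> real" and x
    by (rule integrable_continuous_compact_support[OF cont[OF that(1)], of x R])
      (use that(2) in \<open>auto simp: dist_norm\<close>)
  note int\<rho> = int[OF \<rho>] and intD = int[OF smD D0]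
  obtain L where L: "c11_on UNIV L \<rho>"
    using smooth_compact_support_c11[OF \<rho>(1), of 0 "R + 1"] \<rho>(2) by auto
  have bd: "bounded_second_diff L \<rho>" using L by (auto simp: c11_on_def bounded_second_diff_def)
  obtain N where N: "\<And>x. \<bar>\<rho> x\<bar> \<le> N"
  proof -
    have "bounded (\<rho> ` cball 0 R)"
      using continuous_on_subset[OF smooth_on_continuous[OF \<rho>(1)]]
      by (intro compact_imp_bounded compact_continuous_image) auto
    then obtain N where "N > 0" "\<And>x. x \<in> cball 0 R \<Longrightarrow> \<bar>\<rho> x\<bar> \<le> N" by (auto simp: bounded_pos)
    then have "\<bar>\<rho> x\<bar> \<le> N" for x using \<rho>(2)[of x] by (cases "x \<in> cball 0 R") auto
    then show thesis by (rule that)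
  qed
  have L0: "L \<ge> 0" using bounded_second_diff_nonneg[OF bd] .
  have taylor: "\<bar>\<rho> (x + v) - \<rho> x - D v x\<bar> \<le> L * (norm v)\<^sup>2" for x v
  proof -
    obtain D' :: "'a \<Rightarrow> 'a \<Rightarrow>\<^sub>L real" where D':
      "\<And>x. (\<rho> has_derivative blinfun_apply (D' x)) (at x)"
      "\<And>x z. \<bar>\<rho> (x + z) - \<rho> x - D' x z\<bar> \<le> L * (norm z)\<^sup>2"
      using bounded_second_diff_derivative[OF bd N] by metis
    have "D' x v = D v x" using has_derivative_unique[OF D'(1) hd] by (simp add: D_def)
    then show ?thesis using D'(2)[of x v] by simp
  qed
  have "(convolution \<rho> f has_derivative (\<lambda>v. convolution (D v) f x)) (at x)" for x
  proof (rule has_derivativeI_sandwich[where e=1 and H="\<lambda>y. L * B * measure lborel (cball x (R + 1)) * norm (y - x)"])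
    have "linear (\<lambda>v. convolution (D v) f x)"
    proof (rule linearI)
      show "convolution (D (v + w)) f x = convolution (D v) f x + convolution (D w) f x" for v w
      proof -
        have "D (v + w) y = D v y + D w y" for y by (rule linear_add[OF bounded_linear.linear[OF linD]])
        then show ?thesis unfolding convolution_def using intD by (simp add: distrib_right)
      qed
      show "convolution (D (r *\<^sub>R v)) f x = r *\<^sub>R convolution (D v) f x" for r v
      proof -
        have "D (r *\<^sub>R v) y = r * D v y" for y using linear_scale[OF bounded_linear.linear[OF linD[of y]], of r v] by simp
        then show ?thesis unfolding convolution_def by (simp add: mult.assoc)
      qed
    qed
    then show "bounded_linear (\<lambda>v. convolution (D v) f x)" by (simp add: linear_conv_bounded_linear)
    show "((\<lambda>y. L * B * measure lborel (cball x (R + 1)) * norm (y - x)) \<longlongrightarrow> 0) (at x)"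
      by (auto intro!: tendsto_eq_intros)
    fix y assume y: "y \<noteq> x" "dist y x < 1"
    define v where "v = y - x"
    have v: "y = x + v" "norm v < 1" "v \<noteq> 0" using y by (auto simp: v_def dist_norm)
    have "convolution \<rho> f y - convolution \<rho> f x - convolution (D v) f x =
      (LINT t|lborel. \<rho> (y - t) * f t - \<rho> (x - t) * f t - D v (x - t) * f t)"
      unfolding convolution_def using int\<rho> intD by simp
    also have "\<bar>\<dots>\<bar> \<le> (LINT t|lborel. indicator (cball x (R + 1)) t * (L * (norm v)\<^sup>2 * B))"
    proof (rule integral_abs_bound_integral)
      show "integrable lborel (\<lambda>t. \<rho> (y - t) * f t - \<rho> (x - t) * f t - D v (x - t) * f t)"
        using int\<rho> intD by simp
      show "integrable lborel (\<lambda>t. indicator (cball x (R + 1)) t * (L * (norm v)\<^sup>2 * B))"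
        using emeasure_compact_finite[OF compact_cball, of x "R + 1"] by (intro integrable_mult_left) simp
      fix t
      show "\<bar>\<rho> (y - t) * f t - \<rho> (x - t) * f t - D v (x - t) * f t\<bar> \<le> indicator (cball x (R + 1)) t * (L * (norm v)\<^sup>2 * B)"
      proof (cases "t \<in> cball x (R + 1)")
        case True
        have "\<rho> (y - t) * f t - \<rho> (x - t) * f t - D v (x - t) * f t = (\<rho> (x - t + v) - \<rho> (x - t) - D v (x - t)) * f t"
          by (simp add: v(1) algebra_simps)
        also have "\<bar>\<dots>\<bar> \<le> (L * (norm v)\<^sup>2) * B"
          unfolding abs_mult using taylor f(2) L0 by (intro mult_mono) auto
        finally show ?thesis using True by simp
      next
        case False
        then have "norm (x - t) > R + 1" by (simp add: dist_norm)
        moreover have "norm (x - t) \<le> norm (y - t) + norm v"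
          using norm_triangle_ineq4[of "y - t" v] by (simp add: v(1))
        ultimately have "x - t \<notin> cball 0 R" "y - t \<notin> cball 0 R" using v(2) by auto
        then show ?thesis using \<rho>(2) D0 False by simp
      qed
    qed
    also have "\<dots> = L * B * measure lborel (cball x (R + 1)) * (norm v)\<^sup>2"
      by simp
    finally show "norm (convolution \<rho> f y - convolution \<rho> f x - convolution (D (y - x)) f x) / norm (y - x)
        \<le> L * B * measure lborel (cball x (R + 1)) * norm (y - x)"
      using v(3) by (simp add: v_def[symmetric] field_simps power2_eq_square)
  qed simp
  then show "(convolution \<rho> f has_derivative (\<lambda>v. convolution (\<lambda>y. frechet_derivative \<rho> (at y) v) f x)) (at x)"
    by (simp add: D_def[abs_def])
  show "smooth_on UNIV (\<lambda>y. frechet_derivative \<rho> (at y) v)" using smD by (simp add: D_def[abs_def])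
  show "frechet_derivative \<rho> (at y) v = 0" if "y \<notin> cball 0 R" using D0[OF that] by (simp add: D_def)
qed

lemma smooth_on_convolution:
  fixes \<rho> f :: "'a::euclidean_space \<Rightarrow> real"
  assumes f: "continuous_on UNIV f" "\<And>x. \<bar>f x\<bar> \<le> B"
    and \<rho>: "smooth_on UNIV \<rho>" "\<And>x. x \<notin> cball 0 R \<Longrightarrow> \<rho> x = 0"
  shows "smooth_on UNIV (convolution \<rho> f)"
proof -
  have "Ck_on k UNIV (convolution \<rho> f)" for k
    using \<rho>
  proof (induction k arbitrary: \<rho>)
    case 0
    show ?case
      by (auto intro!: continuous_at_imp_continuous_on has_derivative_continuous[OF convolution_has_derivative(1)[OF f 0]])
  next
    case (Suc k)
    show ?case
      by (rule Ck_on_SucI[OF open_UNIV convolution_has_derivative(1)[OF f Suc.prems]])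
        (use convolution_has_derivative(2,3)[OF f Suc.prems] in \<open>blast intro: Suc.IH\<close>)+
  qed
  then show ?thesis by (simp add: smooth_on_def)
qed

text \<open>A mollification is an average of translates of \<open>f\<close> over a small ball. Averaging preserves
  every bound that is invariant under translation, in particular the one on second differences.\<close>

lemma smooth_approximation:
  fixes f :: "'a::euclidean_space \<Rightarrow> real"
  assumes lip: "L-lipschitz_on UNIV f" and B: "\<And>x. \<bar>f x\<bar> \<le> B" and sd: "bounded_second_diff C f"
    and \<eta>: "\<eta> > 0"
  obtains g where "smooth_on UNIV g" "\<And>x. \<bar>g x - f x\<bar> \<le> \<eta>" "bounded_second_diff C g"
proof -
  have L: "L \<ge> 0" using lipschitz_on_nonneg[OF lip] .
  define \<epsilon> where "\<epsilon> = \<eta> / (L + 1)"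
  have \<epsilon>: "\<epsilon> > 0" "L * \<epsilon> \<le> \<eta>" using L \<eta> by (auto simp: \<epsilon>_def field_simps)
  obtain \<rho> :: "'a \<Rightarrow> real" where \<rho>: "smooth_on UNIV \<rho>" "\<And>x. 0 \<le> \<rho> x \<and> \<rho> x \<le> 1"
    "\<And>x. x \<in> cball 0 (\<epsilon> / 2) \<Longrightarrow> \<rho> x = 1" "\<And>x. x \<notin> ball 0 \<epsilon> \<Longrightarrow> \<rho> x = 0"
    using smooth_bump_exists[of "\<epsilon> / 2" \<epsilon> "0::'a"] \<epsilon>(1) half_gt_zero[OF \<epsilon>(1)] by (metis field_sum_of_halves less_add_same_cancel1)
  have f: "continuous_on UNIV f" using lipschitz_on_continuous_on[OF lip] .
  have c\<rho>: "continuous_on UNIV \<rho>" using smooth_on_continuous[OF \<rho>(1)] .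
  have int: "integrable lborel (\<lambda>y. \<rho> y * h y)" if "continuous_on UNIV h" for h
    by (rule integrable_continuous_compact_support[of _ 0 \<epsilon>]) (use c\<rho> that \<rho>(4) in \<open>auto intro!: continuous_intros\<close>)
  have int\<rho>: "integrable lborel \<rho>" using int[of "\<lambda>_. 1"] by simp
  define I where "I = (LINT y|lborel. \<rho> y)"
  have "(LINT y|lborel. indicator (cball (0::'a) (\<epsilon> / 2)) y) \<le> I"
    unfolding I_def
  proof (rule integral_mono)
    show "integrable lborel (indicat_real (cball (0::'a) (\<epsilon> / 2)))"
      using emeasure_compact_finite[OF compact_cball, of "0::'a" "\<epsilon> / 2"] by simp
  qed (use \<rho>(2,3) int\<rho> in \<open>auto simp: indicator_def\<close>)
  then have "measure lborel (cball (0::'a) (\<epsilon> / 2)) \<le> I" by simp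
  moreover have "measure lborel (cball (0::'a) (\<epsilon> / 2)) > 0" using \<epsilon> by (intro content_cball_pos) simp
  ultimately have I: "I > 0" by linarith
  define avg where "avg h = (LINT y|lborel. \<rho> y * h y) / I" for h
  have avg_add: "avg (\<lambda>y. h y + k y) = avg h + avg k"
    if "continuous_on UNIV h" "continuous_on UNIV k" for h k
    unfolding avg_def using int[OF that(1)] int[OF that(2)] by (simp add: distrib_left add_divide_distrib)
  have avg_cmult: "avg (\<lambda>y. r * h y) = r * avg h" for r h
    unfolding avg_def by (simp add: mult.left_commute)
  have avg_const: "avg (\<lambda>y. r) = r" for r unfolding avg_def using I by (simp add: I_def)
  have avg_bound: "\<bar>avg h\<bar> \<le> K" if "continuous_on UNIV h" "\<And>y. y \<in> ball 0 \<epsilon> \<Longrightarrow> \<bar>h y\<bar> \<le> K" for h K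
  proof -
    have "\<bar>LINT y|lborel. \<rho> y * h y\<bar> \<le> (LINT y|lborel. \<rho> y * K)"
    proof (rule integral_abs_bound_integral)
      fix y show "\<bar>\<rho> y * h y\<bar> \<le> \<rho> y * K"
        using that(2)[of y] \<rho>(2)[of y] \<rho>(4)[of y]
        by (cases "y \<in> ball 0 \<epsilon>") (auto simp: abs_mult intro: mult_left_mono)
    qed (use int int\<rho> that in auto)
    then show ?thesis unfolding avg_def using I by (simp add: I_def[symmetric] field_simps)
  qed
  have shift: "continuous_on UNIV (\<lambda>y. f (x - y))" for x
  proof -
    have "continuous_on UNIV (\<lambda>y. x - y)" by (intro continuous_intros)
    then show ?thesis using continuous_on_compose2[OF f] by blast
  qed
  define g where "g x = avg (\<lambda>y. f (x - y))" for x
  have g_convolution: "g x = inverse I * convolution \<rho> f x" for x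
  proof -
    have "continuous_on UNIV (\<lambda>y. \<rho> y * f (x - y))" using c\<rho> shift by (intro continuous_intros)
    from lborel_integral_reflect[OF this, of x] show ?thesis
      by (simp add: g_def avg_def convolution_def divide_inverse)
  qed
  show thesis
  proof (rule that[of g])
    have "smooth_on UNIV (convolution \<rho> f)"
      using smooth_on_convolution[OF f B \<rho>(1), of \<epsilon>] \<rho>(4) by auto
    then show "smooth_on UNIV g" unfolding g_convolution
      by (intro smooth_on_mult smooth_on_const open_UNIV)
    fix x
    have "g x - f x = avg (\<lambda>y. f (x - y) + - f x)"
      using avg_add[OF shift continuous_on_const, of x "- f x"] by (simp add: g_def avg_const)
    also have "\<bar>\<dots>\<bar> \<le> \<eta>"
    proof (rule avg_bound)
      fix y :: 'a assume y: "y \<in> ball 0 \<epsilon>"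
      have "\<bar>f (x - y) + - f x\<bar> \<le> L * norm y"
        using lipschitz_onD[OF lip, of "x - y" x] by (simp add: dist_norm)
      also have "\<dots> \<le> L * \<epsilon>" using y L by (intro mult_left_mono) auto
      finally show "\<bar>f (x - y) + - f x\<bar> \<le> \<eta>" using \<epsilon>(2) by simp
    qed (use shift in \<open>auto intro: continuous_intros\<close>)
    finally show "\<bar>g x - f x\<bar> \<le> \<eta>" .
  next
    show "bounded_second_diff C g"
      unfolding bounded_second_diff_def
    proof (intro allI)
      fix x z
      have "second_diff g x z = avg (\<lambda>y. (f (x + z - y) + f (x - z - y)) + (- 2) * f (x - y))"
        using avg_add[of "\<lambda>y. f (x + z - y) + f (x - z - y)" "\<lambda>y. (- 2) * f (x - y)"]
          avg_add[OF shift shift, of "x + z" "x - z"] shift avg_cmult[of "-2" "\<lambda>y. f (x - y)"]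
        by (simp add: second_diff_def g_def continuous_on_add continuous_on_mult_left continuous_on_minus)
      also have "\<bar>\<dots>\<bar> \<le> C * (norm z)\<^sup>2"
      proof (rule avg_bound)
        fix y
        show "\<bar>(f (x + z - y) + f (x - z - y)) + (- 2) * f (x - y)\<bar> \<le> C * (norm z)\<^sup>2"
          using sd[unfolded bounded_second_diff_def, rule_format, of "x - y" z]
          by (simp add: second_diff_def algebra_simps)
      qed (use shift in \<open>auto intro!: continuous_intros\<close>)
      finally show "\<bar>second_diff g x z\<bar> \<le> C * (norm z)\<^sup>2" .
    qed
  qed
qed

section \<open>Partitions of unity\<close>

text \<open>If each \<open>\<beta> i\<close> equals 1 on an open set \<open>V i\<close> and these sets cover a
  region, this is a partition of unity there. On \<open>V j\<close> the functions with index greater than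
  \<open>j\<close> vanish, since they contain the factor \<open>1 - \<beta> j\<close>, and the others sum
  to 1 by telescoping. Thus it is locally finite although the cover need not be.\<close>

definition partition_from :: "(nat \<Rightarrow> 'a \<Rightarrow> real) \<Rightarrow> nat \<Rightarrow> 'a \<Rightarrow> real" where
  "partition_from \<beta> i x = \<beta> i x * (\<Prod>j<i. 1 - \<beta> j x)"

lemma partition_from_sum: "(\<Sum>i<n. partition_from \<beta> i x) = 1 - (\<Prod>j<n. 1 - \<beta> j x)"
  by (induction n) (simp_all add: partition_from_def algebra_simps)

lemma partition_from_nonneg:
  "(\<And>i. 0 \<le> \<beta> i x \<and> \<beta> i x \<le> 1) \<Longrightarrow> 0 \<le> partition_from \<beta> i x"
  unfolding partition_from_def by (intro mult_nonneg_nonneg prod_nonneg) auto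

lemma partition_from_sum_le:
  "(\<And>i. 0 \<le> \<beta> i x \<and> \<beta> i x \<le> 1) \<Longrightarrow> (\<Sum>i<n. partition_from \<beta> i x) \<le> 1"
  unfolding partition_from_sum by (simp add: prod_nonneg)

lemma partition_from_eq_0: "\<beta> j x = 1 \<Longrightarrow> j < i \<Longrightarrow> partition_from \<beta> i x = 0"
  unfolding partition_from_def by auto

lemma partition_from_sum_eq_1: "\<beta> j x = 1 \<Longrightarrow> (\<Sum>i\<le>j. partition_from \<beta> i x) = 1"
  using partition_from_sum[of \<beta> x "Suc j"] by (auto simp: lessThan_Suc_atMost)

lemma suminf_partition_from:
  "\<beta> j x = 1 \<Longrightarrow> (\<Sum>i. partition_from \<beta> i x * h i) = (\<Sum>i\<le>j. partition_from \<beta> i x * h i)"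
  by (rule suminf_finite) (auto simp: partition_from_eq_0)

lemma weighted_average_bounds:
  fixes g h :: "'i \<Rightarrow> real"
  assumes "\<And>i. i \<in> I \<Longrightarrow> g i \<ge> 0" "(\<Sum>i\<in>I. g i) = 1"
    and "\<And>i. i \<in> I \<Longrightarrow> g i \<noteq> 0 \<Longrightarrow> l \<le> h i \<and> h i \<le> r"
  shows "l \<le> (\<Sum>i\<in>I. g i * h i)" "(\<Sum>i\<in>I. g i * h i) \<le> r"
proof -
  have *: "g i * l \<le> g i * h i \<and> g i * h i \<le> g i * r" if "i \<in> I" for i
    using assms(1,3)[OF that] by (cases "g i = 0") (auto intro: mult_left_mono)
  then have "(\<Sum>i\<in>I. g i * l) \<le> (\<Sum>i\<in>I. g i * h i)" "(\<Sum>i\<in>I. g i * h i) \<le> (\<Sum>i\<in>I. g i * r)"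
    by (auto intro: sum_mono)
  then show "l \<le> (\<Sum>i\<in>I. g i * h i)" "(\<Sum>i\<in>I. g i * h i) \<le> r"
    unfolding sum_distrib_right[symmetric] assms(2) by auto
qed

lemma weighted_average_strict_bounds:
  fixes g h :: "'i \<Rightarrow> real"
  assumes fin: "finite I" and g: "\<And>i. i \<in> I \<Longrightarrow> g i \<ge> 0" "(\<Sum>i\<in>I. g i) = 1"
    and h: "\<And>i. i \<in> I \<Longrightarrow> g i \<noteq> 0 \<Longrightarrow> l < h i \<and> h i < r"
  shows "l < (\<Sum>i\<in>I. g i * h i)" "(\<Sum>i\<in>I. g i * h i) < r"
proof -
  define J where "J = {i \<in> I. g i \<noteq> 0}"
  have J: "finite J" "J \<noteq> {}" using fin g(2) by (auto simp: J_def) (metis (mono_tags, lifting) sum.neutral zero_neq_one)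
  have eq: "(\<Sum>i\<in>J. g i * k i) = (\<Sum>i\<in>I. g i * k i)" for k
    unfolding J_def using fin by (intro sum.mono_neutral_left) auto
  have m: "h ` J \<noteq> {}" "finite (h ` J)" using J by auto
  have lr: "l < Min (h ` J)" "Max (h ` J) < r" using m h by (auto simp: J_def)
  have "Min (h ` J) \<le> h i \<and> h i \<le> Max (h ` J)" if "i \<in> I" "g i \<noteq> 0" for i
    using that m by (auto simp: J_def)
  from weighted_average_bounds[of I g "Min (h ` J)" h "Max (h ` J)", OF g this] lr
  show "l < (\<Sum>i\<in>I. g i * h i)" "(\<Sum>i\<in>I. g i * h i) < r" by auto
qed

text \<open>Passage from a local existence statement to a sequence of local data. The assumption on the empty set
  allows the sequence to be padded if the cover is finite or empty.\<close>

lemma countable_cover_choice: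
  fixes W :: "'a::second_countable_topology set"
  assumes "\<And>x. x \<in> W \<Longrightarrow> \<exists>V p. open V \<and> x \<in> V \<and> P V p" and "P {} p\<^sub>0"
  obtains V :: "nat \<Rightarrow> 'a set" and p :: "nat \<Rightarrow> 'b"
  where "\<And>i. open (V i)" "\<And>i. P (V i) (p i)" "W \<subseteq> (\<Union>i. V i)"
proof -
  define \<F> where "\<F> = {V. open V \<and> (\<exists>p. P V p)}"
  obtain \<F>' where \<F>': "\<F>' \<subseteq> \<F>" "countable \<F>'" "\<Union>\<F>' = \<Union>\<F>"
    using Lindelof[of \<F>] by (auto simp: \<F>_def)
  define V where "V = from_nat_into (insert {} \<F>')"
  have r: "range V = insert {} \<F>'" unfolding V_def using \<F>'(2) by (intro range_from_nat_into) auto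
  have "V i \<in> \<F>" for i
  proof -
    have "V i \<in> insert {} \<F>'" using r by blast
    then show ?thesis using \<F>'(1) assms(2) by (auto simp: \<F>_def)
  qed
  then have V: "\<And>i. open (V i)" "\<And>i. \<exists>p. P (V i) p" by (auto simp: \<F>_def)
  then obtain p where p: "\<And>i. P (V i) (p i)" by metis
  have "(\<Union>i. V i) = \<Union>\<F>" using r \<F>'(3) by simp
  moreover have "W \<subseteq> \<Union>\<F>"
  proof
    fix x assume "x \<in> W"
    from assms(1)[OF this] show "x \<in> \<Union>\<F>" by (auto simp: \<F>_def)
  qed
  ultimately have "W \<subseteq> (\<Union>i. V i)" by simp
  then show thesis using that V(1) p by blast
qed

text \<open>Term \<open>i\<close> may contribute a share of a convergent series and a multiple of the partition
  function \<open>g i\<close>; both have sum at most 1. Regularity of the individual terms is thus kept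
  across the boundary of the region where the sum is locally finite.\<close>

lemma bounded_second_diff_series:
  fixes w g :: "nat \<Rightarrow> 'a::real_normed_vector \<Rightarrow> real"
  assumes fin: "\<And>x. \<exists>n. \<forall>i\<ge>n. w i x = 0"
    and bd: "\<And>i x z. \<bar>second_diff (w i) x z\<bar> \<le> ((1/2) ^ Suc i + C * g i x) * (norm z)\<^sup>2"
    and C: "C \<ge> 0" and g: "\<And>n x. (\<Sum>i<n. g i x) \<le> 1"
  shows "bounded_second_diff (1 + C) (\<lambda>x. \<Sum>i. w i x)"
  unfolding bounded_second_diff_def
proof (intro allI)
  fix x z
  obtain n1 n2 n3 where n: "\<forall>i\<ge>n1. w i x = 0" "\<forall>i\<ge>n2. w i (x + z) = 0" "\<forall>i\<ge>n3. w i (x - z) = 0"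
    using fin by meson
  define n where "n = max n1 (max n2 n3)"
  have s: "(\<Sum>i. w i y) = (\<Sum>i<n. w i y)" if "y \<in> {x, x + z, x - z}" for y
    using that n by (intro suminf_finite) (auto simp: n_def)
  have "second_diff (\<lambda>x. \<Sum>i. w i x) x z = (\<Sum>i<n. second_diff (w i) x z)"
    by (simp add: second_diff_def s sum.distrib sum_subtractf sum_distrib_left)
  also have "\<bar>\<dots>\<bar> \<le> (\<Sum>i<n. ((1/2) ^ Suc i + C * g i x) * (norm z)\<^sup>2)"
    by (rule order_trans[OF sum_abs]) (intro sum_mono bd)
  also have "\<dots> = ((\<Sum>i<n. (1/2) ^ Suc i) + C * (\<Sum>i<n. g i x)) * (norm z)\<^sup>2"
    by (simp only: sum_distrib_right[symmetric] sum.distrib sum_distrib_left[symmetric])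
  also have "\<dots> \<le> (1 + C) * (norm z)\<^sup>2"
  proof (intro mult_right_mono add_mono)
    have "(\<Sum>i<n. (1/2::real) ^ Suc i) = 1 - (1/2) ^ n" by (induction n) simp_all
    then show "(\<Sum>i<n. (1/2::real) ^ Suc i) \<le> 1" by simp
    show "C * (\<Sum>i<n. g i x) \<le> C" using mult_left_mono[OF g C] by simp
  qed simp
  finally show "\<bar>second_diff (\<lambda>x. \<Sum>i. w i x) x z\<bar> \<le> (1 + C) * (norm z)\<^sup>2" .
qed

section \<open>Smooth and strict insertion on a Euclidean space\<close>

text \<open>Ilmanen's lemma on a Euclidean space. The partition \<open>g\<close> of \<open>\<Omega> = {a <
  b}\<close> is used twice. First \<open>\<delta> = \<Sum> \<epsilon>\<^sub>i g\<^sub>i\<close>, with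
  \<open>\<epsilon>\<^sub>i\<close> small, is a gap that is positive exactly on \<open>\<Omega>\<close>,
  and \<open>f0\<close> is inserted between \<open>a + \<delta>\<close> and \<open>b - \<delta>\<close>.
  Then \<open>f0 + \<Sum> g\<^sub>i (F\<^sub>i - f0)\<close>, with \<open>F\<^sub>i\<close> a
  mollification of \<open>f0\<close>, equals \<open>\<Sum> g\<^sub>i F\<^sub>i\<close> on
  \<open>\<Omega>\<close>, hence is smooth there, and differs from \<open>f0\<close> by at most
  \<open>\<delta> / 2\<close>. The terms \<open>g\<^sub>i (F\<^sub>i - f0)\<close> obey the bound required
  for \<open>bounded_second_diff_series\<close>: in the Leibniz rule, the second difference of
  \<open>F\<^sub>i - f0\<close> is multiplied by \<open>g\<^sub>i\<close>, and all other terms contain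
  \<open>F\<^sub>i - f0\<close> or its Lipschitz constant, which are as small as desired.\<close>

lemma smooth_strict_insertion:
  fixes a b :: "'a::euclidean_space \<Rightarrow> real"
  assumes ab: "\<And>x. a x \<le> b x" and cont: "continuous_on UNIV a" "continuous_on UNIV b"
    and B: "\<And>x. \<bar>a x\<bar> \<le> B" "\<And>x. \<bar>b x\<bar> \<le> B"
    and sc: "semiconcave_with C b" "semiconcave_with C (\<lambda>x. - a x)"
  obtains f C' where "\<And>x. a x \<le> f x \<and> f x \<le> b x" "\<And>x. a x < b x \<Longrightarrow> a x < f x \<and> f x < b x"
    "bounded_second_diff C' f" "smooth_on {x. a x < b x} f"
proof -
  define \<Omega> where "\<Omega> = {x. a x < b x}"
  have \<Omega>: "open \<Omega>" unfolding \<Omega>_def using cont by (rule open_Collect_less)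
  define P where "P V \<beta> \<longleftrightarrow> smooth_on UNIV \<beta> \<and> (\<forall>x. 0 \<le> \<beta> x \<and> \<beta> x \<le> 1) \<and> (\<forall>x\<in>V. \<beta> x = 1) \<and>
    (\<exists>p R. cball p R \<subseteq> \<Omega> \<and> (\<forall>x. x \<notin> ball p R \<longrightarrow> \<beta> x = 0))" for V and \<beta> :: "'a \<Rightarrow> real"
  have "\<exists>V \<beta>. open V \<and> x \<in> V \<and> P V \<beta>" if "x \<in> \<Omega>" for x
  proof -
    obtain R where R: "R > 0" "cball x R \<subseteq> \<Omega>" using \<Omega> \<open>x \<in> \<Omega>\<close> open_contains_cball by blast
    then have "0 < R / 2" "R / 2 < R" by auto
    from smooth_bump_exists[OF this, of x] obtain \<beta> :: "'a \<Rightarrow> real" where \<beta>: "smooth_on UNIV \<beta>"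
      "\<forall>x. 0 \<le> \<beta> x \<and> \<beta> x \<le> 1" "\<forall>y\<in>cball x (R / 2). \<beta> y = 1" "\<forall>y. y \<notin> ball x R \<longrightarrow> \<beta> y = 0"
      by blast
    have "P (ball x (R / 2)) \<beta>" unfolding P_def
    proof (intro conjI)
      show "\<forall>y\<in>ball x (R / 2). \<beta> y = 1" using \<beta>(3) by auto
    qed (use \<beta> R(2) in blast)+
    then show ?thesis using R(1) by (intro exI[of _ "ball x (R / 2)"] exI[of _ \<beta>]) auto
  qed
  moreover have "P {} (\<lambda>_. 0)"
    unfolding P_def by (auto simp: smooth_on_const intro!: exI[of _ 0] exI[of _ "-1"])
  ultimately obtain V \<beta> where V: "\<And>i. open (V i)" "\<And>i::nat. P (V i) (\<beta> i)" "\<Omega> \<subseteq> (\<Union>i. V i)"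
    using countable_cover_choice[of \<Omega> P "\<lambda>_. 0"] by metis
  have \<beta>: "smooth_on UNIV (\<beta> i)" "0 \<le> \<beta> i x \<and> \<beta> i x \<le> 1" "x \<in> V i \<Longrightarrow> \<beta> i x = 1" for i x
    using V(2)[of i] by (auto simp: P_def)
  obtain p R where pR: "\<And>i. cball (p i) (R i) \<subseteq> \<Omega>" "\<And>i x. x \<notin> ball (p i) (R i) \<Longrightarrow> \<beta> i x = 0"
    using V(2) unfolding P_def by metis
  define g where "g = partition_from \<beta>"
  have g0: "g i x \<ge> 0" and g1: "(\<Sum>i<n. g i x) \<le> 1" for i n x
    unfolding g_def by (rule partition_from_nonneg[of \<beta>, OF \<beta>(2)], rule partition_from_sum_le[of \<beta>, OF \<beta>(2)])
  have gsupp: "g i x = 0" if "x \<notin> ball (p i) (R i)" for i x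
    using pR(2)[OF that] by (simp add: g_def partition_from_def)
  have gout: "g i x = 0" if "x \<notin> \<Omega>" for i x
    by (rule gsupp) (use that pR(1)[of i] ball_subset_cball in blast)
  have gsum: "(\<Sum>i. g i x * h i) = (\<Sum>i\<le>j. g i x * h i)" "(\<Sum>i\<le>j. g i x) = 1" "i > j \<Longrightarrow> g i x = 0"
    if "x \<in> V j" for i j x h
    unfolding g_def
    by (rule suminf_partition_from[of \<beta>, OF \<beta>(3)[OF that]], rule partition_from_sum_eq_1[of \<beta>, OF \<beta>(3)[OF that]],
        rule partition_from_eq_0[of \<beta>, OF \<beta>(3)[OF that]])
  have gsm: "smooth_on UNIV (g i)" for i
    unfolding g_def partition_from_def[abs_def]
    by (intro smooth_on_mult smooth_on_prod smooth_on_diff smooth_on_const \<beta> open_UNIV)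
  \<comment> \<open>pointwise finiteness also off \<open>\<Omega>\<close>, where all functions vanish\<close>
  have gfin: "\<exists>n. \<forall>i\<ge>n. g i x * h i = 0" for x and h :: "nat \<Rightarrow> real"
  proof (cases "x \<in> \<Omega>")
    case True
    then obtain j where "x \<in> V j" using V(3) by blast
    then show ?thesis using gsum(3) by (intro exI[of _ "Suc j"]) auto
  qed (use gout in auto)
  have "\<exists>L. c11_on UNIV L (g i)" for i
    using smooth_compact_support_c11[OF gsm[of i], of "p i" "R i"] gsupp by blast
  then obtain L where L: "\<And>i. c11_on UNIV (L i) (g i)" by metis
  have L0: "L i \<ge> 0" for i using L[of i] lipschitz_on_nonneg unfolding c11_on_def by blast
  have gsd: "\<bar>second_diff (g i) x z\<bar> \<le> L i * (norm z)\<^sup>2" for i x z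
    using L[of i] by (simp add: c11_on_def)
  have margin: "\<exists>m. \<forall>i. m i > 0 \<and> (\<forall>x. g i x \<noteq> 0 \<longrightarrow> m i \<le> h x)"
    if h: "continuous_on UNIV h" "\<And>x. x \<in> \<Omega> \<Longrightarrow> h x > 0" for h :: "'a \<Rightarrow> real"
  proof -
    have "\<exists>m>0. \<forall>x\<in>cball (p i) (R i). m \<le> h x" for i
    proof (cases "cball (p i) (R i) = {}")
      case False
      obtain x where x: "x \<in> cball (p i) (R i)" "\<forall>y\<in>cball (p i) (R i). h x \<le> h y"
        using continuous_attains_inf[OF compact_cball False continuous_on_subset[OF h(1) subset_UNIV]] by blast
      then show ?thesis using h(2) pR(1) by blast
    qed (auto intro: exI[of _ 1])
    then obtain m where m: "\<And>i. m i > 0" "\<And>i x. x \<in> cball (p i) (R i) \<Longrightarrow> m i \<le> h x" by metis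
    then show ?thesis using gsupp by (intro exI[of _ m]) (metis ball_subset_cball subsetD)
  qed

  have "continuous_on UNIV (\<lambda>x. (b x - a x) / 3)" using cont by (intro continuous_intros) auto
  from margin[OF this] obtain m where m: "\<And>i. m i > 0" "\<And>i x. g i x \<noteq> 0 \<Longrightarrow> m i \<le> (b x - a x) / 3"
    by (auto simp: \<Omega>_def)
  \<comment> \<open>small against the gap on the support of \<open>g i\<close>, and against the second differences of \<open>g i\<close>\<close>
  define \<epsilon> where "\<epsilon> i = min (m i) ((1/2) ^ Suc i / (L i + 1))" for i
  have \<epsilon>: "\<epsilon> i > 0" "\<epsilon> i * L i \<le> (1/2) ^ Suc i" "\<epsilon> i \<le> m i" for i
  proof -
    show "\<epsilon> i > 0" using m(1) L0[of i] by (simp add: \<epsilon>_def)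
    have "\<epsilon> i * L i \<le> (1/2) ^ Suc i / (L i + 1) * (L i + 1)"
      using L0[of i] by (intro mult_mono) (auto simp: \<epsilon>_def)
    also have "\<dots> = (1/2) ^ Suc i"
      using L0[of i] by (subst times_divide_eq_left, intro nonzero_mult_div_cancel_right) simp
    finally show "\<epsilon> i * L i \<le> (1/2) ^ Suc i" .
  qed (simp add: \<epsilon>_def)
  define \<delta> where "\<delta> x = (\<Sum>i. g i x * \<epsilon> i)" for x
  have \<delta>out: "\<delta> x = 0" if "x \<notin> \<Omega>" for x using gout[OF that] by (simp add: \<delta>_def)
  have \<delta>in: "0 < \<delta> x" "\<delta> x \<le> (b x - a x) / 2" if "x \<in> \<Omega>" for x
  proof -
    obtain j where j: "x \<in> V j" using V(3) \<open>x \<in> \<Omega>\<close> by blast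
    have d: "\<delta> x = (\<Sum>i\<le>j. g i x * \<epsilon> i)" unfolding \<delta>_def by (rule gsum(1)[OF j])
    have "0 < \<epsilon> i \<and> \<epsilon> i < (b x - a x) / 2" if "g i x \<noteq> 0" for i
      using m(2)[OF that] \<epsilon>(1,3)[of i] \<open>x \<in> \<Omega>\<close> by (auto simp: \<Omega>_def)
    from weighted_average_strict_bounds[of "{..j}" "\<lambda>i. g i x" 0 \<epsilon> "(b x - a x) / 2", OF _ g0 gsum(2)[OF j] this]
    show "0 < \<delta> x" "\<delta> x \<le> (b x - a x) / 2" unfolding d by auto
  qed
  have \<delta>bd: "bounded_second_diff (1 + 0) \<delta>"
    unfolding \<delta>_def
  proof (rule bounded_second_diff_series[OF gfin _ order_refl g1])
    fix i x z
    have "\<bar>second_diff (\<lambda>x. g i x * \<epsilon> i) x z\<bar> = \<epsilon> i * \<bar>second_diff (g i) x z\<bar>"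
      using second_diff_cmult[of "\<epsilon> i" "g i" x z] \<epsilon>(1)[of i] by (simp add: mult.commute abs_mult)
    also have "\<dots> \<le> \<epsilon> i * (L i * (norm z)\<^sup>2)" using \<epsilon>(1)[of i] gsd by (intro mult_left_mono) auto
    also have "\<dots> \<le> (1/2) ^ Suc i * (norm z)\<^sup>2" using \<epsilon>(2)[of i] by (simp only: mult.assoc[symmetric] mult_right_mono zero_le_power2)
    finally show "\<bar>second_diff (\<lambda>x. g i x * \<epsilon> i) x z\<bar> \<le> ((1/2) ^ Suc i + 0 * g i x) * (norm z)\<^sup>2" by simp
  qed
  have \<delta>0: "0 \<le> \<delta> x" "\<delta> x \<le> (b x - a x) / 2" for x
    using \<delta>in[of x] \<delta>out[of x] ab[of x] by (cases "x \<in> \<Omega>"; simp)+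
  have "\<bar>\<delta> x\<bar> \<le> B" for x using \<delta>0[of x] B(1)[of x] B(2)[of x] by auto
  then obtain L\<delta> where "L\<delta>-lipschitz_on UNIV \<delta>" using bounded_second_diff_lipschitz[OF \<delta>bd] by blast
  then have \<delta>c: "continuous_on UNIV \<delta>" by (rule lipschitz_on_continuous_on)

  \<comment> \<open>second differences of \<open>\<delta>\<close> are bounded by \<open>\<bar>z\<bar>\<^sup>2\<close>\<close>
  define K where "K = C + 1"
  obtain f0 where f0: "\<And>x. a x + \<delta> x \<le> f0 x" "\<And>x. f0 x \<le> b x - \<delta> x" "bounded_second_diff K f0"
  proof (rule semiconcave_insertion[of "\<lambda>x. a x + \<delta> x" "\<lambda>x. b x - \<delta> x" K])
    show "a x + \<delta> x \<le> b x - \<delta> x" for x using \<delta>0[of x] ab[of x] by simp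
    have sd\<delta>: "\<bar>second_diff \<delta> x z\<bar> \<le> (norm z)\<^sup>2" for x z
      using \<delta>bd by (simp add: bounded_second_diff_def)
    show "semiconcave_with K (\<lambda>x. b x - \<delta> x)"
      unfolding semiconcave_with_def second_diff_diff
    proof (intro allI)
      fix x z
      have "second_diff b x z \<le> C * (norm z)\<^sup>2" using sc(1) by (simp add: semiconcave_with_def)
      then show "second_diff b x z - second_diff \<delta> x z \<le> K * (norm z)\<^sup>2"
        using sd\<delta>[of x z] by (simp add: K_def distrib_right)
    qed
    show "semiconcave_with K (\<lambda>x. - (a x + \<delta> x))"
      unfolding semiconcave_with_def second_diff_uminus second_diff_add
    proof (intro allI)
      fix x z
      have "- second_diff a x z \<le> C * (norm z)\<^sup>2" using sc(2) by (simp add: semiconcave_with_def second_diff_uminus)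
      then show "- (second_diff a x z + second_diff \<delta> x z) \<le> K * (norm z)\<^sup>2"
        using sd\<delta>[of x z] by (simp add: K_def distrib_right)
    qed
  qed blast
  have K0: "K \<ge> 0" using bounded_second_diff_nonneg[OF f0(3)] .
  have f0B: "\<bar>f0 x\<bar> \<le> B" for x
    using f0(1)[of x] f0(2)[of x] \<delta>0[of x] B(1)[of x] B(2)[of x] by auto
  obtain L0 where lip0: "L0-lipschitz_on UNIV f0" using bounded_second_diff_lipschitz[OF f0(3) f0B] by blast

  have "continuous_on UNIV (\<lambda>x. \<delta> x / 2)" using \<delta>c by (intro continuous_intros) auto
  from margin[OF this] obtain m' where m': "\<And>i. m' i > 0" "\<And>i x. g i x \<noteq> 0 \<Longrightarrow> m' i \<le> \<delta> x / 2"
    using \<delta>in(1) by auto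
  define M where "M i = L i + 2 * L i * (2 + 2 * K)" for i
  have M0: "M i \<ge> 0" for i using L0[of i] K0 by (simp add: M_def)
  \<comment> \<open>\<open>(s i)\<^sup>2\<close> is the mollification error; \<open>s i * M i\<close> will bound all terms of the Leibniz rule
    in which the mollification error or its Lipschitz constant occurs\<close>
  define s where "s i = min (min 1 (m' i)) ((1/2) ^ Suc i / (M i + 1))" for i
  have s: "s i > 0" "s i \<le> 1" "s i \<le> m' i" "s i * M i \<le> (1/2) ^ Suc i" for i
  proof -
    show "s i > 0" using m'(1) M0[of i] by (simp add: s_def)
    have "s i * M i \<le> (1/2) ^ Suc i / (M i + 1) * (M i + 1)"
      using M0[of i] by (intro mult_mono) (auto simp: s_def)
    also have "\<dots> = (1/2) ^ Suc i"
      using M0[of i] by (subst times_divide_eq_left, intro nonzero_mult_div_cancel_right) simp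
    finally show "s i * M i \<le> (1/2) ^ Suc i" .
  qed (auto simp: s_def)
  have ss: "(s i)\<^sup>2 \<le> s i" for i using s(1,2)[of i] by (simp add: power2_eq_square mult_left_le)
  have "\<exists>F. smooth_on UNIV F \<and> (\<forall>x. \<bar>F x - f0 x\<bar> \<le> (s i)\<^sup>2) \<and> bounded_second_diff K F" for i
    using smooth_approximation[OF lip0 f0B f0(3), of "(s i)\<^sup>2"] s(1)[of i] by (metis zero_less_power)
  then obtain F where F: "\<And>i. smooth_on UNIV (F i)" "\<And>i x. \<bar>F i x - f0 x\<bar> \<le> (s i)\<^sup>2"
    "\<And>i. bounded_second_diff K (F i)" by metis
  define e where "e i x = F i x - f0 x" for i x
  have esd: "bounded_second_diff (2 * K) (e i)" for i
    unfolding bounded_second_diff_def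
  proof (intro allI)
    fix x z
    have "second_diff (e i) x z = second_diff (F i) x z - second_diff f0 x z"
      by (simp add: second_diff_def e_def)
    moreover have "\<bar>second_diff (F i) x z\<bar> \<le> K * (norm z)\<^sup>2" "\<bar>second_diff f0 x z\<bar> \<le> K * (norm z)\<^sup>2"
      using F(3)[of i] f0(3) by (auto simp: bounded_second_diff_def)
    ultimately show "\<bar>second_diff (e i) x z\<bar> \<le> 2 * K * (norm z)\<^sup>2" by linarith
  qed
  have eb: "\<bar>e i x\<bar> \<le> (s i)\<^sup>2" for i x using F(2) by (simp add: e_def)
  have elip: "((2 + 2 * K) * s i)-lipschitz_on UNIV (e i)" for i
    by (rule lipschitz_on_interpolation[OF esd eb s(1)])
  define W where "W x = (\<Sum>i. g i x * e i x)" for x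
  have Wsd: "bounded_second_diff (1 + 2 * K) W"
    unfolding W_def
  proof (rule bounded_second_diff_series[OF gfin _ _ g1])
    fix i x z
    have 1: "\<bar>g i x * second_diff (e i) x z\<bar> \<le> g i x * (2 * K * (norm z)\<^sup>2)"
      using esd[of i] g0[of i x] by (auto simp: bounded_second_diff_def abs_mult intro: mult_left_mono)
    have 2: "\<bar>e i x * second_diff (g i) x z\<bar> \<le> s i * (L i * (norm z)\<^sup>2)"
      unfolding abs_mult using eb[of i x] ss[of i] gsd[of i x z] s(1)[of i] by (intro mult_mono) auto
    have 3: "\<bar>(g i y - g i x) * (e i y - e i x)\<bar> \<le> (L i * norm z) * ((2 + 2 * K) * s i * norm z)"
      if "norm (y - x) = norm z" for y
    proof -
      have "(L i)-lipschitz_on UNIV (g i)" using L[of i] by (simp add: c11_on_def)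
      from lipschitz_onD[OF this, of y x] lipschitz_onD[OF elip, of y x i] that L0[of i]
      show ?thesis unfolding abs_mult by (intro mult_mono) (auto simp: dist_norm)
    qed
    have "\<bar>second_diff (\<lambda>x. g i x * e i x) x z\<bar> \<le> g i x * (2 * K * (norm z)\<^sup>2) + s i * (L i * (norm z)\<^sup>2)
       + 2 * ((L i * norm z) * ((2 + 2 * K) * s i * norm z))"
      unfolding second_diff_mult using 1 2 3[of "x + z"] 3[of "x - z"] by (simp add: norm_minus_commute)
    also have "\<dots> = (s i * M i + 2 * K * g i x) * (norm z)\<^sup>2"
      by (simp add: M_def power2_eq_square algebra_simps)
    also have "\<dots> \<le> ((1/2) ^ Suc i + 2 * K * g i x) * (norm z)\<^sup>2"
      using s(4)[of i] by (intro mult_right_mono) auto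
    finally show "\<bar>second_diff (\<lambda>x. g i x * e i x) x z\<bar> \<le> ((1/2) ^ Suc i + 2 * K * g i x) * (norm z)\<^sup>2" .
  qed (use K0 in simp)
  have Wb: "\<bar>W x\<bar> \<le> \<delta> x / 2" for x
  proof (cases "x \<in> \<Omega>")
    case True
    then obtain j where j: "x \<in> V j" using V(3) by blast
    have "W x = (\<Sum>i\<le>j. g i x * e i x)" unfolding W_def by (rule gsum(1)[OF j])
    also have "\<bar>\<dots>\<bar> \<le> \<delta> x / 2"
    proof -
      have "- (\<delta> x / 2) \<le> e i x \<and> e i x \<le> \<delta> x / 2" if "g i x \<noteq> 0" for i
        using m'(2)[OF that] s(3)[of i] ss[of i] eb[of i x] by linarith
      from weighted_average_bounds[of "{..j}" "\<lambda>i. g i x" "- (\<delta> x / 2)" "\<lambda>i. e i x" "\<delta> x / 2", OF g0 gsum(2)[OF j] this]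
      show ?thesis by (simp add: abs_le_iff)
    qed
    finally show ?thesis .
  next
    case False
    then show ?thesis using gout \<delta>out by (simp add: W_def)
  qed
  show thesis
  proof (rule that[of "\<lambda>x. f0 x + W x" "K + (1 + 2 * K)"])
    fix x
    show "a x \<le> f0 x + W x \<and> f0 x + W x \<le> b x"
      using f0(1)[of x] f0(2)[of x] Wb[of x] \<delta>0[of x] by auto
    show "a x < f0 x + W x \<and> f0 x + W x < b x" if "a x < b x"
      using f0(1)[of x] f0(2)[of x] Wb[of x] \<delta>in[of x] that by (auto simp: \<Omega>_def abs_le_iff)
  next
    show "bounded_second_diff (K + (1 + 2 * K)) (\<lambda>x. f0 x + W x)"
      unfolding bounded_second_diff_def second_diff_add
    proof (intro allI)
      fix x z
      have "\<bar>second_diff f0 x z\<bar> \<le> K * (norm z)\<^sup>2" "\<bar>second_diff W x z\<bar> \<le> (1 + 2 * K) * (norm z)\<^sup>2"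
        using f0(3) Wsd by (auto simp: bounded_second_diff_def)
      then show "\<bar>second_diff f0 x z + second_diff W x z\<bar> \<le> (K + (1 + 2 * K)) * (norm z)\<^sup>2"
        unfolding distrib_right[of K] by linarith
    qed
    show "smooth_on {x. a x < b x} (\<lambda>x. f0 x + W x)"
    proof (rule smooth_on_local)
      fix x assume "x \<in> {x. a x < b x}"
      then obtain j where j: "x \<in> V j" using V(3) by (auto simp: \<Omega>_def)
      have "smooth_on (V j) (\<lambda>x. \<Sum>i\<le>j. g i x * F i x)"
        by (intro smooth_on_sum smooth_on_mult V(1) smooth_on_subset[OF gsm] smooth_on_subset[OF F(1)]) auto
      moreover have "(\<Sum>i\<le>j. g i y * F i y) = f0 y + W y" if "y \<in> V j" for y
      proof -
        have "W y = (\<Sum>i\<le>j. g i y * e i y)" unfolding W_def by (rule gsum(1)[OF that])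
        then show ?thesis using gsum(2)[OF that]
          by (simp add: e_def right_diff_distrib sum_subtractf flip: sum_distrib_right)
      qed
      ultimately have "smooth_on (V j) (\<lambda>x. f0 x + W x)" using smooth_on_cong[OF V(1)] by (metis (no_types, lifting))
      then show "\<exists>T. open T \<and> x \<in> T \<and> smooth_on T (\<lambda>x. f0 x + W x)" using V(1) j by blast
    qed
  qed
qed

section \<open>Germs of functions on a manifold\<close>

text \<open>Quantifying over all charts at the point makes closure under sums and products immediate, since both
  operands are available in the same chart. One chart suffices by \<open>smooth_at_ptI\<close>.\<close>

definition smooth_at_pt :: "('m, 'e::euclidean_space) chart set \<Rightarrow> ('m \<Rightarrow> real) \<Rightarrow> 'm \<Rightarrow> bool" where
  "smooth_at_pt A f x \<longleftrightarrow> (\<forall>(U, \<phi>)\<in>A. x \<in> U \<longrightarrow>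
     (\<exists>N. open N \<and> \<phi> x \<in> N \<and> smooth_on N (in_chart (U, \<phi>) f)))"

definition semiconcave_at_pt :: "('m, 'e::euclidean_space) chart set \<Rightarrow> ('m \<Rightarrow> real) \<Rightarrow> 'm \<Rightarrow> bool" where
  "semiconcave_at_pt A f x \<longleftrightarrow> (\<forall>(U, \<phi>)\<in>A. x \<in> U \<longrightarrow> semiconcave_near (in_chart (U, \<phi>) f) (\<phi> x))"

lemma chart_facts:
  assumes "smooth_structure A" "(U, \<phi>) \<in> A"
  shows "open U" "open (\<phi> ` U)" "homeomorphism U (\<phi> ` U) \<phi> (inv_into U \<phi>)" "inj_on \<phi> U"
    "continuous_on U \<phi>" "continuous_on (\<phi> ` U) (inv_into U \<phi>)"
proof -
  have "chart (U, \<phi>)" using assms unfolding smooth_structure_def by blast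
  then show 1: "open U" "open (\<phi> ` U)" "homeomorphism U (\<phi> ` U) \<phi> (inv_into U \<phi>)" by (auto simp: chart_def)
  then show "continuous_on U \<phi>" "continuous_on (\<phi> ` U) (inv_into U \<phi>)" "inj_on \<phi> U"
    by (auto simp: homeomorphism_def intro!: inj_on_inverseI)
qed

lemma chart_compatible:
  assumes "smooth_structure A" "(U, \<phi>) \<in> A" "(V, \<psi>) \<in> A"
  shows "smooth_on (\<phi> ` (U \<inter> V)) (in_chart (U, \<phi>) \<psi>)" "smooth_on (\<psi> ` (U \<inter> V)) (in_chart (V, \<psi>) \<phi>)"
proof -
  have "\<forall>k\<in>A. \<forall>l\<in>A. compatible k l" using assms(1) unfolding smooth_structure_def by (elim conjE)
  then have "compatible (U, \<phi>) (V, \<psi>)" using assms(2,3) by blast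
  then show "smooth_on (\<phi> ` (U \<inter> V)) (in_chart (U, \<phi>) \<psi>)" "smooth_on (\<psi> ` (U \<inter> V)) (in_chart (V, \<psi>) \<phi>)"
    by (simp_all add: compatible_def)
qed

lemma in_chart_apply [simp]: "inj_on \<phi> U \<Longrightarrow> x \<in> U \<Longrightarrow> in_chart (U, \<phi>) f (\<phi> x) = f x"
  by (simp add: in_chart_def)

lemma chart_at:
  assumes "smooth_structure A" obtains U \<phi> where "(U, \<phi>) \<in> A" "x \<in> U"
proof -
  have "x \<in> (\<Union>(U, \<phi>)\<in>A. U)" using assms by (simp add: smooth_structure_def)
  then show thesis using that by auto
qed

lemma open_chart_image:
  assumes "smooth_structure A" "(U, \<phi>) \<in> A" "open W"
  shows "open (\<phi> ` (U \<inter> W))"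
proof -
  note c = chart_facts[OF assms(1,2)]
  have "\<phi> ` (U \<inter> W) = \<phi> ` U \<inter> inv_into U \<phi> -` W"
    using c(4) by (auto simp: inv_into_f_f)
  then show ?thesis using continuous_open_preimage[OF c(6,2) assms(3)] by simp
qed

lemma open_chart_preimage:
  assumes "smooth_structure A" "(U, \<phi>) \<in> A" "open N"
  shows "open {y \<in> U. \<phi> y \<in> N}"
  using continuous_open_preimage[OF chart_facts(5,1)[OF assms(1,2)] assms(3)]
  by (simp add: vimage_def Int_def)

text \<open>Restrictions are compatible with the whole atlas and belong to it by maximality. The regularity classes
  on the manifold ask for a property on the whole image of some chart, so they are reached from local
  statements by restriction.\<close>

lemma chart_restrict:
  assumes A: "smooth_structure A" and U: "(U, \<phi>) \<in> A" and W: "open W"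
  shows "(U \<inter> W, \<phi>) \<in> A"
proof -
  note c = chart_facts[OF A U]
  have inv: "inv_into (U \<inter> W) \<phi> z = inv_into U \<phi> z" if "z \<in> \<phi> ` (U \<inter> W)" for z
    using that c(4) inj_on_subset[OF c(4), of "U \<inter> W"] by (auto simp: inv_into_f_f)
  have "homeomorphism (U \<inter> W) (\<phi> ` (U \<inter> W)) \<phi> (inv_into U \<phi>)"
    by (rule homeomorphism_of_subsets[OF c(3)]) auto
  then have "homeomorphism (U \<inter> W) (\<phi> ` (U \<inter> W)) \<phi> (inv_into (U \<inter> W) \<phi>)"
    by (rule homeomorphism_cong) (use inv in auto)
  then have "chart (U \<inter> W, \<phi>)"
    using c(1) W open_chart_image[OF A U W] by (auto simp: chart_def)
  moreover have "compatible (U \<inter> W, \<phi>) l" if l: "l \<in> A" for l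
  proof -
    obtain V \<psi> where V: "l = (V, \<psi>)" by force
    note s = chart_compatible[OF A U l[unfolded V]]
    have op: "open (\<phi> ` (U \<inter> W \<inter> V))"
      using open_chart_image[OF A U, of "W \<inter> V"] W chart_facts(1)[OF A, of V \<psi>] l V by (auto simp: Int_assoc)
    have "smooth_on (\<phi> ` (U \<inter> W \<inter> V)) (in_chart (U, \<phi>) \<psi>)"
      by (rule smooth_on_subset[OF s(1)]) auto
    then have "smooth_on (\<phi> ` (U \<inter> W \<inter> V)) (in_chart (U \<inter> W, \<phi>) \<psi>)"
      by (subst smooth_on_cong[OF op]) (auto simp: in_chart_def inv)
    moreover have "smooth_on (\<psi> ` (U \<inter> W \<inter> V)) (in_chart (V, \<psi>) \<phi>)"
      by (rule smooth_on_subset[OF s(2)]) auto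
    ultimately show ?thesis by (simp add: compatible_def V)
  qed
  moreover have "\<forall>k. chart k \<and> (\<forall>l\<in>A. compatible k l) \<longrightarrow> k \<in> A"
    using A unfolding smooth_structure_def by (elim conjE)
  ultimately show ?thesis by blast
qed

lemma chart_transition:
  assumes A: "smooth_structure A" and U: "(U, \<phi>) \<in> A" "x \<in> U" and V: "(V, \<psi>) \<in> A" "x \<in> V"
  obtains S \<tau> where "open S" "\<psi> x \<in> S" "smooth_on S \<tau>" "\<tau> (\<psi> x) = \<phi> x" "\<tau> ` S \<subseteq> \<phi> ` U"
    "\<And>f z. z \<in> S \<Longrightarrow> in_chart (V, \<psi>) f z = in_chart (U, \<phi>) f (\<tau> z)"
proof (rule that[of "\<psi> ` (U \<inter> V)" "in_chart (V, \<psi>) \<phi>"])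
  note cU = chart_facts[OF A U(1)] and cV = chart_facts[OF A V(1)]
  show "open (\<psi> ` (U \<inter> V))" using open_chart_image[OF A V(1) cU(1)] by (simp add: Int_commute)
  show "smooth_on (\<psi> ` (U \<inter> V)) (in_chart (V, \<psi>) \<phi>)" by (rule chart_compatible(2)[OF A U(1) V(1)])
  show "in_chart (V, \<psi>) \<phi> ` \<psi> ` (U \<inter> V) \<subseteq> \<phi> ` U"
    using cV(4) by (auto simp: in_chart_def inv_into_f_f)
  show "in_chart (V, \<psi>) f z = in_chart (U, \<phi>) f (in_chart (V, \<psi>) \<phi> z)" if "z \<in> \<psi> ` (U \<inter> V)" for f :: "_ \<Rightarrow> 'z" and z
    using that cU(4) cV(4) by (auto simp: in_chart_def inv_into_f_f)
qed (use U V chart_facts(4)[OF A V(1)] in \<open>auto simp: in_chart_def inv_into_f_f\<close>)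

lemma smooth_at_ptI:
  assumes A: "smooth_structure A" and U: "(U, \<phi>) \<in> A" "x \<in> U"
    and N: "open N" "\<phi> x \<in> N" "smooth_on N (in_chart (U, \<phi>) f)"
  shows "smooth_at_pt A f x"
  unfolding smooth_at_pt_def
proof (intro ballI, clarify)
  fix V \<psi> assume V: "(V, \<psi>) \<in> A" "x \<in> V"
  obtain S \<tau> where S: "open S" "\<psi> x \<in> S" "smooth_on S \<tau>" "\<tau> (\<psi> x) = \<phi> x"
    "\<And>z. z \<in> S \<Longrightarrow> in_chart (V, \<psi>) f z = in_chart (U, \<phi>) f (\<tau> z)"
    using chart_transition[OF A U V] by metis
  define T where "T = S \<inter> \<tau> -` N"
  have T: "open T" unfolding T_def
    using continuous_open_preimage[OF smooth_on_continuous[OF S(3)] S(1) N(1)] .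
  have "smooth_on T (\<lambda>z. in_chart (U, \<phi>) f (\<tau> z))"
    by (rule smooth_on_compose[OF T N(1) _ N(3) smooth_on_subset[OF S(3)]]) (auto simp: T_def)
  then have "smooth_on T (in_chart (V, \<psi>) f)"
    by (subst smooth_on_cong[OF T]) (auto simp: T_def S(5))
  then show "\<exists>N. open N \<and> \<psi> x \<in> N \<and> smooth_on N (in_chart (V, \<psi>) f)"
    using T S(2,4) N(2) by (intro exI[of _ T]) (auto simp: T_def)
qed

lemma semiconcave_at_ptI:
  assumes A: "smooth_structure A" and U: "(U, \<phi>) \<in> A" "x \<in> U"
    and f: "semiconcave_near (in_chart (U, \<phi>) f) (\<phi> x)"
  shows "semiconcave_at_pt A f x"
  unfolding semiconcave_at_pt_def
proof (intro ballI, clarify)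
  fix V \<psi> assume V: "(V, \<psi>) \<in> A" "x \<in> V"
  obtain S \<tau> where S: "open S" "\<psi> x \<in> S" "smooth_on S \<tau>" "\<tau> (\<psi> x) = \<phi> x"
    "\<And>z. z \<in> S \<Longrightarrow> in_chart (V, \<psi>) f z = in_chart (U, \<phi>) f (\<tau> z)"
    using chart_transition[OF A U V] by metis
  have "semiconcave_near (\<lambda>z. in_chart (U, \<phi>) f (\<tau> z)) (\<psi> x)"
    by (rule semiconcave_near_compose) (use f S(4) smooth_on_imp_c11_near[OF S(3,1,2)] in auto)
  then show "semiconcave_near (in_chart (V, \<psi>) f) (\<psi> x)"
    using semiconcave_near_cong[OF S(1,2), of "\<lambda>z. in_chart (U, \<phi>) f (\<tau> z)" "in_chart (V, \<psi>) f"] S(5) by auto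
qed

lemma in_chart_eq_near:
  assumes A: "smooth_structure A" and U: "(U, \<phi>) \<in> A" "x \<in> U"
    and W: "open W" "x \<in> W" "\<And>y. y \<in> W \<Longrightarrow> f y = g y"
  obtains S where "open S" "\<phi> x \<in> S" "\<And>z. z \<in> S \<Longrightarrow> in_chart (U, \<phi>) f z = in_chart (U, \<phi>) g z"
  by (rule that[of "\<phi> ` (U \<inter> W)"])
    (use open_chart_image[OF A U(1) W(1)] chart_facts(4)[OF A U(1)] U W in auto)

lemma smooth_at_pt_cong:
  assumes A: "smooth_structure A" and W: "open W" "x \<in> W" "\<And>y. y \<in> W \<Longrightarrow> f y = g y"
    and f: "smooth_at_pt A f x"
  shows "smooth_at_pt A g x"
proof -
  obtain U \<phi> where U: "(U, \<phi>) \<in> A" "x \<in> U" using chart_at[OF A] by blast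
  obtain N where N: "open N" "\<phi> x \<in> N" "smooth_on N (in_chart (U, \<phi>) f)"
    using f U by (auto simp: smooth_at_pt_def)
  obtain S where S: "open S" "\<phi> x \<in> S" "\<And>z. z \<in> S \<Longrightarrow> in_chart (U, \<phi>) f z = in_chart (U, \<phi>) g z"
    using in_chart_eq_near[of A U \<phi> x W f g] A U W by blast
  have "smooth_on (N \<inter> S) (in_chart (U, \<phi>) f)" by (rule smooth_on_subset[OF N(3)]) auto
  then have "smooth_on (N \<inter> S) (in_chart (U, \<phi>) g)"
    using smooth_on_cong[of "N \<inter> S" "in_chart (U, \<phi>) f" "in_chart (U, \<phi>) g"] N(1) S by auto
  then show ?thesis using smooth_at_ptI[OF A U, of "N \<inter> S"] N S by auto
qed

lemma semiconcave_at_pt_cong: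
  assumes A: "smooth_structure A" and W: "open W" "x \<in> W" "\<And>y. y \<in> W \<Longrightarrow> f y = g y"
    and f: "semiconcave_at_pt A f x"
  shows "semiconcave_at_pt A g x"
proof -
  obtain U \<phi> where U: "(U, \<phi>) \<in> A" "x \<in> U" using chart_at[OF A] by blast
  obtain S where S: "open S" "\<phi> x \<in> S" "\<And>z. z \<in> S \<Longrightarrow> in_chart (U, \<phi>) f z = in_chart (U, \<phi>) g z"
    using in_chart_eq_near[of A U \<phi> x W f g] A U W by blast
  have "semiconcave_near (in_chart (U, \<phi>) f) (\<phi> x)" using f U by (auto simp: semiconcave_at_pt_def)
  then have "semiconcave_near (in_chart (U, \<phi>) g) (\<phi> x)"
    using semiconcave_near_cong[OF S(1,2)] S(3) by blast
  then show ?thesis by (rule semiconcave_at_ptI[OF A U])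
qed

lemma smooth_at_pt_const: "smooth_at_pt A (\<lambda>_. c) x"
  unfolding smooth_at_pt_def by (auto simp: in_chart_def intro!: exI[of _ UNIV] smooth_on_const)

lemma smooth_at_pt_binop:
  fixes A :: "('m::topological_space, 'e::euclidean_space) chart set"
  assumes A: "smooth_structure A" and f: "smooth_at_pt A f x" and g: "smooth_at_pt A g x"
    and op: "\<And>N (f::'e \<Rightarrow> real) g. open N \<Longrightarrow> smooth_on N f \<Longrightarrow> smooth_on N g \<Longrightarrow> smooth_on N (\<lambda>z. h (f z) (g z))"
  shows "smooth_at_pt A (\<lambda>y. h (f y) (g y)) x"
  unfolding smooth_at_pt_def
proof (intro ballI, clarify)
  fix U and \<phi> :: "_ \<Rightarrow> 'e" assume U: "(U, \<phi>) \<in> A" "x \<in> U"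
  obtain N where N: "open N" "\<phi> x \<in> N" "smooth_on N (in_chart (U, \<phi>) f)"
    using f U by (auto simp: smooth_at_pt_def)
  obtain M where M: "open M" "\<phi> x \<in> M" "smooth_on M (in_chart (U, \<phi>) g)"
    using g U by (auto simp: smooth_at_pt_def)
  have "smooth_on (N \<inter> M) (\<lambda>z. h (in_chart (U, \<phi>) f z) (in_chart (U, \<phi>) g z))"
    by (intro op open_Int N M smooth_on_subset[OF N(3)] smooth_on_subset[OF M(3)]) auto
  then show "\<exists>N. open N \<and> \<phi> x \<in> N \<and> smooth_on N (in_chart (U, \<phi>) (\<lambda>y. h (f y) (g y)))"
    using N M by (intro exI[of _ "N \<inter> M"]) (auto simp: in_chart_def)
qed

lemma smooth_at_pt_mult:
  "smooth_structure A \<Longrightarrow> smooth_at_pt A f x \<Longrightarrow> smooth_at_pt A g x \<Longrightarrow> smooth_at_pt A (\<lambda>y. f y * g y) x"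
  by (rule smooth_at_pt_binop) (auto intro: smooth_on_mult)

lemma smooth_at_pt_diff:
  "smooth_structure A \<Longrightarrow> smooth_at_pt A f x \<Longrightarrow> smooth_at_pt A g x \<Longrightarrow> smooth_at_pt A (\<lambda>y. f y - g y) x"
  by (rule smooth_at_pt_binop) (auto intro: smooth_on_diff)

lemma smooth_at_pt_sum:
  assumes A: "smooth_structure A" and "\<And>i. i \<in> I \<Longrightarrow> smooth_at_pt A (f i) x"
  shows "smooth_at_pt A (\<lambda>y. \<Sum>i\<in>I. f i y) x"
  using assms(2)
  by (induction I rule: infinite_finite_induct)
    (auto intro!: smooth_at_pt_const smooth_at_pt_binop[OF A, where h="(+)"] smooth_on_add)

lemma smooth_at_pt_prod:
  assumes A: "smooth_structure A" and "\<And>i. i \<in> I \<Longrightarrow> smooth_at_pt A (f i) x"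
  shows "smooth_at_pt A (\<lambda>y. \<Prod>i\<in>I. f i y) x"
  using assms(2)
  by (induction I rule: infinite_finite_induct)
    (auto intro!: smooth_at_pt_const smooth_at_pt_mult[OF A])

lemma smooth_at_pt_imp_c11_near:
  "smooth_at_pt A f x \<Longrightarrow> (U, \<phi>) \<in> A \<Longrightarrow> x \<in> U \<Longrightarrow> c11_near (in_chart (U, \<phi>) f) (\<phi> x)"
  unfolding smooth_at_pt_def using smooth_on_imp_c11_near by blast

lemma smooth_at_pt_imp_semiconcave_at_pt:
  assumes "smooth_at_pt A f x" shows "semiconcave_at_pt A f x"
  unfolding semiconcave_at_pt_def
  by (intro ballI, clarify) (rule c11_near_imp_semiconcave_near(1)[OF smooth_at_pt_imp_c11_near[OF assms]])

lemma semiconcave_at_pt_mult: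
  assumes "smooth_at_pt A \<beta> x" "semiconcave_at_pt A f x" "\<And>y. \<beta> y \<ge> 0"
  shows "semiconcave_at_pt A (\<lambda>y. \<beta> y * f y) x"
  unfolding semiconcave_at_pt_def
proof (intro ballI, clarify)
  fix U \<phi> assume U: "(U, \<phi>) \<in> A" "x \<in> U"
  have "semiconcave_near (\<lambda>z. in_chart (U, \<phi>) \<beta> z * in_chart (U, \<phi>) f z) (\<phi> x)"
    by (rule semiconcave_near_mult)
      (use assms U smooth_at_pt_imp_c11_near in \<open>auto simp: semiconcave_at_pt_def, auto simp: in_chart_def\<close>)
  then show "semiconcave_near (in_chart (U, \<phi>) (\<lambda>y. \<beta> y * f y)) (\<phi> x)"
    by (simp add: in_chart_def)
qed

lemma semiconcave_at_pt_add:
  assumes "semiconcave_at_pt A f x" "semiconcave_at_pt A g x"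
  shows "semiconcave_at_pt A (\<lambda>y. f y + g y) x"
  unfolding semiconcave_at_pt_def
proof (intro ballI, clarify)
  fix U \<phi> assume U: "(U, \<phi>) \<in> A" "x \<in> U"
  have "semiconcave_near (\<lambda>z. in_chart (U, \<phi>) f z + in_chart (U, \<phi>) g z) (\<phi> x)"
    by (rule semiconcave_near_add) (use assms U in \<open>auto simp: semiconcave_at_pt_def\<close>)
  then show "semiconcave_near (in_chart (U, \<phi>) (\<lambda>y. f y + g y)) (\<phi> x)"
    by (simp add: in_chart_def)
qed

lemma semiconcave_at_pt_sum:
  assumes "\<And>i. i \<in> I \<Longrightarrow> semiconcave_at_pt A (f i) x"
  shows "semiconcave_at_pt A (\<lambda>y. \<Sum>i\<in>I. f i y) x"
  using assms
  by (induction I rule: infinite_finite_induct)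
    (simp_all add: semiconcave_at_pt_add smooth_at_pt_imp_semiconcave_at_pt[OF smooth_at_pt_const])

lemma bounded_second_diff_imp_semiconcave_near:
  fixes f :: "'a::euclidean_space \<Rightarrow> real"
  assumes "bounded_second_diff C f" "\<And>x. \<bar>f x\<bar> \<le> B"
  shows "semiconcave_near f p" "semiconcave_near (\<lambda>x. - f x) p"
proof -
  obtain L where L: "L-lipschitz_on UNIV f" using bounded_second_diff_lipschitz[OF assms] .
  have "c11_on (ball p 1) (max L C) f"
    unfolding c11_on_def
  proof (intro conjI allI impI)
    show "(max L C)-lipschitz_on (ball p 1) f"
      by (rule lipschitz_on_mono[OF L]) auto
    fix x z
    have "norm (second_diff f x z) \<le> C * (norm z)\<^sup>2" using assms(1) by (simp add: bounded_second_diff_def)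
    also have "\<dots> \<le> max L C * (norm z)\<^sup>2" by (intro mult_right_mono) auto
    finally show "norm (second_diff f x z) \<le> max L C * (norm z)\<^sup>2" .
  qed
  then have "c11_near f p" unfolding c11_near_def by (intro exI[of _ 1]) auto
  then show "semiconcave_near f p" "semiconcave_near (\<lambda>x. - f x) p"
    by (rule c11_near_imp_semiconcave_near)+
qed

section \<open>Insertion on a manifold\<close>

text \<open>The last property expresses that the support of \<open>\<beta>\<close> lies well inside the chart. The
  support is compact, hence closed because the manifold is Hausdorff; so the extension by zero is smooth.\<close>

lemma chart_bump:
  fixes A :: "('m::t2_space, 'e::euclidean_space) chart set"
  assumes A: "smooth_structure A" and U: "(U, \<phi>) \<in> A" "x \<in> U" and r: "r > 0"
  obtains \<beta> :: "'m \<Rightarrow> real" and V where "\<And>y. 0 \<le> \<beta> y \<and> \<beta> y \<le> 1" "\<And>y. smooth_at_pt A \<beta> y"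
    "open V" "x \<in> V" "\<And>y. y \<in> V \<Longrightarrow> \<beta> y = 1"
    "\<And>y. (\<exists>W. open W \<and> y \<in> W \<and> (\<forall>z\<in>W. \<beta> z = 0)) \<or> (y \<in> U \<and> \<phi> y \<in> ball (\<phi> x) r)"
proof -
  note c = chart_facts[OF A U(1)]
  obtain r1 where r1: "r1 > 0" "cball (\<phi> x) r1 \<subseteq> \<phi> ` U" using c(2) U(2) open_contains_cball by blast
  define R where "R = min r1 r / 2"
  have R: "R > 0" "R < r1" "R < r" using r1 r by (auto simp: R_def)
  have "0 < R / 2" "R / 2 < R" using R by auto
  from smooth_bump_exists[OF this, of "\<phi> x"] obtain \<rho> :: "'e \<Rightarrow> real" where \<rho>: "smooth_on UNIV \<rho>"
    "\<forall>z. 0 \<le> \<rho> z \<and> \<rho> z \<le> 1" "\<forall>z\<in>cball (\<phi> x) (R / 2). \<rho> z = 1" "\<forall>z. z \<notin> ball (\<phi> x) R \<longrightarrow> \<rho> z = 0"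
    by blast
  define \<beta> where "\<beta> y = (if y \<in> U then \<rho> (\<phi> y) else 0)" for y
  define K where "K = inv_into U \<phi> ` cball (\<phi> x) R"
  have sub: "cball (\<phi> x) R \<subseteq> \<phi> ` U" using R r1(2) by auto
  have "compact K" unfolding K_def
    by (intro compact_continuous_image continuous_on_subset[OF c(6) sub] compact_cball)
  then have K: "open (- K)" by (simp add: compact_imp_closed open_Compl)
  have \<beta>0: "\<beta> z = 0" if "z \<in> - K" for z
  proof (cases "z \<in> U")
    case True
    then have "inv_into U \<phi> (\<phi> z) = z" using c(4) by (simp add: inv_into_f_f)
    then have "\<phi> z \<notin> cball (\<phi> x) R" using that unfolding K_def by (metis ComplD imageI)
    then show ?thesis using \<rho>(4) by (simp add: \<beta>_def)
  qed (simp add: \<beta>_def)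
  have Kin: "y \<in> U \<and> \<phi> y \<in> ball (\<phi> x) r" if y: "y \<in> K" for y
  proof -
    obtain z where z: "z \<in> cball (\<phi> x) R" "y = inv_into U \<phi> z" using y by (auto simp: K_def)
    then have "z \<in> \<phi> ` U" using sub by blast
    then show ?thesis using z R by (auto simp: inv_into_into f_inv_into_f)
  qed
  show thesis
  proof (rule that[of \<beta> "{y \<in> U. \<phi> y \<in> ball (\<phi> x) (R / 2)}"])
    show "0 \<le> \<beta> y \<and> \<beta> y \<le> 1" for y using \<rho>(2) by (simp add: \<beta>_def)
    show "open {y \<in> U. \<phi> y \<in> ball (\<phi> x) (R / 2)}" by (rule open_chart_preimage[OF A U(1) open_ball])
    show "x \<in> {y \<in> U. \<phi> y \<in> ball (\<phi> x) (R / 2)}" using U R by simp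
    show "\<beta> y = 1" if "y \<in> {y \<in> U. \<phi> y \<in> ball (\<phi> x) (R / 2)}" for y
      using that \<rho>(3) by (simp add: \<beta>_def)
    show "(\<exists>W. open W \<and> y \<in> W \<and> (\<forall>z\<in>W. \<beta> z = 0)) \<or> (y \<in> U \<and> \<phi> y \<in> ball (\<phi> x) r)" for y
      using Kin[of y] K \<beta>0 by (cases "y \<in> K") blast+
    show "smooth_at_pt A \<beta> y" for y
    proof (cases "y \<in> K")
      case True
      then have y: "y \<in> U" using Kin by blast
      have "smooth_on (\<phi> ` U) \<rho>" using smooth_on_subset[OF \<rho>(1)] by blast
      then have "smooth_on (\<phi> ` U) (in_chart (U, \<phi>) \<beta>)"
        by (rule smooth_on_cong[OF c(2), THEN iffD1, rotated]) (auto simp: c(4) \<beta>_def)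
      then show ?thesis using smooth_at_ptI[OF A U(1) y c(2)] y by blast
    next
      case False
      then show ?thesis
        using smooth_at_pt_cong[OF A K, of y "\<lambda>_. 0" \<beta>] \<beta>0 smooth_at_pt_const by force
    qed
  qed
qed

text \<open>The conclusion of the insertion theorem, localised at a point in such a way that each clause passes to
  locally finite convex combinations with smooth coefficients.\<close>

definition inserted_at ::
  "('m, 'e::euclidean_space) chart set \<Rightarrow> ('m \<Rightarrow> real) \<Rightarrow> ('m \<Rightarrow> real) \<Rightarrow> ('m \<Rightarrow> real) \<Rightarrow> 'm \<Rightarrow> bool" where
  "inserted_at A a b f y \<longleftrightarrow>
     semiconcave_at_pt A f y \<and> semiconcave_at_pt A (\<lambda>y. - f y) y \<and> a y \<le> f y \<and> f y \<le> b y \<and>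
     (a y < b y \<longrightarrow> smooth_at_pt A f y \<and> a y < f y \<and> f y < b y)"

text \<open>Near \<open>x\<close>, the coordinate expressions of \<open>a\<close> and \<open>b\<close> agree with
  functions on the whole Euclidean space to which \<open>smooth_strict_insertion\<close> applies, namely
  their products with a common bump function \<open>\<rho>\<close>.\<close>

lemma local_insertion:
  fixes A :: "('m::t2_space, 'e::euclidean_space) chart set"
  assumes A: "smooth_structure A" and U: "(U, \<phi>) \<in> A" "x \<in> U"
    and b: "semiconcave_at_pt A b x" and a: "semiconcave_at_pt A (\<lambda>y. - a y) x"
    and ab: "\<And>y. a y \<le> b y"
  obtains f r where "r > 0" "\<And>y. y \<in> U \<Longrightarrow> \<phi> y \<in> ball (\<phi> x) r \<Longrightarrow> inserted_at A a b f y"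
proof -
  note c = chart_facts[OF A U(1)]
  define \<alpha> where "\<alpha> = in_chart (U, \<phi>) a"
  define \<gamma> where "\<gamma> = in_chart (U, \<phi>) b"
  have "semiconcave_near \<gamma> (\<phi> x)" "semiconcave_near (in_chart (U, \<phi>) (\<lambda>y. - a y)) (\<phi> x)"
    using a b U by (auto simp: semiconcave_at_pt_def \<gamma>_def)
  moreover have "in_chart (U, \<phi>) (\<lambda>y. - a y) = (\<lambda>z. - \<alpha> z)" by (simp add: in_chart_def \<alpha>_def fun_eq_iff)
  ultimately have sc: "semiconcave_near \<gamma> (\<phi> x)" "semiconcave_near (\<lambda>z. - \<alpha> z) (\<phi> x)" by simp_all
  obtain \<rho> r C B where \<rho>: "r > 0" "\<And>z. 0 \<le> \<rho> z" "\<And>z. z \<in> cball (\<phi> x) r \<Longrightarrow> \<rho> z = 1"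
    and \<gamma>: "semiconcave_with C (\<lambda>z. \<rho> z * \<gamma> z)" "continuous_on UNIV (\<lambda>z. \<rho> z * \<gamma> z)" "\<And>z. \<bar>\<rho> z * \<gamma> z\<bar> \<le> B"
    and \<alpha>: "semiconcave_with C (\<lambda>z. \<rho> z * - \<alpha> z)" "continuous_on UNIV (\<lambda>z. \<rho> z * - \<alpha> z)" "\<And>z. \<bar>\<rho> z * - \<alpha> z\<bar> \<le> B"
    by (rule simultaneous_cutoff[OF sc]) (rule that)
  have \<alpha>\<gamma>: "\<rho> z * \<alpha> z \<le> \<rho> z * \<gamma> z" for z
    using ab \<rho>(2) by (intro mult_left_mono) (auto simp: \<alpha>_def \<gamma>_def in_chart_def)
  have c\<alpha>: "continuous_on UNIV (\<lambda>z. \<rho> z * \<alpha> z)" using continuous_on_minus[OF \<alpha>(2)] by simp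
  have b\<alpha>: "\<bar>\<rho> z * \<alpha> z\<bar> \<le> B" for z using \<alpha>(3)[of z] by simp
  have s\<alpha>: "semiconcave_with C (\<lambda>z. - (\<rho> z * \<alpha> z))" using \<alpha>(1) by simp
  obtain F C' where F: "\<And>z. \<rho> z * \<alpha> z \<le> F z \<and> F z \<le> \<rho> z * \<gamma> z"
    "\<And>z. \<rho> z * \<alpha> z < \<rho> z * \<gamma> z \<Longrightarrow> \<rho> z * \<alpha> z < F z \<and> F z < \<rho> z * \<gamma> z"
    "bounded_second_diff C' F" "smooth_on {z. \<rho> z * \<alpha> z < \<rho> z * \<gamma> z} F"
    by (rule smooth_strict_insertion[OF \<alpha>\<gamma> c\<alpha> \<gamma>(2) b\<alpha> \<gamma>(3) \<gamma>(1) s\<alpha>]) (rule that)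
  have FB: "\<bar>F z\<bar> \<le> B" for z using F(1)[of z] b\<alpha>[of z] \<gamma>(3)[of z] by auto
  define f where "f y = F (\<phi> y)" for y
  have inf: "in_chart (U, \<phi>) f z = F z" if "z \<in> \<phi> ` U" for z
    using that c(4) by (auto simp: f_def)
  show thesis
  proof (rule that[OF \<rho>(1), of f])
    fix y assume y: "y \<in> U" "\<phi> y \<in> ball (\<phi> x) r"
    have \<phi>y: "\<phi> y \<in> \<phi> ` U" using y by blast
    have val: "\<rho> (\<phi> y) * \<alpha> (\<phi> y) = a y" "\<rho> (\<phi> y) * \<gamma> (\<phi> y) = b y"
      using \<rho>(3)[of "\<phi> y"] y c(4) by (simp_all add: \<alpha>_def \<gamma>_def)
    have "semiconcave_near (in_chart (U, \<phi>) f) (\<phi> y)"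
      by (rule semiconcave_near_cong[OF c(2) \<phi>y _ bounded_second_diff_imp_semiconcave_near(1)[OF F(3) FB]])
        (simp add: inf)
    then have 1: "semiconcave_at_pt A f y" by (rule semiconcave_at_ptI[OF A U(1) y(1)])
    have "semiconcave_near (in_chart (U, \<phi>) (\<lambda>y. - f y)) (\<phi> y)"
      by (rule semiconcave_near_cong[OF c(2) \<phi>y _ bounded_second_diff_imp_semiconcave_near(2)[OF F(3) FB]])
        (use inf in \<open>simp add: in_chart_def\<close>)
    then have 2: "semiconcave_at_pt A (\<lambda>y. - f y) y" by (rule semiconcave_at_ptI[OF A U(1) y(1)])
    have 3: "smooth_at_pt A f y" if "a y < b y"
    proof -
      define N where "N = {z. \<rho> z * \<alpha> z < \<rho> z * \<gamma> z} \<inter> \<phi> ` U"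
      have N: "open N" unfolding N_def using c\<alpha> \<gamma>(2) c(2) by (intro open_Int open_Collect_less)
      have "smooth_on N F" by (rule smooth_on_subset[OF F(4)]) (auto simp: N_def)
      then have "smooth_on N (in_chart (U, \<phi>) f)"
        by (rule smooth_on_cong[OF N, THEN iffD1, rotated]) (simp add: N_def inf)
      moreover have "\<phi> y \<in> N" using val that \<phi>y by (simp add: N_def)
      ultimately show ?thesis using smooth_at_ptI[OF A U(1) y(1) N] by blast
    qed
    show "inserted_at A a b f y"
      unfolding inserted_at_def using 1 2 3 F(1)[of "\<phi> y"] F(2)[of "\<phi> y"] unfolding val by (auto simp: f_def)
  qed
qed

text \<open>Local solutions are glued by a partition of unity. At points outside the domain of a local solution its
  coefficient vanishes identically nearby, so arbitrary values there do no harm.\<close>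

lemma manifold_insertion:
  fixes A :: "('m::{t2_space, second_countable_topology}, 'e::euclidean_space) chart set"
  assumes A: "smooth_structure A"
    and b: "\<And>x. semiconcave_at_pt A b x" and a: "\<And>x. semiconcave_at_pt A (\<lambda>y. - a y) x"
    and ab: "\<And>y. a y \<le> b y"
  obtains v where "\<And>y. a y \<le> v y \<and> v y \<le> b y" "\<And>y. a y < b y \<Longrightarrow> a y < v y \<and> v y < b y"
    "\<And>y. semiconcave_at_pt A v y" "\<And>y. semiconcave_at_pt A (\<lambda>y. - v y) y"
    "\<And>y. a y < b y \<Longrightarrow> smooth_at_pt A v y"
proof -
  define P where "P V = (\<lambda>(\<beta>, f). (\<forall>y. 0 \<le> \<beta> y \<and> \<beta> y \<le> 1) \<and> (\<forall>y. smooth_at_pt A \<beta> y) \<and> (\<forall>y\<in>V. \<beta> y = 1) \<and>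
    (\<forall>y. (\<exists>W. open W \<and> y \<in> W \<and> (\<forall>z\<in>W. \<beta> z = 0)) \<or> inserted_at A a b f y))" for V :: "'m set"
  have "\<exists>V p. open V \<and> x \<in> V \<and> P V p" for x
  proof -
    obtain U \<phi> where U: "(U, \<phi>) \<in> A" "x \<in> U" using chart_at[OF A] by blast
    obtain f r where f: "r > 0" "\<And>y. y \<in> U \<Longrightarrow> \<phi> y \<in> ball (\<phi> x) r \<Longrightarrow> inserted_at A a b f y"
      by (rule local_insertion[OF A U b a ab]) (rule that)
    obtain \<beta> :: "'m \<Rightarrow> real" and V where \<beta>: "\<And>y. 0 \<le> \<beta> y \<and> \<beta> y \<le> 1" "\<And>y. smooth_at_pt A \<beta> y"
      and V: "open V" "x \<in> V" "\<And>y. y \<in> V \<Longrightarrow> \<beta> y = 1"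
      and alt: "\<And>y. (\<exists>W. open W \<and> y \<in> W \<and> (\<forall>z\<in>W. \<beta> z = 0)) \<or> (y \<in> U \<and> \<phi> y \<in> ball (\<phi> x) r)"
      by (rule chart_bump[OF A U f(1)]) (rule that)
    have alt': "(\<exists>W. open W \<and> y \<in> W \<and> (\<forall>z\<in>W. \<beta> z = 0)) \<or> inserted_at A a b f y" for y
      using alt[of y] f(2)[of y] by blast
    have "P V (\<beta>, f)" unfolding P_def prod.case
      by (intro conjI allI ballI conjunct1[OF \<beta>(1)] conjunct2[OF \<beta>(1)] \<beta>(2) V(3) alt')
    then show ?thesis using V(1,2) by blast
  qed
  moreover have "P {} ((\<lambda>_. 0), (\<lambda>_. 0))"
    unfolding P_def by (auto simp: smooth_at_pt_const)
  ultimately obtain V p where V: "\<And>i::nat. open (V i)" "\<And>i. P (V i) (p i)" "UNIV \<subseteq> (\<Union>i. V i)"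
    using countable_cover_choice[of UNIV P "((\<lambda>_. 0), (\<lambda>_. 0))"] by metis
  define \<beta> where "\<beta> i = fst (p i)" for i
  define f where "f i = snd (p i)" for i
  have \<beta>: "0 \<le> \<beta> i y \<and> \<beta> i y \<le> 1" "smooth_at_pt A (\<beta> i) y" "y \<in> V i \<Longrightarrow> \<beta> i y = 1"
    and alt: "(\<exists>W. open W \<and> y \<in> W \<and> (\<forall>z\<in>W. \<beta> i z = 0)) \<or> inserted_at A a b (f i) y" for i y
    using V(2)[of i] unfolding P_def \<beta>_def f_def by (simp_all add: case_prod_beta)
  define g where "g = partition_from \<beta>"
  have g0: "g i y \<ge> 0" for i y
    unfolding g_def by (rule partition_from_nonneg[of \<beta>, OF \<beta>(1)])
  have gsm: "smooth_at_pt A (g i) y" for i y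
    unfolding g_def partition_from_def[abs_def]
    by (intro smooth_at_pt_mult[OF A] smooth_at_pt_prod[OF A] smooth_at_pt_diff[OF A] smooth_at_pt_const \<beta>)
  define v where "v y = (\<Sum>i. g i y * f i y)" for y
  have v: "v y = (\<Sum>i\<le>j. g i y * f i y)" "(\<Sum>i\<le>j. g i y) = 1" if "y \<in> V j" for y j
    unfolding v_def g_def
    by (rule suminf_partition_from[of \<beta>, OF \<beta>(3)[OF that]], rule partition_from_sum_eq_1[of \<beta>, OF \<beta>(3)[OF that]])
  have cover: "\<exists>j. y \<in> V j" for y using V(3) by blast
  have zero: "\<exists>W. open W \<and> y \<in> W \<and> (\<forall>z\<in>W. g i z = 0)" if "\<not> inserted_at A a b (f i) y" for i y
    using alt[of y i] that by (auto simp: g_def partition_from_def)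
  have good: "inserted_at A a b (f i) y" if "g i y \<noteq> 0" for i y
    using zero[of i y] that by blast
  have terms: "semiconcave_at_pt A (\<lambda>y. g i y * f i y) y \<and> semiconcave_at_pt A (\<lambda>y. g i y * - f i y) y \<and>
      (a y < b y \<longrightarrow> smooth_at_pt A (\<lambda>y. g i y * f i y) y)" for i y
  proof (cases "inserted_at A a b (f i) y")
    case True
    then show ?thesis
      unfolding inserted_at_def using semiconcave_at_pt_mult[OF gsm _ g0] smooth_at_pt_mult[OF A gsm] by blast
  next
    case False
    from zero[OF this] obtain W where W: "open W" "y \<in> W" "\<And>z. z \<in> W \<Longrightarrow> g i z = 0" by blast
    have sm0: "smooth_at_pt A (\<lambda>y. g i y * f i y) y" "smooth_at_pt A (\<lambda>y. g i y * - f i y) y"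
      by (rule smooth_at_pt_cong[OF A W(1,2) _ smooth_at_pt_const[of A 0]]; simp add: W(3))+
    show ?thesis by (intro conjI impI smooth_at_pt_imp_semiconcave_at_pt sm0)
  qed
  then have sc: "semiconcave_at_pt A (\<lambda>y. g i y * f i y) y" "semiconcave_at_pt A (\<lambda>y. g i y * - f i y) y"
      and sm: "a y < b y \<Longrightarrow> smooth_at_pt A (\<lambda>y. g i y * f i y) y" for i y
    by simp_all
  show thesis
  proof (rule that[of v])
    fix y
    obtain j where j: "y \<in> V j" using cover by blast
    show "a y \<le> v y \<and> v y \<le> b y"
      unfolding v(1)[OF j] using weighted_average_bounds[of "{..j}" "\<lambda>i. g i y" "a y" "\<lambda>i. f i y" "b y"]
        g0 v(2)[OF j] good by (simp add: inserted_at_def)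
    show "a y < v y \<and> v y < b y" if "a y < b y"
      unfolding v(1)[OF j] using weighted_average_strict_bounds[of "{..j}" "\<lambda>i. g i y" "a y" "\<lambda>i. f i y" "b y"]
        g0 v(2)[OF j] good that by (simp add: inserted_at_def)
    show "semiconcave_at_pt A v y"
      by (rule semiconcave_at_pt_cong[OF A V(1) j _ semiconcave_at_pt_sum[where I="{..j}", OF sc(1)]]) (simp add: v(1))
    show "semiconcave_at_pt A (\<lambda>y. - v y) y"
      by (rule semiconcave_at_pt_cong[OF A V(1) j _ semiconcave_at_pt_sum[where I="{..j}", OF sc(2)]])
        (simp add: v(1) sum_negf)
    show "smooth_at_pt A v y" if "a y < b y"
      by (rule smooth_at_pt_cong[OF A V(1) j _ smooth_at_pt_sum[where I="{..j}", OF A sm[OF that]]]) (simp add: v(1))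
  qed
qed

section \<open>Regularity classes on a manifold\<close>

lemma locally_semiconcave_imp_semiconcave_at_pt:
  assumes A: "smooth_structure A" and f: "locally_semiconcave A f"
  shows "semiconcave_at_pt A f x"
proof -
  obtain U \<phi> h s where U: "(U, \<phi>) \<in> A" "x \<in> U"
    and h: "concave_on (\<phi> ` U) h" and s: "smooth_on (\<phi> ` U) s" and eq: "\<And>p. p \<in> U \<Longrightarrow> f p = h (\<phi> p) + s (\<phi> p)"
    using f unfolding locally_semiconcave_def by fast
  note c = chart_facts[OF A U(1)]
  have x: "\<phi> x \<in> \<phi> ` U" using U by blast
  have "semiconcave_near (\<lambda>z. h z + s z) (\<phi> x)"
    by (intro semiconcave_near_add concave_on_imp_semiconcave_near[OF h c(2) x]
        c11_near_imp_semiconcave_near(1) smooth_on_imp_c11_near[OF s c(2) x])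
  then have "semiconcave_near (in_chart (U, \<phi>) f) (\<phi> x)"
    by (rule semiconcave_near_cong[OF c(2) x, rotated]) (auto simp: c(4) eq)
  then show ?thesis by (rule semiconcave_at_ptI[OF A U])
qed

text \<open>After a cutoff in a chart, \<open>bounded_second_diff_derivative\<close> applies to a function on the
  whole Euclidean space; the chart is then restricted to the region where the cutoff is trivial.\<close>

lemma semiconcave_at_pt_imp_locally_C11:
  fixes A :: "('m::topological_space, 'e::euclidean_space) chart set"
  assumes A: "smooth_structure A"
    and v: "\<And>x. semiconcave_at_pt A v x" "\<And>x. semiconcave_at_pt A (\<lambda>y. - v y) x"
  shows "locally_C11 A v"
  unfolding locally_C11_def
proof
  fix x
  obtain U \<phi> where U: "(U, \<phi>) \<in> A" "x \<in> U" using chart_at[OF A] by blast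
  note c = chart_facts[OF A U(1)]
  define V where "V = in_chart (U, \<phi>) v"
  have "semiconcave_near V (\<phi> x)" "semiconcave_near (in_chart (U, \<phi>) (\<lambda>y. - v y)) (\<phi> x)"
    using v(1)[of x] v(2)[of x] U by (auto simp: semiconcave_at_pt_def V_def)
  moreover have "in_chart (U, \<phi>) (\<lambda>y. - v y) = (\<lambda>z. - V z)" by (simp add: in_chart_def V_def fun_eq_iff)
  ultimately have sc: "semiconcave_near V (\<phi> x)" "semiconcave_near (\<lambda>z. - V z) (\<phi> x)" by simp_all
  obtain \<rho> r C B where \<rho>: "r > 0" "\<And>z. z \<in> cball (\<phi> x) r \<Longrightarrow> \<rho> z = 1"
    and F: "semiconcave_with C (\<lambda>z. \<rho> z * V z)" "\<And>z. \<bar>\<rho> z * V z\<bar> \<le> B" "semiconcave_with C (\<lambda>z. \<rho> z * - V z)"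
    by (rule simultaneous_cutoff[OF sc]) (rule that)
  have bsd: "bounded_second_diff C (\<lambda>z. \<rho> z * V z)" using F by (simp add: bounded_second_diff_iff)
  obtain D :: "'e \<Rightarrow> 'e \<Rightarrow>\<^sub>L real" where
    D: "\<And>z. ((\<lambda>z. \<rho> z * V z) has_derivative blinfun_apply (D z)) (at z)" "(3 * C)-lipschitz_on UNIV D"
    by (rule bounded_second_diff_derivative[OF bsd F(2)]) (rule that)
  define W where "W = {y \<in> U. \<phi> y \<in> ball (\<phi> x) r}"
  have W: "open W" unfolding W_def by (rule open_chart_preimage[OF A U(1) open_ball])
  have UW: "U \<inter> W = W" by (auto simp: W_def)
  have k: "(W, \<phi>) \<in> A" using chart_restrict[OF A U(1) W] by (simp add: UW)
  note cW = chart_facts[OF A k]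
  have "(in_chart (W, \<phi>) v has_derivative blinfun_apply (D z)) (at z)" if "z \<in> \<phi> ` W" for z
  proof (rule has_derivative_transform_within_open[OF D(1) cW(2) that])
    fix t assume "t \<in> \<phi> ` W"
    then obtain y where y: "y \<in> W" "t = \<phi> y" by blast
    then have "\<rho> t = 1" using \<rho>(2) by (auto simp: W_def)
    then show "\<rho> t * V t = in_chart (W, \<phi>) v t"
      using y cW(4) c(4) by (auto simp: V_def W_def)
  qed
  moreover have "(3 * C)-lipschitz_on (\<phi> ` W) D" by (rule lipschitz_on_subset[OF D(2)]) simp
  moreover have "x \<in> W" using U \<rho>(1) by (simp add: W_def)
  ultimately show "\<exists>(U, \<phi>)\<in>A. x \<in> U \<and> (\<exists>(D :: 'e \<Rightarrow> 'e \<Rightarrow>\<^sub>L real) L.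
           (\<forall>z\<in>\<phi> ` U. (in_chart (U, \<phi>) v has_derivative blinfun_apply (D z)) (at z)) \<and>
           L-lipschitz_on (\<phi> ` U) D)"
    using k by (intro bexI[OF _ k]) auto
qed

lemma smooth_at_pt_imp_smooth_fun_on:
  assumes A: "smooth_structure A" and v: "\<And>x. x \<in> W \<Longrightarrow> smooth_at_pt A v x"
  shows "smooth_fun_on A W v"
  unfolding smooth_fun_on_def
proof
  fix x assume x: "x \<in> W"
  obtain U \<phi> where U: "(U, \<phi>) \<in> A" "x \<in> U" using chart_at[OF A] by blast
  note c = chart_facts[OF A U(1)]
  obtain N where N: "open N" "\<phi> x \<in> N" "smooth_on N (in_chart (U, \<phi>) v)"
    using v[OF x] U by (auto simp: smooth_at_pt_def)
  define T where "T = {y \<in> U. \<phi> y \<in> N}"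
  have T: "open T" unfolding T_def by (rule open_chart_preimage[OF A U(1) N(1)])
  have UT: "U \<inter> T = T" by (auto simp: T_def)
  have k: "(T, \<phi>) \<in> A" using chart_restrict[OF A U(1) T] by (simp add: UT)
  note cT = chart_facts[OF A k]
  have "smooth_on (\<phi> ` T) (in_chart (U, \<phi>) v)" by (rule smooth_on_subset[OF N(3)]) (auto simp: T_def)
  then have "smooth_on (\<phi> ` T) (in_chart (T, \<phi>) v)"
    by (rule smooth_on_cong[OF cT(2), THEN iffD1, rotated]) (use c(4) cT(4) in \<open>auto simp: T_def\<close>)
  moreover have "x \<in> T" using U N by (simp add: T_def)
  ultimately show "\<exists>(U, \<phi>)\<in>A. x \<in> U \<and> smooth_on (\<phi> ` U) (in_chart (U, \<phi>) v)"
    by (intro bexI[OF _ k]) auto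
qed

section \<open>Subsolutions\<close>

lemma Tminus_le: "subsolution c u \<Longrightarrow> Tminus c u x \<le> u y + c y x"
  unfolding Tminus_def
  by (rule cINF_lower[OF bdd_belowI[of _ "u x"]]) (auto simp: subsolution_def algebra_simps)

lemma le_Tminus: "(\<And>y. l \<le> u y + c y x) \<Longrightarrow> l \<le> Tminus c u x"
  unfolding Tminus_def by (rule cINF_greatest) auto

lemma le_Tplus: "subsolution c u \<Longrightarrow> u y - c x y \<le> Tplus c u x"
  unfolding Tplus_def
  by (rule cSUP_upper[OF _ bdd_aboveI[of _ "u x"]]) (auto simp: subsolution_def algebra_simps)

lemma Tplus_le: "(\<And>y. u y - c x y \<le> l) \<Longrightarrow> Tplus c u x \<le> l"
  unfolding Tplus_def by (rule cSUP_least) auto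

lemma subsolution_Tminus_Tplus_bounds:
  assumes "subsolution c u" shows "Tplus c u x \<le> u x" "u x \<le> Tminus c u x"
proof -
  have "u y - u z \<le> c z y" for y z using assms by (simp add: subsolution_def)
  then show "Tplus c u x \<le> u x" "u x \<le> Tminus c u x"
    by (auto intro!: Tplus_le le_Tminus simp: algebra_simps)
qed

text \<open>The reason why insertion produces subsolutions.\<close>

lemma subsolution_between_above:
  assumes "subsolution c u" "\<And>x. u x \<le> v x" "\<And>x. v x \<le> Tminus c u x"
  shows "subsolution c v"
  unfolding subsolution_def
proof (intro allI)
  fix x y
  show "v y - v x \<le> c x y" using assms(3)[of y] Tminus_le[OF assms(1), of y x] assms(2)[of x] by simp
qed

lemma subsolution_between_below:
  assumes "subsolution c u" "\<And>x. v x \<le> u x" "\<And>x. Tplus c u x \<le> v x"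
  shows "subsolution c v"
  unfolding subsolution_def
proof (intro allI)
  fix x y
  show "v y - v x \<le> c x y" using assms(3)[of x] le_Tplus[OF assms(1), of y x] assms(2)[of y] by simp
qed

lemma subsolution_Tplus: "subsolution c u \<Longrightarrow> subsolution c (Tplus c u)"
  by (rule subsolution_between_below) (auto intro: subsolution_Tminus_Tplus_bounds)

lemma subsolution_midpoint:
  assumes "subsolution c u"
  shows "subsolution c (\<lambda>x. (u x + Tminus c u x) / 2)"
  by (rule subsolution_between_above[OF assms])
    (use subsolution_Tminus_Tplus_bounds(2)[OF assms] in \<open>simp_all add: field_simps\<close>)

text \<open>The witness is \<open>w = (u + T\<^sup>- u) / 2\<close>. From \<open>T\<^sup>+ T\<^sup>- u \<le>
  u\<close> one gets \<open>T\<^sup>+ w \<le> (T\<^sup>+ u + u) / 2\<close>, and \<open>(T\<^sup>+ u + u)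
  / 2 = w\<close> forces \<open>T\<^sup>+ u = u = T\<^sup>- u\<close>. Only \<open>T\<^sup>+ w\<close> and
  \<open>T\<^sup>- T\<^sup>+ w\<close> enter the conclusion, since they are the barriers for the
  insertion.\<close>

lemma free_subsolution:
  assumes u: "subsolution c u"
  obtains w where "subsolution c w"
    "\<And>x. x \<in> aubry c u \<Longrightarrow> Tplus c w x = u x \<and> Tminus c (Tplus c w) x = u x"
    "\<And>x. x \<notin> aubry c u \<Longrightarrow> Tplus c w x < Tminus c (Tplus c w) x"
    "\<And>x. Tplus c w x \<le> Tminus c (Tplus c w) x"
proof -
  define w where "w x = (u x + Tminus c u x) / 2" for x
  note bu = subsolution_Tminus_Tplus_bounds[OF u]
  have w: "subsolution c w" unfolding w_def[abs_def] by (rule subsolution_midpoint[OF u])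
  note Pw = subsolution_Tplus[OF w] and bw = subsolution_Tminus_Tplus_bounds[OF w]
  have uw: "u x \<le> w x" for x using bu(2)[of x] by (simp add: w_def)
  have Pu: "Tplus c u x \<le> Tplus c w x" for x
    by (rule Tplus_le) (use le_Tplus[OF w, of _ x] uw in \<open>smt (verit)\<close>)
  have wP: "Tplus c w x \<le> (Tplus c u x + u x) / 2" for x
  proof (rule Tplus_le)
    fix y
    show "w y - c x y \<le> (Tplus c u x + u x) / 2"
      using le_Tplus[OF u, of y x] Tminus_le[OF u, of y x] by (simp add: w_def field_simps)
  qed
  have wM: "w x \<le> Tminus c (Tplus c w) x" for x
    by (rule le_Tminus) (use le_Tplus[OF w, of x] in \<open>simp add: algebra_simps\<close>)
  have Mu: "Tminus c (Tplus c w) x \<le> Tminus c u x" for x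
  proof (rule le_Tminus)
    fix y
    show "Tminus c (Tplus c w) x \<le> u y + c y x"
      using Tminus_le[OF Pw, of x y] wP[of y] bu(1)[of y] by simp
  qed
  show thesis
  proof (rule that[OF w])
    fix x
    show "Tplus c w x = u x \<and> Tminus c (Tplus c w) x = u x" if "x \<in> aubry c u"
      using that Pu[of x] wP[of x] Mu[of x] wM[of x] uw[of x] by (auto simp: aubry_def)
    show "Tplus c w x < Tminus c (Tplus c w) x" if "x \<notin> aubry c u"
      using that wP[of x] bu[of x] wM[of x] by (auto simp: aubry_def w_def)
    show "Tplus c w x \<le> Tminus c (Tplus c w) x" using bw(1)[of x] wM[of x] by simp
  qed
qed

theorem theorem3:
  fixes A :: "('m::{t2_space, second_countable_topology}, 'e::euclidean_space) chart set"
    and g :: "('m, 'e) chart \<Rightarrow> 'm \<Rightarrow> 'e \<Rightarrow> 'e \<Rightarrow> real"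
    and c :: "'m \<Rightarrow> 'm \<Rightarrow> real"
    and u :: "'m \<Rightarrow> real"
  assumes "smooth_structure A"
    and "riemannian_metric A g"
    and "connected (UNIV :: 'm set)"
    and "\<And>w. subsolution c w \<Longrightarrow>
           locally_semiconcave A (Tminus c w) \<and> locally_semiconcave A (\<lambda>x. - Tplus c w x)"
    and "subsolution c u"
  shows "\<exists>v. subsolution c v \<and>
           (\<forall>x\<in>aubry c u. v x = u x) \<and>
           smooth_fun_on A (- aubry c u) v \<and>
           (\<forall>x\<in>- aubry c u. free_at c v x) \<and>
           locally_C11 A v \<and>
           (\<forall>x y. strict_at c u x y \<longrightarrow> strict_at c v x y)"
proof -
  note A = assms(1) and sc = assms(4)
  obtain w where w: "subsolution c w"
    and eq: "\<And>x. x \<in> aubry c u \<Longrightarrow> Tplus c w x = u x \<and> Tminus c (Tplus c w) x = u x"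
    and lt: "\<And>x. x \<notin> aubry c u \<Longrightarrow> Tplus c w x < Tminus c (Tplus c w) x"
    and le: "\<And>x. Tplus c w x \<le> Tminus c (Tplus c w) x"
    using free_subsolution[OF assms(5)] by blast
  define a where "a = Tplus c w"
  define b where "b = Tminus c a"
  have a: "subsolution c a" unfolding a_def by (rule subsolution_Tplus[OF w])
  have "semiconcave_at_pt A b x" "semiconcave_at_pt A (\<lambda>y. - a y) x" for x
    using locally_semiconcave_imp_semiconcave_at_pt[OF A] sc[OF a] sc[OF w] by (auto simp: a_def b_def)
  from manifold_insertion[OF A this] le obtain v where
    v: "\<And>y. a y \<le> v y \<and> v y \<le> b y" "\<And>y. a y < b y \<Longrightarrow> a y < v y \<and> v y < b y"
      "\<And>y. semiconcave_at_pt A v y" "\<And>y. semiconcave_at_pt A (\<lambda>y. - v y) y"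
      "\<And>y. a y < b y \<Longrightarrow> smooth_at_pt A v y"
    unfolding a_def b_def by blast
  have sub: "subsolution c v"
    by (rule subsolution_between_above[OF a]) (use v(1) in \<open>auto simp: b_def\<close>)
  have "Tplus c v x \<le> a x" for x
  proof (rule Tplus_le)
    fix y show "v y - c x y \<le> a x" using v(1)[of y] Tminus_le[OF a, of y x] by (simp add: b_def)
  qed
  moreover have "b x \<le> Tminus c v x" for x
  proof (rule le_Tminus)
    fix y show "b x \<le> v y + c y x" using v(1)[of y] Tminus_le[OF a, of x y] by (simp add: b_def)
  qed
  ultimately have free: "free_at c v x" if "x \<notin> aubry c u" for x
    using v(2)[of x] lt[OF that] unfolding free_at_def a_def[symmetric] b_def[symmetric]
    by (meson le_less_trans less_le_trans)
  have aub: "v x = u x" if "x \<in> aubry c u" for x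
    using eq[OF that] v(1)[of x] by (simp add: a_def b_def)
  have strict: "strict_at c v x y" if "strict_at c u x y" for x y
  proof (rule ccontr)
    assume "\<not> strict_at c v x y"
    then have *: "v y - v x \<ge> c x y" by (simp add: strict_at_def)
    have "\<not> free_at c v x" using * le_Tplus[OF sub, of y x] by (simp add: free_at_def)
    moreover have "\<not> free_at c v y" using * Tminus_le[OF sub, of y x] by (simp add: free_at_def)
    ultimately have "v x = u x" "v y = u y" using free aub by blast+
    then show False using * that by (simp add: strict_at_def)
  qed
  have "smooth_fun_on A (- aubry c u) v"
    by (rule smooth_at_pt_imp_smooth_fun_on[OF A]) (use v(5) lt in \<open>auto simp: a_def b_def\<close>)
  moreover have "locally_C11 A v" by (rule semiconcave_at_pt_imp_locally_C11[OF A v(3,4)])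
  ultimately show ?thesis using sub aub free strict by (intro exI[of _ v]) simp
qed

end
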